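(* Let $(f_k)$ be a sequence in $\mathcal L^1_E$ and $f_0\in\mathcal L^1_E$. Then $(f_k)$ converges in the Pettis norm to $f_0$ and is uniformly integrable if and only if (1) $(f_k)$ converges to $f_0$ in the $\sigma(\mathcal L^1_E,\mathcal L^\infty_{E^*})$-topology; (2) $(f_k)$ satisfies the sequential Pettis Bocce criterion; and (3) for each $B\in\mathcal F^+$, the set $\Delta_B:=\{m_B(f_k): k\in\mathbb N\}$ is relatively norm compact in $E$. The equivalence remains valid if condition (3) is replaced by (3') $\lim_k\|m_B(f_k)-m_B(f_0)\|=0$ for each $B\in\mathcal F^+$. Furthermore, if $E^*$ has the Radon–Nikodym property, then (1) is equivalent to (1') $(f_k)$ converges to $f_0$ weakly in $\mathcal L^1_E$.
   Context: $(E,\|\cdot\|)$ is a Banach space with dual $E^*$ and dual closed unit ball $B_{E^*}$, and $(\Omega,\mathcal F,\mu)$ is a probability space. $\mathcal F^+$ is the collection of sets in $\mathcal F$ with strictly positive measure, and for $B\in\mathcal F$, $\mathcal F^+(B)$ is the collection of measurable subsets of $B$ with strictly positive measure. $\mathcal L^1_E$ is the (prequotient) space of Bochner $\mu$-integrable functions $f:\Omega\to E$, with seminorm $\|f\|_1=\int_\Omega\|f\|\,d\mu$. Weak convergence means convergence against every continuous linear functional on $(\mathcal L^1_E,\|\cdot\|_1)$. $\mathcal L^\infty_{E^*}$ is the space of strongly measurable bounded functions $b:\Omega\to E^*$; $\sigma(\mathcal L^1_E,\mathcal L^\infty_{E^*})$ is the topology on $\mathcal L^1_E$ induced by the functionals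 $f\mapsto\int_\Omega\langle f,b\rangle\,d\mu$, $b\in\mathcal L^\infty_{E^*}$. The Pettis (semi)norm on $\mathcal L^1_E$ is $\|f\|_{\text{Pettis}}=\sup_{x^*\in B_{E^*}}\int_\Omega|x^*(f)|\,d\mu$. A subset $K\subset\mathcal L^1_E$ is uniformly integrable if $\lim_{c\to\infty}\sup_{f\in K}\int_{\{\|f\|\ge c\}}\|f\|\,d\mu=0$. For $f\in\mathcal L^1_E$ (or $\mathcal L^1_{\mathbb R}$) and $A\in\mathcal F$, put $m_A(f):=\frac{1}{\mu(A)}\int_A f\,d\mu$ and $\text{Bocce-osc } f|_A:=\frac{1}{\mu(A)}\int_A\|f-m_A(f)\|\,d\mu$ (with $0/0=0$). Put $\text{Pettis-Bocce-osc } f|_A:=\sup_{x^*\in B_{E^*}}\text{Bocce-osc } x^*(f)|_A$. A sequence $(f_k)$ in $\mathcal L^1_E$ satisfies the sequential Pettis Bocce criterion if for each subsequence $(f_{k_j})$, each $\epsilon>0$ and each $B\in\mathcal F^+$ there is $A\in\mathcal F^+(B)$ such that $\liminf_j\text{Pettis-Bocce-osc } f_{k_j}|_A<\epsilon$. *)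

theory Defs
  imports "HOL-Probability.Probability"
begin

section \<open>Bochner integration in an arbitrary Banach space\<close>

text \<open>
  \<^const>\<open>has_bochner_integral\<close> is available only for second countable (i.e. separable) target
  spaces, and \<^term>\<open>borel_measurable M\<close> is too weak a notion of measurability outside that
  class.  The definitions below replace Borel measurability by strong measurability (being an
  almost everywhere limit of simple functions) and otherwise copy the library; see
  \<open>has_Bochner_int_of_has_bochner_integral\<close>.
  Note that \<^term>\<open>nn_integral M u\<close> only depends on the almost-everywhere class of \<open>u\<close>
  (\<open>nn_integral_cong_AE\<close> has no measurability premise), so it may be applied to functions
  that are merely almost everywhere equal to a measurable one.
\<close>

definition strongly_measurable :: "'w measure \<Rightarrow> ('w \<Rightarrow> 'b::real_normed_vector) \<Rightarrow> bool" where
  "strongly_measurable M f \<longleftrightarrow>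
     (\<exists>s. (\<forall>i. simple_function M (s i)) \<and> (AE w in M. (\<lambda>i::nat. s i w) \<longlonglongrightarrow> f w))"

definition has_Bochner_int :: "'w measure \<Rightarrow> ('w \<Rightarrow> 'b::real_normed_vector) \<Rightarrow> 'b \<Rightarrow> bool" where
  "has_Bochner_int M f I \<longleftrightarrow> strongly_measurable M f \<and>
     (\<exists>s. (\<forall>i::nat. Bochner_Integration.simple_bochner_integrable M (s i)) \<and>
          (\<lambda>i. \<integral>\<^sup>+w. ennreal (norm (f w - s i w)) \<partial>M) \<longlonglongrightarrow> 0 \<and>
          (\<lambda>i. Bochner_Integration.simple_bochner_integral M (s i)) \<longlonglongrightarrow> I)"

definition Bochner_integrable :: "'w measure \<Rightarrow> ('w \<Rightarrow> 'b::real_normed_vector) \<Rightarrow> bool" where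
  "Bochner_integrable M f \<longleftrightarrow> (\<exists>I. has_Bochner_int M f I)"

definition Bochner_int :: "'w measure \<Rightarrow> ('w \<Rightarrow> 'b::real_normed_vector) \<Rightarrow> 'b" where
  "Bochner_int M f = (if Bochner_integrable M f then THE I. has_Bochner_int M f I else 0)"

definition Bochner_set_int ::
    "'w measure \<Rightarrow> 'w set \<Rightarrow> ('w \<Rightarrow> 'b::real_normed_vector) \<Rightarrow> 'b" where
  "Bochner_set_int M A f = Bochner_int M (\<lambda>w. indicator A w *\<^sub>R f w)"

lemma has_Bochner_int_unique:
  fixes f :: "'w \<Rightarrow> 'b::real_normed_vector"
  assumes "has_Bochner_int M f x" "has_Bochner_int M f y"
  shows "x = y"
proof -
  obtain \<sigma> where \<sigma>: "\<And>i. simple_function M (\<sigma> i)"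
    and lim: "AE w in M. (\<lambda>i::nat. \<sigma> i w) \<longlonglongrightarrow> f w"
    using assms(1) unfolding has_Bochner_int_def strongly_measurable_def by blast
  obtain s where s: "\<And>i::nat. Bochner_Integration.simple_bochner_integrable M (s i)"
    and s0: "(\<lambda>i. \<integral>\<^sup>+w. ennreal (norm (f w - s i w)) \<partial>M) \<longlonglongrightarrow> 0"
    and sI: "(\<lambda>i. Bochner_Integration.simple_bochner_integral M (s i)) \<longlonglongrightarrow> x"
    using assms(1) unfolding has_Bochner_int_def by blast
  obtain t where t: "\<And>i::nat. Bochner_Integration.simple_bochner_integrable M (t i)"
    and t0: "(\<lambda>i. \<integral>\<^sup>+w. ennreal (norm (f w - t i w)) \<partial>M) \<longlonglongrightarrow> 0"
    and tI: "(\<lambda>i. Bochner_Integration.simple_bochner_integral M (t i)) \<longlonglongrightarrow> y"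
    using assms(2) unfolding has_Bochner_int_def by blast
  have meas: "\<exists>u\<in>borel_measurable M. AE w in M. u w = ennreal (norm (f w - r w))"
    if r: "Bochner_Integration.simple_bochner_integrable M r" for r
  proof -
    have rs: "simple_function M r"
      using r by (auto elim: simple_bochner_integrable.cases)
    have m: "(\<lambda>w. norm (\<sigma> n w - r w)) \<in> borel_measurable M" for n
      using simple_function_compose2[OF \<sigma>[of n] rs, of "\<lambda>a b. norm (a - b)"]
      by (rule borel_measurable_simple_function)
    then have "(\<lambda>w. ennreal (lim (\<lambda>n. norm (\<sigma> n w - r w)))) \<in> borel_measurable M"
      by measurable
    moreover have "AE w in M. ennreal (lim (\<lambda>n. norm (\<sigma> n w - r w))) = ennreal (norm (f w - r w))"
      using lim
    proof eventually_elim
      case (elim w)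
      then have "(\<lambda>n. norm (\<sigma> n w - r w)) \<longlonglongrightarrow> norm (f w - r w)"
        by (intro tendsto_intros)
      then show ?case by (simp add: limI)
    qed
    ultimately show ?thesis
      by (intro bexI[of _ "\<lambda>w. ennreal (lim (\<lambda>n. norm (\<sigma> n w - r w)))"])
  qed
  have bound: "ennreal (norm (Bochner_Integration.simple_bochner_integral M (s i) - Bochner_Integration.simple_bochner_integral M (t i))) \<le>
      (\<integral>\<^sup>+w. ennreal (norm (f w - s i w)) \<partial>M) + (\<integral>\<^sup>+w. ennreal (norm (f w - t i w)) \<partial>M)" for i
  proof -
    obtain u where u: "u \<in> borel_measurable M" "AE w in M. u w = ennreal (norm (f w - s i w))"
      using meas[OF s[of i]] by blast
    obtain v where v: "v \<in> borel_measurable M" "AE w in M. v w = ennreal (norm (f w - t i w))"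
      using meas[OF t[of i]] by blast
    have "ennreal (norm (Bochner_Integration.simple_bochner_integral M (s i) - Bochner_Integration.simple_bochner_integral M (t i))) =
        norm (Bochner_Integration.simple_bochner_integral M (\<lambda>x. s i x - t i x))"
      using s t by (subst simple_bochner_integral_diff) auto
    also have "\<dots> \<le> Bochner_Integration.simple_bochner_integral M (\<lambda>x. norm (s i x - t i x))"
      using simple_bochner_integrable_compose2[of "(-)" M "s i" "t i"] s t
      by (auto intro!: simple_bochner_integral_norm_bound)
    also have "\<dots> = (\<integral>\<^sup>+x. norm (s i x - t i x) \<partial>M)"
      using simple_bochner_integrable_compose2[of "\<lambda>x y. norm (x - y)" M "s i" "t i"] s t
      by (auto intro!: simple_bochner_integral_eq_nn_integral)
    also have "\<dots> \<le> (\<integral>\<^sup>+x. u x + v x \<partial>M)"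
    proof (rule nn_integral_mono_AE)
      show "AE x in M. ennreal (norm (s i x - t i x)) \<le> u x + v x"
        using u(2) v(2)
      proof eventually_elim
        case (elim x)
        have "norm (s i x - t i x) \<le> norm (f x - s i x) + norm (f x - t i x)"
          by (metis dual_order.refl norm_diff_triangle_le norm_minus_commute)
        then show ?case
          unfolding elim by (metis ennreal_leI ennreal_plus norm_ge_zero)
      qed
    qed
    also have "\<dots> = (\<integral>\<^sup>+x. u x \<partial>M) + (\<integral>\<^sup>+x. v x \<partial>M)"
      using u v by (intro nn_integral_add)
    also have "\<dots> = (\<integral>\<^sup>+w. ennreal (norm (f w - s i w)) \<partial>M) + (\<integral>\<^sup>+w. ennreal (norm (f w - t i w)) \<partial>M)"
      using nn_integral_cong_AE[OF u(2)] nn_integral_cong_AE[OF v(2)] by simp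
    finally show ?thesis .
  qed
  have "(\<lambda>i. ennreal (norm (Bochner_Integration.simple_bochner_integral M (s i) - Bochner_Integration.simple_bochner_integral M (t i)))) \<longlonglongrightarrow> 0"
    by (rule tendsto_sandwich[OF _ always_eventually[OF allI[OF bound]] tendsto_const])
       (use tendsto_add[OF s0 t0] in auto)
  then have "(\<lambda>i. norm (Bochner_Integration.simple_bochner_integral M (s i) - Bochner_Integration.simple_bochner_integral M (t i))) \<longlonglongrightarrow> 0"
    by (simp flip: ennreal_0)
  moreover have "(\<lambda>i. norm (Bochner_Integration.simple_bochner_integral M (s i) - Bochner_Integration.simple_bochner_integral M (t i))) \<longlonglongrightarrow> norm (x - y)"
    using sI tI by (intro tendsto_intros)
  ultimately have "norm (x - y) = 0"
    using LIMSEQ_unique by blast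
  then show ?thesis by simp
qed

lemma Bochner_int_eq: "has_Bochner_int M f I \<Longrightarrow> Bochner_int M f = I"
  unfolding Bochner_int_def Bochner_integrable_def
  by (auto intro: has_Bochner_int_unique)

lemma has_Bochner_int_of_has_bochner_integral:
  fixes f :: "'w \<Rightarrow> 'b::{real_normed_vector, second_countable_topology}"
  assumes "has_bochner_integral M f I"
  shows "has_Bochner_int M f I"
proof -
  have "f \<in> borel_measurable M"
    using assms by (auto elim: has_bochner_integral.cases)
  then obtain F where "\<forall>i. simple_function M (F i)" "\<forall>x\<in>space M. (\<lambda>i::nat. F i x) \<longlonglongrightarrow> f x"
    using borel_measurable_implies_sequence_metric[of f M 0] by blast
  then have "strongly_measurable M f"
    unfolding strongly_measurable_def by (intro exI[of _ F]) auto
  then show ?thesis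
    using assms unfolding has_Bochner_int_def
    by (auto elim!: has_bochner_integral.cases)
qed

lemma Bochner_int_eq_lebesgue_integral:
  fixes f :: "'w \<Rightarrow> 'b::{banach, second_countable_topology}"
  assumes "integrable M f"
  shows "Bochner_int M f = integral\<^sup>L M f"
  using assms has_Bochner_int_of_has_bochner_integral Bochner_int_eq has_bochner_integral_integrable
  by blast


section \<open>The spaces $L^1_E$ and $L^\infty_{E^*}$ and their topologies\<close>

text \<open>The dual space of \<^typ>\<open>'a\<close> is \<^typ>\<open>'a \<Rightarrow>\<^sub>L real\<close> with the operator norm.\<close>

definition L1_space :: "'w measure \<Rightarrow> ('w \<Rightarrow> 'a::real_normed_vector) set" where
  "L1_space M = {f. Bochner_integrable M f}"

definition L1_norm :: "'w measure \<Rightarrow> ('w \<Rightarrow> 'a::real_normed_vector) \<Rightarrow> ennreal" where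
  "L1_norm M f = (\<integral>\<^sup>+w. ennreal (norm (f w)) \<partial>M)"

definition Linf_dual :: "'w measure \<Rightarrow> ('w \<Rightarrow> ('a::real_normed_vector \<Rightarrow>\<^sub>L real)) set" where
  "Linf_dual M = {b. strongly_measurable M b \<and> bounded (b ` space M)}"

definition dual_pairing ::
    "'w measure \<Rightarrow> ('w \<Rightarrow> 'a::real_normed_vector) \<Rightarrow> ('w \<Rightarrow> ('a \<Rightarrow>\<^sub>L real)) \<Rightarrow> real" where
  "dual_pairing M f b = Bochner_int M (\<lambda>w. blinfun_apply (b w) (f w))"

definition sigma_L1_Linf :: "'w measure \<Rightarrow> ('w \<Rightarrow> 'a::real_normed_vector) topology" where
  "sigma_L1_Linf M = topology_generated_by
     {{f \<in> L1_space M. dual_pairing M f b \<in> U} | b U. b \<in> Linf_dual M \<and> open U}"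

definition L1_continuous_linear_functional ::
    "'w measure \<Rightarrow> (('w \<Rightarrow> 'a::real_normed_vector) \<Rightarrow> real) \<Rightarrow> bool" where
  "L1_continuous_linear_functional M \<phi> \<longleftrightarrow>
     (\<forall>f\<in>L1_space M. \<forall>g\<in>L1_space M. \<phi> (\<lambda>w. f w + g w) = \<phi> f + \<phi> g) \<and>
     (\<forall>c. \<forall>f\<in>L1_space M. \<phi> (\<lambda>w. c *\<^sub>R f w) = c * \<phi> f) \<and>
     (\<forall>f\<in>L1_space M. \<forall>e>0. \<exists>d>0. \<forall>g\<in>L1_space M.
        L1_norm M (\<lambda>w. g w - f w) < ennreal d \<longrightarrow> \<bar>\<phi> g - \<phi> f\<bar> < e)"

definition L1_weakly_convergent ::
    "'w measure \<Rightarrow> (nat \<Rightarrow> 'w \<Rightarrow> 'a::real_normed_vector) \<Rightarrow> ('w \<Rightarrow> 'a) \<Rightarrow> bool" where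
  "L1_weakly_convergent M f f0 \<longleftrightarrow>
     (\<forall>\<phi>. L1_continuous_linear_functional M \<phi> \<longrightarrow> (\<lambda>k. \<phi> (f k)) \<longlonglongrightarrow> \<phi> f0)"

definition Pettis_norm :: "'w measure \<Rightarrow> ('w \<Rightarrow> 'a::real_normed_vector) \<Rightarrow> ennreal" where
  "Pettis_norm M f =
     (SUP x\<in>cball (0 :: 'a \<Rightarrow>\<^sub>L real) 1. \<integral>\<^sup>+w. ennreal \<bar>blinfun_apply x (f w)\<bar> \<partial>M)"

definition uniformly_integrable ::
    "'w measure \<Rightarrow> ('w \<Rightarrow> 'a::real_normed_vector) set \<Rightarrow> bool" where
  "uniformly_integrable M K \<longleftrightarrow>
     ((\<lambda>c::real. SUP f\<in>K. \<integral>\<^sup>+w\<in>{w \<in> space M. c \<le> norm (f w)}. ennreal (norm (f w)) \<partial>M)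
        \<longlongrightarrow> 0) at_top"


section \<open>The sequential Pettis Bocce criterion\<close>

definition pos_sets :: "'w measure \<Rightarrow> 'w set set" where
  "pos_sets M = {A \<in> sets M. emeasure M A > 0}"

definition pos_subsets :: "'w measure \<Rightarrow> 'w set \<Rightarrow> 'w set set" where
  "pos_subsets M B = {A \<in> pos_sets M. A \<subseteq> B}"

definition mean_on :: "'w measure \<Rightarrow> 'w set \<Rightarrow> ('w \<Rightarrow> 'a::real_normed_vector) \<Rightarrow> 'a" where
  "mean_on M A f = (1 / measure M A) *\<^sub>R Bochner_set_int M A f"

text \<open>The convention $0/0=0$ holds in \<^typ>\<open>ennreal\<close>.\<close>

definition Bocce_osc :: "'w measure \<Rightarrow> ('w \<Rightarrow> 'a::real_normed_vector) \<Rightarrow> 'w set \<Rightarrow> ennreal" where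
  "Bocce_osc M f A = (\<integral>\<^sup>+w\<in>A. ennreal (norm (f w - mean_on M A f)) \<partial>M) / emeasure M A"

definition Pettis_Bocce_osc ::
    "'w measure \<Rightarrow> ('w \<Rightarrow> 'a::real_normed_vector) \<Rightarrow> 'w set \<Rightarrow> ennreal" where
  "Pettis_Bocce_osc M f A =
     (SUP x\<in>cball (0 :: 'a \<Rightarrow>\<^sub>L real) 1. Bocce_osc M (\<lambda>w. blinfun_apply x (f w)) A)"

definition seq_Pettis_Bocce ::
    "'w measure \<Rightarrow> (nat \<Rightarrow> 'w \<Rightarrow> 'a::real_normed_vector) \<Rightarrow> bool" where
  "seq_Pettis_Bocce M f \<longleftrightarrow>
     (\<forall>r::nat \<Rightarrow> nat. strict_mono r \<longrightarrow>
       (\<forall>e::real. e > 0 \<longrightarrow> (\<forall>B\<in>pos_sets M. \<exists>A\<in>pos_subsets M B.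
          liminf (\<lambda>j. Pettis_Bocce_osc M (f (r j)) A) < ennreal e)))"


section \<open>The Radon-Nikodym property\<close>

definition vector_measure :: "'w measure \<Rightarrow> ('w set \<Rightarrow> 'b::real_normed_vector) \<Rightarrow> bool" where
  "vector_measure N G \<longleftrightarrow>
     (\<forall>A :: nat \<Rightarrow> 'w set. range A \<subseteq> sets N \<longrightarrow> disjoint_family A \<longrightarrow>
        (\<lambda>i. G (A i)) sums G (\<Union>i. A i))"

definition vm_bounded_variation ::
    "'w measure \<Rightarrow> ('w set \<Rightarrow> 'b::real_normed_vector) \<Rightarrow> bool" where
  "vm_bounded_variation N G \<longleftrightarrow>
     (\<exists>C::real. \<forall>P. finite P \<longrightarrow> P \<subseteq> sets N \<longrightarrow> partition_on (space N) P \<longrightarrow>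
        (\<Sum>A\<in>P. norm (G A)) \<le> C)"

definition vm_continuous :: "'w measure \<Rightarrow> ('w set \<Rightarrow> 'b::real_normed_vector) \<Rightarrow> bool" where
  "vm_continuous N G \<longleftrightarrow>
     (\<forall>e::real. e > 0 \<longrightarrow>
       (\<exists>d::real. d > 0 \<and> (\<forall>A\<in>sets N. emeasure N A < ennreal d \<longrightarrow> norm (G A) < e)))"

definition has_RNP_wrt :: "'w measure \<Rightarrow> 'b::banach itself \<Rightarrow> bool" where
  "has_RNP_wrt N _ \<longleftrightarrow>
     (\<forall>G :: 'w set \<Rightarrow> 'b.
        vector_measure N G \<and> vm_bounded_variation N G \<and> vm_continuous N G \<longrightarrow>
        (\<exists>g\<in>L1_space N. \<forall>A\<in>sets N. G A = Bochner_set_int N A g))"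

text \<open>
  The Radon-Nikodym property quantifies over all finite measure spaces.  As HOL has no
  quantification over types, the type \<^typ>\<open>'w\<close> carrying these measure spaces (with arbitrary
  underlying sets and sigma-algebras) is a parameter.  For every \<^typ>\<open>'w\<close> the property
  below is implied by the unrestricted one.
\<close>

definition has_RNP :: "'w itself \<Rightarrow> 'b::banach itself \<Rightarrow> bool" where
  "has_RNP _ B \<longleftrightarrow> (\<forall>N :: 'w measure. finite_measure N \<longrightarrow> has_RNP_wrt N B)"

end

theory Submission
  imports Defs
begin

text \<open>
  A gliding hump argument shows that a \<open>\<sigma>(L\<^sup>1\<^sub>E, L\<^sup>\<infinity>\<^sub>E\<^sub>*)\<close>-convergent sequence is uniformly integrable.
  The Bocce criterion, applied to subsequences, yields a set \<open>A\<close> of positive measure on which infinitely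
  many \<open>f\<^sub>k\<close> have small Pettis oscillation; once the means \<open>m\<^sub>A(f\<^sub>k)\<close> converge in norm, \<open>f\<^sub>k - f\<^sub>0\<close> is small
  on \<open>A\<close> in the Pettis norm.  A greedy exhaustion with a diagonal subsequence covers almost all of the
  space by such sets, and uniform integrability takes care of the remainder.  Conversely, the weak
  convergence follows from Pettis convergence by approximating \<open>b\<close> by simple functions, with uniform
  integrability controlling the error.  Under the Radon-Nikodym property, a continuous functional
  \<open>\<phi>\<close> is represented by the density of the vector measure \<open>A \<mapsto> (x \<mapsto> \<phi>(1\<^sub>A x))\<close>.
\<close>

section \<open>Norming functionals\<close>

text \<open>The obstacle is that the Bocce criterion yields a set which depends on the subsequence
  and is good only for infinitely many of its indices, while the functional witnessing a large
  Pettis norm changes with \<open>k\<close>. Hence the argument by contradiction inside an infinite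
  set of bad indices, where goodness of a set means a bound for all functionals of the dual ball at
  once. The criterion says nothing about \<open>f_0\<close>; its oscillation is made small by
  passing to a set on which \<open>f_0\<close> is almost constant. Since \<open>E\<close> need not
  be separable, functions are replaced by everywhere limits of simple functions, and differences of
  means are estimated through norming functionals. The gliding hump is in substance a Baire category
  argument in the unit ball of bounded dual-valued functions, which is complete for the
  \<open>L^1\<close> metric; the bounds obtained on a small ball are carried to small sets by
  pasting and to global \<open>L^1\<close> bounds by convex combination.\<close>

definition sublinear :: "('a::real_vector \<Rightarrow> real) \<Rightarrow> bool" where
  "sublinear p \<longleftrightarrow> (\<forall>x y. p (x + y) \<le> p x + p y) \<and> (\<forall>c>0. \<forall>x. p (c *\<^sub>R x) \<le> c * p x) \<and> p 0 = 0"

text \<open>The reverse inequality comes from applying the defining one to \<open>inverse c\<close>.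
  A function built as an infimum therefore needs only the easy direction to count as
  sublinear.\<close>

lemma sublinear_scaleR:
  assumes "sublinear p" "0 \<le> c"
  shows "p (c *\<^sub>R x) = c * p x"
proof (cases "c = 0")
  case False
  with assms(2) have c: "c > 0" by simp
  have "p (inverse c *\<^sub>R (c *\<^sub>R x)) \<le> inverse c * p (c *\<^sub>R x)"
    using assms(1) c unfolding sublinear_def by (metis positive_imp_inverse_positive)
  then have "c * p x \<le> p (c *\<^sub>R x)"
    using c by (simp add: field_simps)
  moreover have "p (c *\<^sub>R x) \<le> c * p x"
    using assms(1) c unfolding sublinear_def by blast
  ultimately show ?thesis by simp
qed (use assms in \<open>auto simp: sublinear_def\<close>)

lemma sublinear_add: "sublinear p \<Longrightarrow> p (x + y) \<le> p x + p y"
  by (simp add: sublinear_def)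

lemma sublinear_uminus: "sublinear p \<Longrightarrow> - p (- x) \<le> p x"
  using sublinear_add[of p x "- x"] by (simp add: sublinear_def)

text \<open>\<open>q\<close> is the infimum of \<open>p (x + t y) - t p y\<close> over
  \<open>t \<ge> 0\<close>: \<open>t = 0\<close> gives \<open>q \<le> p\<close>,
  \<open>t = 1\<close> the last claim, and \<open>- p (- x)\<close> bounds the family below. It is
  subadditive because the parameters of two summands may be added. If \<open>p\<close> is minimal
  then \<open>q = p\<close>, and the last claim reads
  \<open>p x + p y \<le> p (x + y)\<close>.\<close>

lemma sublinear_directional_minorant:
  assumes p: "sublinear p"
  shows "\<exists>q. sublinear q \<and> q \<le> p \<and> (\<forall>x. q x \<le> p (x + y) - p y)"
proof -
  define q where "q x = (INF t\<in>{0::real..}. p (x + t *\<^sub>R y) - t * p y)" for x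
  have bdd: "bdd_below ((\<lambda>t. p (x + t *\<^sub>R y) - t * p y) ` {0..})" for x
  proof (rule bdd_belowI2)
    fix t :: real assume "t \<in> {0..}"
    then have "t * p y = p (t *\<^sub>R y)" using sublinear_scaleR[OF p, of t y] by simp
    also have "\<dots> \<le> p (x + t *\<^sub>R y) + p (- x)"
      using sublinear_add[OF p, of "x + t *\<^sub>R y" "- x"] by simp
    finally show "- p (- x) \<le> p (x + t *\<^sub>R y) - t * p y" by simp
  qed
  have q_le: "q x \<le> p (x + t *\<^sub>R y) - t * p y" if "t \<ge> 0" for x t
    unfolding q_def using bdd that by (intro cINF_lower) auto
  have le_q: "a \<le> q x" if "\<And>t. t \<ge> 0 \<Longrightarrow> a \<le> p (x + t *\<^sub>R y) - t * p y" for a x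
    unfolding q_def using that by (intro cINF_greatest) auto
  have "q (x + x') \<le> q x + q x'" for x x'
  proof -
    have "q (x + x') - q x' \<le> q x"
    proof (rule le_q)
      fix t :: real assume t: "t \<ge> 0"
      have "q (x + x') - (p (x + t *\<^sub>R y) - t * p y) \<le> q x'"
      proof (rule le_q)
        fix s :: real assume s: "s \<ge> 0"
        have "q (x + x') \<le> p ((x + x') + (s + t) *\<^sub>R y) - (s + t) * p y"
          using s t by (intro q_le) auto
        moreover have "p ((x + x') + (s + t) *\<^sub>R y) \<le> p (x + t *\<^sub>R y) + p (x' + s *\<^sub>R y)"
          using sublinear_add[OF p, of "x + t *\<^sub>R y" "x' + s *\<^sub>R y"] by (simp add: algebra_simps)
        ultimately show "q (x + x') - (p (x + t *\<^sub>R y) - t * p y) \<le> p (x' + s *\<^sub>R y) - s * p y"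
          by (simp add: algebra_simps)
      qed
      then show "q (x + x') - q x' \<le> p (x + t *\<^sub>R y) - t * p y" by simp
    qed
    then show ?thesis by simp
  qed
  moreover have "q (c *\<^sub>R x) \<le> c * q x" if c: "c > 0" for c x
  proof -
    have "q (c *\<^sub>R x) / c \<le> q x"
    proof (rule le_q)
      fix t :: real assume t: "t \<ge> 0"
      have "q (c *\<^sub>R x) \<le> p (c *\<^sub>R x + (c * t) *\<^sub>R y) - (c * t) * p y"
        using c t by (intro q_le) auto
      also have "p (c *\<^sub>R x + (c * t) *\<^sub>R y) = c * p (x + t *\<^sub>R y)"
        using sublinear_scaleR[OF p, of c "x + t *\<^sub>R y"] c by (simp add: algebra_simps)
      finally show "q (c *\<^sub>R x) / c \<le> p (x + t *\<^sub>R y) - t * p y"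
        using c by (simp add: field_simps)
    qed
    then show ?thesis using c by (simp add: field_simps)
  qed
  moreover have "q 0 = 0"
    using q_le[of 0 0] le_q[of 0 0] sublinear_scaleR[OF p] p
    by (intro antisym) (auto simp: sublinear_def)
  ultimately have "sublinear q" unfolding sublinear_def by blast
  moreover have "q \<le> p" using q_le[of 0] by (auto simp: le_fun_def)
  moreover have "q x \<le> p (x + y) - p y" for x using q_le[of 1 x] by simp
  ultimately show ?thesis by blast
qed

text \<open>Zorn's lemma for the reversed order. The pointwise infimum of a chain is finite since
  \<open>- p (- x) \<le> q x\<close> for every sublinear \<open>q \<le> p\<close>, and it is
  subadditive since of two members of a chain one lies below both.\<close>

lemma exists_minimal_sublinear:
  fixes p :: "'a::real_vector \<Rightarrow> real"
  assumes p: "sublinear p"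
  shows "\<exists>m. sublinear m \<and> m \<le> p \<and> (\<forall>q. sublinear q \<longrightarrow> q \<le> m \<longrightarrow> q = m)"
proof -
  define S where "S = {q. sublinear q \<and> q \<le> p}"
  have "\<exists>m\<in>S. \<forall>q\<in>S. q \<le> m \<longrightarrow> q = m"
  proof (rule predicate_Zorn[where P = "\<lambda>a b. b \<le> a"])
    show "partial_order_on S (relation_of (\<lambda>a b. b \<le> a) S)"
      by (rule partial_order_on_relation_ofI) auto
    fix C assume C: "C \<in> Chains (relation_of (\<lambda>a b. b \<le> a) S)"
    then have CS: "C \<subseteq> S" and tot: "\<And>a b. a \<in> C \<Longrightarrow> b \<in> C \<Longrightarrow> a \<le> b \<or> b \<le> a"
      by (auto simp: Chains_def relation_of_def)
    show "\<exists>u\<in>S. \<forall>a\<in>C. u \<le> a"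
    proof (cases "C = {}")
      case True
      then show ?thesis using p by (auto simp: S_def)
    next
      case False
      define u where "u x = (INF q\<in>C. q x)" for x
      have bdd: "bdd_below ((\<lambda>q. q x) ` C)" for x
      proof (rule bdd_belowI2)
        fix q assume "q \<in> C"
        then have "sublinear q" "q (- x) \<le> p (- x)" using CS by (auto simp: S_def le_fun_def)
        then show "- p (- x) \<le> q x" using sublinear_uminus[of q x] by simp
      qed
      have u_le: "u x \<le> q x" if "q \<in> C" for x q
        unfolding u_def using bdd that by (intro cINF_lower) auto
      have le_u: "a \<le> u x" if "\<And>q. q \<in> C \<Longrightarrow> a \<le> q x" for a x
        unfolding u_def using that False by (intro cINF_greatest) auto
      have sub: "sublinear q" if "q \<in> C" for q using that CS by (auto simp: S_def)
      have "u (x + y) \<le> u x + u y" for x y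
      proof -
        have "u (x + y) - u y \<le> u x"
        proof (rule le_u)
          fix q assume q: "q \<in> C"
          have "u (x + y) - q x \<le> u y"
          proof (rule le_u)
            fix r assume r: "r \<in> C"
            obtain s where s: "s \<in> C" "s \<le> q" "s \<le> r" using tot[OF q r] q r by blast
            have "u (x + y) \<le> s x + s y"
              using u_le[OF s(1), of "x + y"] sublinear_add[OF sub[OF s(1)], of x y] by simp
            also have "\<dots> \<le> q x + r y" using s by (auto simp: le_fun_def intro: add_mono)
            finally show "u (x + y) - q x \<le> r y" by simp
          qed
          then show "u (x + y) - u y \<le> q x" by simp
        qed
        then show ?thesis by simp
      qed
      moreover have "u (c *\<^sub>R x) \<le> c * u x" if c: "c > 0" for c x
      proof -
        have "u (c *\<^sub>R x) / c \<le> u x"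
        proof (rule le_u)
          fix q assume q: "q \<in> C"
          show "u (c *\<^sub>R x) / c \<le> q x"
            using u_le[OF q, of "c *\<^sub>R x"] sublinear_scaleR[OF sub[OF q], of c x] c
            by (simp add: field_simps)
        qed
        then show ?thesis using c by (simp add: field_simps)
      qed
      moreover have "u 0 = 0"
      proof -
        have "(INF q\<in>C. q 0) = (INF q\<in>C. 0 :: real)"
          using sub by (intro INF_cong) (auto simp: sublinear_def)
        then show ?thesis using False by (simp add: u_def)
      qed
      ultimately have "sublinear u" unfolding sublinear_def by blast
      moreover have "u \<le> q" if "q \<in> C" for q using u_le[OF that] by (simp add: le_fun_def)
      moreover have "u \<le> p"
      proof -
        obtain q where q: "q \<in> C" using False by blast
        have "u \<le> q" using u_le[OF q] by (simp add: le_fun_def)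
        also have "q \<le> p" using q CS by (auto simp: S_def)
        finally show ?thesis .
      qed
      ultimately show ?thesis by (auto simp: S_def)
    qed
  qed
  then show ?thesis unfolding S_def by (auto intro: order_trans)
qed

text \<open>Hahn-Banach without extensions from subspaces: a minimal sublinear function is linear,
  because its directional minorants cannot be strictly smaller.\<close>

lemma exists_norming_functional:
  fixes x :: "'a::real_normed_vector"
  shows "\<exists>\<phi> :: 'a \<Rightarrow>\<^sub>L real. norm \<phi> \<le> 1 \<and> blinfun_apply \<phi> x = norm x"
proof -
  have "sublinear (norm :: 'a \<Rightarrow> real)"
    by (auto simp: sublinear_def norm_triangle_ineq)
  \<comment> \<open>Lowering the norm in direction \<open>x\<close> before minimising forces
    \<open>p (- x) \<le> - norm x\<close>; every linear minorant of \<open>p\<close> then takes the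
    value \<open>norm x\<close> at \<open>x\<close>.\<close>
  from sublinear_directional_minorant[OF this, of x]
  obtain p :: "'a \<Rightarrow> real" where p: "sublinear p" "p \<le> norm" "\<And>z. p z \<le> norm (z + x) - norm x"
    by blast
  from exists_minimal_sublinear[OF p(1)]
  obtain m where m: "sublinear m" "m \<le> p" "\<And>q. sublinear q \<Longrightarrow> q \<le> m \<Longrightarrow> q = m" by blast
  have add: "m (y + z) = m y + m z" for y z
  proof -
    obtain q where q: "sublinear q" "q \<le> m" "\<And>w. q w \<le> m (w + z) - m z"
      using sublinear_directional_minorant[OF m(1), of z] by blast
    then have "m y \<le> m (y + z) - m z" using m(3) by metis
    then show ?thesis using sublinear_add[OF m(1), of y z] by simp
  qed
  have m0: "m 0 = 0" using m(1) by (simp add: sublinear_def)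
  have neg: "m (- z) = - m z" for z using add[of z "- z"] m0 by simp
  have scale: "m (c *\<^sub>R z) = c * m z" for c z
  proof (cases "c \<ge> 0")
    case False
    then show ?thesis using neg[of "c *\<^sub>R z"] sublinear_scaleR[OF m(1), of "- c" z] by simp
  qed (simp add: sublinear_scaleR[OF m(1)])
  have le: "m z \<le> norm z" for z using m(2) p(2) by (auto simp: le_fun_def intro: order_trans)
  have abs: "\<bar>m z\<bar> \<le> norm z" for z using le[of z] le[of "- z"] neg[of z] by simp
  have lin: "bounded_linear m"
    by (rule bounded_linear_intro[of _ 1]) (auto simp: add scale abs)
  have "m (- x) \<le> - norm x"
    using p(3)[of "- x"] le_funD[OF m(2), of "- x"] by simp
  then have "m x = norm x" using neg[of x] le[of x] by simp
  moreover have "norm (Blinfun m) \<le> 1"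
    using abs by (intro norm_blinfun_bound) (auto simp: bounded_linear_Blinfun_apply[OF lin])
  ultimately show ?thesis
    using bounded_linear_Blinfun_apply[OF lin] by metis
qed

text \<open>A bare choice, with no measurability in \<open>x\<close>. Inside integrals it is only
  composed with simple functions, whose finite range makes the composition simple again.\<close>

definition norming :: "'a::real_normed_vector \<Rightarrow> ('a \<Rightarrow>\<^sub>L real)" where
  "norming x = (SOME \<phi>. norm \<phi> \<le> 1 \<and> blinfun_apply \<phi> x = norm x)"

lemma norm_norming: "norm (norming x) \<le> 1" and norming_self: "blinfun_apply (norming x) x = norm x"
  unfolding norming_def using someI_ex[OF exists_norming_functional[of x]] by auto

lemma abs_blinfun_le: "norm \<phi> \<le> 1 \<Longrightarrow> \<bar>blinfun_apply \<phi> x\<bar> \<le> norm x"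
  for \<phi> :: "'a::real_normed_vector \<Rightarrow>\<^sub>L real"
  using norm_blinfun[of \<phi> x] mult_right_mono[of "norm \<phi>" 1 "norm x"] by simp

text \<open>Through this rule a norm estimate for Bochner means becomes a family of estimates for
  scalar Lebesgue integrals.\<close>

lemma norm_le_dual: "(\<And>\<phi> :: 'a \<Rightarrow>\<^sub>L real. norm \<phi> \<le> 1 \<Longrightarrow> blinfun_apply \<phi> x \<le> C) \<Longrightarrow> norm x \<le> C"
  for x :: "'a::real_normed_vector"
  using norm_norming[of x] norming_self[of x] by metis

section \<open>Limits of simple functions and their Bochner integrals\<close>

text \<open>Convergence is required at every point of the space, in contrast to
  \<open>strongly_measurable\<close>. Norms and pairings of such functions are therefore Borel
  measurable as they stand, with no exceptional null set, whatever the size of the target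
  space.\<close>

definition simple_limit :: "'w measure \<Rightarrow> ('w \<Rightarrow> 'b::topological_space) \<Rightarrow> bool" where
  "simple_limit M f \<longleftrightarrow>
     (\<exists>s. (\<forall>i::nat. simple_function M (s i)) \<and> (\<forall>w\<in>space M. (\<lambda>i. s i w) \<longlonglongrightarrow> f w))"

lemma simple_limit_simple_function: "simple_function M f \<Longrightarrow> simple_limit M f"
  unfolding simple_limit_def by (intro exI[of _ "\<lambda>_. f"]) auto

lemma simple_limit_compose2:
  assumes "simple_limit M f" "simple_limit M g"
    and h: "\<And>x y s t. s \<longlonglongrightarrow> x \<Longrightarrow> t \<longlonglongrightarrow> y \<Longrightarrow> (\<lambda>i. h (s i) (t i)) \<longlonglongrightarrow> h x y"
  shows "simple_limit M (\<lambda>w. h (f w) (g w))"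
proof -
  obtain s where s: "\<And>i::nat. simple_function M (s i)" "\<And>w. w \<in> space M \<Longrightarrow> (\<lambda>i. s i w) \<longlonglongrightarrow> f w"
    using assms(1) unfolding simple_limit_def by blast
  obtain t where t: "\<And>i::nat. simple_function M (t i)" "\<And>w. w \<in> space M \<Longrightarrow> (\<lambda>i. t i w) \<longlonglongrightarrow> g w"
    using assms(2) unfolding simple_limit_def by blast
  show ?thesis
    unfolding simple_limit_def
    using s t h by (intro exI[of _ "\<lambda>i w. h (s i w) (t i w)"]) (auto intro: simple_function_compose2)
qed

lemma simple_limit_norm: "simple_limit M f \<Longrightarrow> simple_limit M (\<lambda>w. norm (f w))"
  for f :: "'w \<Rightarrow> 'b::real_normed_vector"
  using simple_limit_compose2[of M f f "\<lambda>x y. norm x"] by (auto intro: tendsto_intros)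

lemma simple_limit_add: "simple_limit M f \<Longrightarrow> simple_limit M g \<Longrightarrow> simple_limit M (\<lambda>w. f w + g w)"
  for f :: "'w \<Rightarrow> 'b::real_normed_vector"
  by (rule simple_limit_compose2) (auto intro: tendsto_intros)

lemma simple_limit_diff: "simple_limit M f \<Longrightarrow> simple_limit M g \<Longrightarrow> simple_limit M (\<lambda>w. f w - g w)"
  for f :: "'w \<Rightarrow> 'b::real_normed_vector"
  by (rule simple_limit_compose2) (auto intro: tendsto_intros)

lemma simple_limit_scaleR:
  "simple_limit M h \<Longrightarrow> simple_limit M f \<Longrightarrow> simple_limit M (\<lambda>w. h w *\<^sub>R f w)"
  for f :: "'w \<Rightarrow> 'b::real_normed_vector"
  by (rule simple_limit_compose2) (auto intro: tendsto_intros)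

lemma simple_limit_blinfun_apply:
  "simple_limit M b \<Longrightarrow> simple_limit M f \<Longrightarrow> simple_limit M (\<lambda>w. blinfun_apply (b w) (f w))"
  by (rule simple_limit_compose2) (auto intro: tendsto_intros)

lemma simple_limit_const: "simple_limit M (\<lambda>w. c)"
  by (rule simple_limit_simple_function) simp

lemma simple_limit_indicator: "A \<in> sets M \<Longrightarrow> simple_limit M (indicator A :: 'w \<Rightarrow> real)"
  by (rule simple_limit_simple_function) simp

lemma borel_measurable_simple_limit: "simple_limit M f \<Longrightarrow> f \<in> borel_measurable M"
  for f :: "'w \<Rightarrow> 'b::metric_space"
  unfolding simple_limit_def
proof (elim exE conjE)
  fix s assume "\<forall>i::nat. simple_function M (s i)" "\<forall>w\<in>space M. (\<lambda>i. s i w) \<longlonglongrightarrow> f w"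
  then show ?thesis
    by - (rule borel_measurable_LIMSEQ_metric[of s], auto intro: borel_measurable_simple_function)
qed

lemma strongly_measurable_simple_limit: "simple_limit M f \<Longrightarrow> strongly_measurable M f"
  unfolding simple_limit_def strongly_measurable_def by (meson AE_I2)

lemma strongly_measurable_cong_AE:
  assumes "AE w in M. f w = g w" "strongly_measurable M f"
  shows "strongly_measurable M g"
proof -
  obtain s where s: "\<And>i::nat. simple_function M (s i)" "AE w in M. (\<lambda>i. s i w) \<longlonglongrightarrow> f w"
    using assms(2) unfolding strongly_measurable_def by blast
  have "AE w in M. (\<lambda>i. s i w) \<longlonglongrightarrow> g w" using assms(1) s(2) by eventually_elim simp
  then show ?thesis using s(1) unfolding strongly_measurable_def by blast
qed

text \<open>Multiply by the indicator of the complement of a measurable null set containing the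
  exceptional points. The clause that only the value \<open>0\<close> is ever substituted preserves
  pointwise norm bounds.\<close>

lemma strongly_measurable_simple_limit_version:
  assumes "strongly_measurable M f"
  shows "\<exists>f'. simple_limit M f' \<and> (AE w in M. f' w = f w) \<and> (\<forall>w. f' w = f w \<or> f' w = 0)"
proof -
  obtain s where s: "\<And>i::nat. simple_function M (s i)" "AE w in M. (\<lambda>i. s i w) \<longlonglongrightarrow> f w"
    using assms unfolding strongly_measurable_def by blast
  obtain N where N: "{w \<in> space M. \<not> (\<lambda>i. s i w) \<longlonglongrightarrow> f w} \<subseteq> N" "emeasure M N = 0" "N \<in> sets M"
    using AE_E[OF s(2)] by blast
  let ?f = "\<lambda>w. indicator (space M - N) w *\<^sub>R f w"
  have "simple_limit M ?f"
    unfolding simple_limit_def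
  proof (intro exI[of _ "\<lambda>i w. indicator (space M - N) w *\<^sub>R s i w"] conjI allI ballI)
    show "simple_function M (\<lambda>w. indicator (space M - N) w *\<^sub>R s i w)" for i
      using simple_function_compose2[of M "indicator (space M - N) :: 'a \<Rightarrow> real" "s i" "(*\<^sub>R)"] s(1) N(3)
      by auto
    show "(\<lambda>i. indicator (space M - N) w *\<^sub>R s i w) \<longlonglongrightarrow> ?f w" if "w \<in> space M" for w
      using N(1) that by (auto simp: indicator_def)
  qed
  moreover have "AE w in M. ?f w = f w"
    using AE_not_in[of N M] N AE_space by (auto simp: null_sets_def)
  ultimately show ?thesis by (intro exI[of _ ?f]) (auto simp: indicator_def)
qed

text \<open>The norm of a simple limit is Borel measurable, so real-valued \<open>integrable\<close>
  expresses integrability of \<open>f\<close> although the target space need not be second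
  countable.\<close>

definition L1_regular :: "'w measure \<Rightarrow> ('w \<Rightarrow> 'b::real_normed_vector) \<Rightarrow> bool" where
  "L1_regular M f \<longleftrightarrow> simple_limit M f \<and> integrable M (\<lambda>w. norm (f w))"

lemma L1_regular_simple_limit: "L1_regular M f \<Longrightarrow> simple_limit M f"
  and L1_regular_norm: "L1_regular M f \<Longrightarrow> integrable M (\<lambda>w. norm (f w))"
  by (auto simp: L1_regular_def)

lemma L1_regular_bound:
  assumes "simple_limit M f" "integrable M h" "\<And>w. w \<in> space M \<Longrightarrow> norm (f w) \<le> h w"
  shows "L1_regular M f"
  unfolding L1_regular_def
proof
  show "integrable M (\<lambda>w. norm (f w))"
    using assms(3) by (intro Bochner_Integration.integrable_bound[OF assms(2)]
        borel_measurable_simple_limit simple_limit_norm assms(1) AE_I2)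
      (force intro: order_trans[OF _ abs_ge_self])
qed fact

lemma L1_regular_diff: "L1_regular M f \<Longrightarrow> L1_regular M g \<Longrightarrow> L1_regular M (\<lambda>w. f w - g w)"
  by (rule L1_regular_bound[of _ _ "\<lambda>w. norm (f w) + norm (g w)"])
     (auto simp: L1_regular_def simple_limit_diff norm_triangle_ineq4)

lemma L1_regular_add: "L1_regular M f \<Longrightarrow> L1_regular M g \<Longrightarrow> L1_regular M (\<lambda>w. f w + g w)"
  by (rule L1_regular_bound[of _ _ "\<lambda>w. norm (f w) + norm (g w)"])
     (auto simp: L1_regular_def simple_limit_add norm_triangle_ineq)

lemma L1_regular_scaleR: "L1_regular M f \<Longrightarrow> L1_regular M (\<lambda>w. c *\<^sub>R f w)"
  by (rule L1_regular_bound[of _ _ "\<lambda>w. \<bar>c\<bar> * norm (f w)"])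
     (auto simp: L1_regular_def intro: simple_limit_scaleR simple_limit_const)

lemma L1_regular_indicator:
  "A \<in> sets M \<Longrightarrow> L1_regular M f \<Longrightarrow> L1_regular M (\<lambda>w. indicator A w *\<^sub>R f w)"
  by (rule L1_regular_bound[of _ _ "\<lambda>w. norm (f w)"])
     (auto simp: L1_regular_def indicator_leI intro!: simple_limit_scaleR simple_limit_indicator split: split_indicator)

lemma L1_regular_pairing:
  fixes b :: "'w \<Rightarrow> 'a::real_normed_vector \<Rightarrow>\<^sub>L real"
  assumes f: "L1_regular M f" and b: "simple_limit M b" "\<And>w. w \<in> space M \<Longrightarrow> norm (b w) \<le> C"
  shows "L1_regular M (\<lambda>w. blinfun_apply (b w) (f w))"
proof (rule L1_regular_bound[of _ _ "\<lambda>w. C * norm (f w)"])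
  fix w assume "w \<in> space M"
  then show "norm (blinfun_apply (b w) (f w)) \<le> C * norm (f w)"
    using b(2)[of w] norm_blinfun[of "b w" "f w"] by (meson mult_right_mono norm_ge_zero order_trans)
qed (use f b(1) in \<open>auto simp: L1_regular_def intro: simple_limit_blinfun_apply\<close>)

lemma integrable_L1_regular: "L1_regular M f \<Longrightarrow> integrable M f"
  for f :: "'w \<Rightarrow> real"
  using borel_measurable_simple_limit[of M f]
  by (auto simp: L1_regular_def intro: integrable_norm_cancel)

lemmas integrable_pairing = integrable_L1_regular[OF L1_regular_pairing]

lemma L1_regular_functional:
  fixes x :: "'a::real_normed_vector \<Rightarrow>\<^sub>L real"
  shows "L1_regular M f \<Longrightarrow> L1_regular M (\<lambda>w. blinfun_apply x (f w))"
  by (rule L1_regular_pairing[of _ _ _ "norm x"]) (auto intro: simple_limit_const)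

lemma integrable_functional:
  fixes x :: "'a::real_normed_vector \<Rightarrow>\<^sub>L real"
  shows "L1_regular M f \<Longrightarrow> integrable M (\<lambda>w. blinfun_apply x (f w))"
  by (rule integrable_L1_regular[OF L1_regular_functional])

text \<open>Truncate: keep \<open>s i w\<close> while its norm is at most
  \<open>2 * norm (f w)\<close>, else use \<open>0\<close>. Where \<open>f w \<noteq> 0\<close> the
  limit lies strictly inside the bound, so the cut is eventually inactive; where
  \<open>f w = 0\<close> it forces the value \<open>0\<close>. The bound serves dominated
  convergence.\<close>

lemma simple_limit_dominated_approx:
  fixes f :: "'w \<Rightarrow> 'b::real_normed_vector"
  assumes f: "simple_limit M f"
  shows "\<exists>s. (\<forall>i::nat. simple_function M (s i)) \<and> (\<forall>w\<in>space M. (\<lambda>i. s i w) \<longlonglongrightarrow> f w)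
     \<and> (\<forall>i w. norm (s i w) \<le> 2 * norm (f w))"
proof -
  obtain s where s: "\<And>i::nat. simple_function M (s i)" "\<And>w. w \<in> space M \<Longrightarrow> (\<lambda>i. s i w) \<longlonglongrightarrow> f w"
    using f unfolding simple_limit_def by blast
  let ?s = "\<lambda>i w. if norm (s i w) \<le> 2 * norm (f w) then s i w else 0"
  have "simple_function M (?s i)" for i
  proof (rule simple_function_If)
    have [measurable]: "(\<lambda>w. norm (s i w)) \<in> borel_measurable M" "(\<lambda>w. norm (f w)) \<in> borel_measurable M"
      by (intro borel_measurable_simple_limit simple_limit_norm f simple_limit_simple_function s)+
    show "{w \<in> space M. norm (s i w) \<le> 2 * norm (f w)} \<in> sets M" by measurable
  qed (use s in auto)
  moreover have "(\<lambda>i. ?s i w) \<longlonglongrightarrow> f w" if w: "w \<in> space M" for w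
  proof (cases "f w = 0")
    case True
    then have "(\<lambda>i. ?s i w) = (\<lambda>i. 0)" by auto
    then show ?thesis using True by simp
  next
    case False
    then have "norm (f w) < 2 * norm (f w)" by simp
    then have "\<forall>\<^sub>F i in sequentially. norm (s i w) < 2 * norm (f w)"
      using tendsto_norm[OF s(2)[OF w]] by (rule order_tendstoD(2)[rotated])
    then have "\<forall>\<^sub>F i in sequentially. ?s i w = s i w" by eventually_elim simp
    then show ?thesis using s(2)[OF w] by (simp add: tendsto_cong)
  qed
  ultimately show ?thesis by (intro exI[of _ ?s]) auto
qed

lemma L1_regular_simple_approx_integral:
  fixes f :: "'w \<Rightarrow> 'b::real_normed_vector"
  assumes f: "L1_regular M f"
  shows "\<exists>s. (\<forall>i::nat. simple_function M (s i)) \<and> (\<forall>i. L1_regular M (s i))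
     \<and> (\<lambda>i. \<integral>w. norm (f w - s i w) \<partial>M) \<longlonglongrightarrow> 0"
proof -
  obtain s where s: "\<And>i::nat. simple_function M (s i)" "\<And>w. w \<in> space M \<Longrightarrow> (\<lambda>i. s i w) \<longlonglongrightarrow> f w"
      "\<And>i w. norm (s i w) \<le> 2 * norm (f w)"
    using simple_limit_dominated_approx[of M f] f by (auto simp: L1_regular_def)
  have reg: "L1_regular M (s i)" for i
    by (rule L1_regular_bound[of _ _ "\<lambda>w. 2 * norm (f w)"])
       (use f s in \<open>auto simp: L1_regular_def intro: simple_limit_simple_function\<close>)
  have "(\<lambda>i. \<integral>w. norm (f w - s i w) \<partial>M) \<longlonglongrightarrow> (\<integral>w. 0 \<partial>M)"
  \<comment> \<open>The factor is 1 from \<open>f\<close> plus 2 from the truncated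
    approximants.\<close>
  proof (rule integral_dominated_convergence[where w = "\<lambda>w. 3 * norm (f w)"])
    show "(\<lambda>w. norm (f w - s i w)) \<in> borel_measurable M" for i
      using L1_regular_norm[OF L1_regular_diff[OF f reg]] by simp
    show "integrable M (\<lambda>w. 3 * norm (f w))" using f by (auto simp: L1_regular_def)
    show "AE w in M. (\<lambda>i. norm (f w - s i w)) \<longlonglongrightarrow> 0"
    proof (rule AE_I2)
      fix w assume "w \<in> space M"
      then show "(\<lambda>i. norm (f w - s i w)) \<longlonglongrightarrow> 0"
        using tendsto_norm[OF tendsto_diff[OF tendsto_const[of "f w"] s(2)[of w]]] by simp
    qed
    show "AE w in M. norm (norm (f w - s i w)) \<le> 3 * norm (f w)" for i
    proof (rule AE_I2)
      fix w show "norm (norm (f w - s i w)) \<le> 3 * norm (f w)"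
        using norm_triangle_ineq4[of "f w" "s i w"] s(3)[of i w] by simp
    qed
  qed auto
  then show ?thesis using s(1) reg by (intro exI[of _ s]) auto
qed

lemma nn_integral_norm_L1_regular:
  "L1_regular M f \<Longrightarrow> (\<integral>\<^sup>+w. ennreal (norm (f w)) \<partial>M) = ennreal (\<integral>w. norm (f w) \<partial>M)"
  by (intro nn_integral_eq_integral) (auto simp: L1_regular_def)

lemma simple_bochner_integrable_L1_regular:
  "simple_function M s \<Longrightarrow> L1_regular M s \<Longrightarrow> Bochner_Integration.simple_bochner_integrable M s"
  by (rule simple_bochner_integrableI_bounded) (auto simp: nn_integral_norm_L1_regular)

lemma L1_regular_simple_bochner_integrable:
  assumes s: "Bochner_Integration.simple_bochner_integrable M s"
  shows "L1_regular M s"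
proof -
  have "simple_function M s" using s by (auto elim: simple_bochner_integrable.cases)
  moreover have "Bochner_Integration.simple_bochner_integrable M (\<lambda>w. norm (s w))"
    using simple_bochner_integrable_compose2[of "\<lambda>x y. norm x", OF _ s s] by simp
  ultimately show ?thesis
    unfolding L1_regular_def
    using has_bochner_integral_simple_bochner_integrable[of M "\<lambda>w. norm (s w)"]
    by (auto intro: simple_limit_simple_function integrable.intros)
qed

text \<open>The integrals of the simple approximants form a Cauchy sequence, because two of them
  differ by at most the sum of their \<open>L1\<close> distances to \<open>f\<close>. Completeness
  of the target supplies the value.\<close>

lemma has_Bochner_int_exists:
  fixes f :: "'w \<Rightarrow> 'b::banach"
  assumes f: "L1_regular M f"
  shows "\<exists>I. has_Bochner_int M f I"
proof -
  obtain s where s: "\<And>i::nat. simple_function M (s i)" "\<And>i. L1_regular M (s i)"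
      "(\<lambda>i. \<integral>w. norm (f w - s i w) \<partial>M) \<longlonglongrightarrow> 0"
    using L1_regular_simple_approx_integral[OF f] by blast
  define e where "e i = (\<integral>w. norm (f w - s i w) \<partial>M)" for i
  define I where "I i = Bochner_Integration.simple_bochner_integral M (s i)" for i
  note sb = simple_bochner_integrable_L1_regular[OF s(1,2)]
  have dist: "norm (I i - I j) \<le> e i + e j" for i j
  proof -
    have sb2: "Bochner_Integration.simple_bochner_integrable M (\<lambda>w. s i w - s j w)"
      using simple_bochner_integrable_compose2[of "(-)", OF _ sb sb] by simp
    have sb3: "Bochner_Integration.simple_bochner_integrable M (\<lambda>w. norm (s i w - s j w))"
      using simple_bochner_integrable_compose2[of "\<lambda>x y. norm x", OF _ sb2 sb2] by simp
    have "norm (I i - I j) \<le> Bochner_Integration.simple_bochner_integral M (\<lambda>w. norm (s i w - s j w))"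
      using simple_bochner_integral_norm_bound[OF sb2] simple_bochner_integral_diff[OF sb sb]
      by (simp add: I_def)
    also have "\<dots> = (\<integral>w. norm (s i w - s j w) \<partial>M)"
      by (rule simple_bochner_integrable_eq_integral[OF sb3])
    also have "\<dots> \<le> (\<integral>w. norm (f w - s i w) + norm (f w - s j w) \<partial>M)"
    proof (rule integral_mono)
      show "norm (s i w - s j w) \<le> norm (f w - s i w) + norm (f w - s j w)" for w
        by (metis dual_order.refl norm_diff_triangle_le norm_minus_commute)
    qed (use L1_regular_norm[OF L1_regular_diff[OF s(2) s(2)]] L1_regular_norm[OF L1_regular_diff[OF f s(2)]] in auto)
    also have "\<dots> = e i + e j"
      unfolding e_def using L1_regular_norm[OF L1_regular_diff[OF f s(2)]]
      by (intro Bochner_Integration.integral_add) auto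
    finally show ?thesis .
  qed
  have "Cauchy I"
  proof (rule metric_CauchyI)
    fix r :: real assume "r > 0"
    then have "\<forall>\<^sub>F i in sequentially. e i < r / 2"
      using s(3) unfolding e_def[symmetric] by (intro order_tendstoD(2)) auto
    then obtain N where "\<And>i. i \<ge> N \<Longrightarrow> e i < r / 2" by (auto simp: eventually_sequentially)
    moreover have "dist (I m) (I n) \<le> e m + e n" for m n
      using dist by (simp add: dist_norm)
    ultimately have "dist (I m) (I n) < r" if "m \<ge> N" "n \<ge> N" for m n
      using that by (smt (verit) field_sum_of_halves)
    then show "\<exists>N. \<forall>m\<ge>N. \<forall>n\<ge>N. dist (I m) (I n) < r"
      by blast
  qed
  then obtain J where J: "I \<longlonglongrightarrow> J" using Cauchy_convergent convergent_def by blast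
  have "(\<lambda>i. \<integral>\<^sup>+w. ennreal (norm (f w - s i w)) \<partial>M) \<longlonglongrightarrow> 0"
    using tendsto_ennrealI[OF s(3)]
    by (simp add: nn_integral_norm_L1_regular[OF L1_regular_diff[OF f s(2)]])
  then have "has_Bochner_int M f J"
    using J sb f unfolding has_Bochner_int_def I_def
    by (auto simp: L1_regular_def intro: strongly_measurable_simple_limit)
  then show ?thesis ..
qed

lemma L1_space_regular: "L1_regular M f \<Longrightarrow> f \<in> L1_space M"
  for f :: "'w \<Rightarrow> 'b::banach"
  using has_Bochner_int_exists by (auto simp: L1_space_def Bochner_integrable_def)

lemma has_Bochner_int_cong_AE:
  assumes "AE w in M. f w = g w" "has_Bochner_int M f I"
  shows "has_Bochner_int M g I"
proof -
  have "(\<integral>\<^sup>+w. ennreal (norm (f w - s w)) \<partial>M) = (\<integral>\<^sup>+w. ennreal (norm (g w - s w)) \<partial>M)" for s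
    using assms(1) by (intro nn_integral_cong_AE) auto
  then show ?thesis
    using assms strongly_measurable_cong_AE[OF assms(1)] unfolding has_Bochner_int_def by simp
qed

lemma has_Bochner_int_cong_AE_iff:
  assumes "AE w in M. f w = g w"
  shows "has_Bochner_int M f I \<longleftrightarrow> has_Bochner_int M g I"
proof -
  have "AE w in M. g w = f w" using assms by eventually_elim simp
  then show ?thesis using has_Bochner_int_cong_AE assms by metis
qed

lemma Bochner_int_cong_AE:
  assumes "AE w in M. f w = g w"
  shows "Bochner_int M f = Bochner_int M g"
  unfolding Bochner_int_def Bochner_integrable_def has_Bochner_int_cong_AE_iff[OF assms] ..

text \<open>One approximant suffices for integrability: \<open>f' - s i\<close> has norm integral
  below 1 and \<open>s i\<close> is integrable, hence so is their sum \<open>f'\<close>.\<close>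

lemma L1_space_regular_version:
  assumes "f \<in> L1_space M"
  shows "\<exists>f'. L1_regular M f' \<and> (AE w in M. f' w = f w)"
proof -
  obtain I s where f: "strongly_measurable M f" and s: "\<And>i::nat. Bochner_Integration.simple_bochner_integrable M (s i)"
      "(\<lambda>i. \<integral>\<^sup>+w. ennreal (norm (f w - s i w)) \<partial>M) \<longlonglongrightarrow> 0"
    using assms unfolding L1_space_def Bochner_integrable_def has_Bochner_int_def by blast
  obtain f' where f': "simple_limit M f'" "AE w in M. f' w = f w"
    using strongly_measurable_simple_limit_version[OF f] by blast
  have "\<forall>\<^sub>F i in sequentially. (\<integral>\<^sup>+w. ennreal (norm (f w - s i w)) \<partial>M) < 1"
    using s(2) by (rule order_tendstoD) auto
  then obtain i where i: "(\<integral>\<^sup>+w. ennreal (norm (f w - s i w)) \<partial>M) < 1"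
    by (auto simp: eventually_sequentially)
  have "(\<integral>\<^sup>+w. ennreal (norm (f w - s i w)) \<partial>M) = (\<integral>\<^sup>+w. ennreal (norm (f' w - s i w)) \<partial>M)"
    using f'(2) by (intro nn_integral_cong_AE) auto
  with i have less: "(\<integral>\<^sup>+w. ennreal (norm (f' w - s i w)) \<partial>M) < \<infinity>"
    using ennreal_one_less_top by (auto intro: order.strict_trans)
  note reg = L1_regular_simple_bochner_integrable[OF s(1)]
  have d: "simple_limit M (\<lambda>w. f' w - s i w)"
    by (intro simple_limit_diff f' L1_regular_simple_limit reg)
  have "L1_regular M (\<lambda>w. f' w - s i w)"
    unfolding L1_regular_def using d less borel_measurable_simple_limit[OF simple_limit_norm[OF d]]
    by (auto intro!: integrableI_bounded)
  from L1_regular_add[OF this reg[of i]] show ?thesis using f'(2) by auto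
qed

text \<open>Composing a defining sequence of \<open>f\<close> with \<open>x\<close> yields a
  defining sequence of the scalar function. This is the bridge from vector integrals to Lebesgue
  integrals.\<close>

lemma functional_has_Bochner_int:
  fixes x :: "'a::real_normed_vector \<Rightarrow>\<^sub>L real"
  assumes f: "L1_regular M f" and I: "has_Bochner_int M f I"
  shows "(\<integral>w. blinfun_apply x (f w) \<partial>M) = blinfun_apply x I"
proof -
  obtain s where s: "\<And>i::nat. Bochner_Integration.simple_bochner_integrable M (s i)"
      "(\<lambda>i. \<integral>\<^sup>+w. ennreal (norm (f w - s i w)) \<partial>M) \<longlonglongrightarrow> 0"
      "(\<lambda>i. Bochner_Integration.simple_bochner_integral M (s i)) \<longlonglongrightarrow> I"
    using I unfolding has_Bochner_int_def by blast
  have "has_bochner_integral M (\<lambda>w. blinfun_apply x (f w)) (blinfun_apply x I)"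
  proof (rule has_bochner_integral.intros[where s = "\<lambda>i w. blinfun_apply x (s i w)"])
    show "(\<lambda>w. blinfun_apply x (f w)) \<in> borel_measurable M"
      using integrable_functional[OF f] by auto
    show "Bochner_Integration.simple_bochner_integrable M (\<lambda>w. blinfun_apply x (s i w))" for i
      using simple_bochner_integrable_compose2[of "\<lambda>u v. blinfun_apply x u", OF _ s(1) s(1)] by simp
    have "(\<lambda>i. blinfun_apply x (Bochner_Integration.simple_bochner_integral M (s i))) \<longlonglongrightarrow> blinfun_apply x I"
      using s(3) by (intro tendsto_intros)
    then show "(\<lambda>i. Bochner_Integration.simple_bochner_integral M (\<lambda>w. blinfun_apply x (s i w))) \<longlonglongrightarrow> blinfun_apply x I"
      using simple_bochner_integral_linear[OF _ s(1), of "blinfun_apply x"]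
      by (simp add: blinfun.bounded_linear_right bounded_linear.linear)
    show "(\<lambda>i. \<integral>\<^sup>+w. ennreal (norm (blinfun_apply x (f w) - blinfun_apply x (s i w))) \<partial>M) \<longlonglongrightarrow> 0"
    proof (rule tendsto_sandwich[OF always_eventually always_eventually tendsto_const, OF allI allI])
      fix i
      have m: "(\<lambda>w. norm (f w - s i w)) \<in> borel_measurable M"
        using L1_regular_norm[OF L1_regular_diff[OF f L1_regular_simple_bochner_integrable[OF s(1)]]] by simp
      have "(\<integral>\<^sup>+w. ennreal (norm (blinfun_apply x (f w) - blinfun_apply x (s i w))) \<partial>M) \<le>
          (\<integral>\<^sup>+w. ennreal (norm x) * ennreal (norm (f w - s i w)) \<partial>M)"
        using norm_blinfun[of x]
        by (intro nn_integral_mono)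
           (simp add: blinfun.diff_right[symmetric] ennreal_mult[symmetric] ennreal_leI del: real_norm_def)
      also have "\<dots> = ennreal (norm x) * (\<integral>\<^sup>+w. ennreal (norm (f w - s i w)) \<partial>M)"
        using m by (intro nn_integral_cmult) auto
      finally show "(\<integral>\<^sup>+w. ennreal (norm (blinfun_apply x (f w) - blinfun_apply x (s i w))) \<partial>M) \<le>
        ennreal (norm x) * (\<integral>\<^sup>+w. ennreal (norm (f w - s i w)) \<partial>M)" .
    next
      show "(\<lambda>i. ennreal (norm x) * (\<integral>\<^sup>+w. ennreal (norm (f w - s i w)) \<partial>M)) \<longlonglongrightarrow> 0"
        using ennreal_tendsto_cmult[OF _ s(2), of "ennreal (norm x)"] by simp
    qed simp
  qed
  then show ?thesis by (rule has_bochner_integral_integral_eq)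
qed

lemma functional_Bochner_int:
  fixes x :: "'a::banach \<Rightarrow>\<^sub>L real"
  assumes f: "L1_regular M f"
  shows "blinfun_apply x (Bochner_int M f) = (\<integral>w. blinfun_apply x (f w) \<partial>M)"
  using has_Bochner_int_exists[OF f] functional_has_Bochner_int[OF f] Bochner_int_eq by metis

lemma functional_Bochner_set_int:
  fixes x :: "'a::banach \<Rightarrow>\<^sub>L real"
  assumes f: "L1_regular M f" and A: "A \<in> sets M"
  shows "blinfun_apply x (Bochner_set_int M A f) = (\<integral>w. indicator A w * blinfun_apply x (f w) \<partial>M)"
  unfolding Bochner_set_int_def
  using functional_Bochner_int[OF L1_regular_indicator[OF A f]] by (simp add: blinfun.scaleR_right)

lemma functional_mean_on:
  fixes x :: "'a::banach \<Rightarrow>\<^sub>L real"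
  assumes f: "L1_regular M f" and A: "A \<in> sets M"
  shows "blinfun_apply x (mean_on M A f) = (\<integral>w. indicator A w * blinfun_apply x (f w) \<partial>M) / measure M A"
  unfolding mean_on_def by (simp add: blinfun.scaleR_right functional_Bochner_set_int[OF f A])

lemma mean_on_real:
  fixes h :: "'w \<Rightarrow> real"
  assumes h: "integrable M h" and A: "A \<in> sets M"
  shows "mean_on M A h = (\<integral>w. indicator A w * h w \<partial>M) / measure M A"
  unfolding mean_on_def Bochner_set_int_def
  using Bochner_int_eq_lebesgue_integral[of M "\<lambda>w. indicator A w * h w"] integrable_mult_indicator[OF A h] by simp

lemma mean_on_cong_AE: "AE w in M. f w = g w \<Longrightarrow> mean_on M A f = mean_on M A g"
  unfolding mean_on_def Bochner_set_int_def
  by (intro arg_cong[of _ _ "(*\<^sub>R) _"] Bochner_int_cong_AE) auto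

section \<open>Uniform integrability of weakly convergent sequences\<close>

text \<open>A real number rather than an \<open>ennreal\<close>, so that linear arithmetic applies;
  it is used for \<open>L1_regular\<close> functions, where the integral is finite.\<close>

definition L1_on :: "'w measure \<Rightarrow> 'w set \<Rightarrow> ('w \<Rightarrow> 'b::real_normed_vector) \<Rightarrow> real" where
  "L1_on M A f = (\<integral>w. indicator A w * norm (f w) \<partial>M)"

lemma integrable_L1_on:
  "L1_regular M f \<Longrightarrow> A \<in> sets M \<Longrightarrow> integrable M (\<lambda>w. indicator A w * norm (f w))"
  using L1_regular_norm[of M f] integrable_mult_indicator[of A M "\<lambda>w. norm (f w)"] by simp

lemma L1_on_nonneg: "0 \<le> L1_on M A f"
  unfolding L1_on_def by (intro integral_nonneg_AE AE_I2) auto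

lemma L1_on_space: "L1_on M (space M) f = (\<integral>w. norm (f w) \<partial>M)"
  unfolding L1_on_def by (intro Bochner_Integration.integral_cong) auto

lemma L1_on_le:
  assumes "L1_regular M f" "L1_regular M g" "L1_regular M h" "A \<in> sets M"
    and "\<And>w. w \<in> space M \<Longrightarrow> norm (f w) \<le> norm (g w) + norm (h w)"
  shows "L1_on M A f \<le> L1_on M A g + L1_on M A h"
proof -
  have "L1_on M A f \<le> (\<integral>w. indicator A w * norm (g w) + indicator A w * norm (h w) \<partial>M)"
    unfolding L1_on_def using assms
    by (intro integral_mono Bochner_Integration.integrable_add integrable_L1_on)
       (auto simp: indicator_def)
  also have "\<dots> = L1_on M A g + L1_on M A h"
    unfolding L1_on_def using assms by (intro Bochner_Integration.integral_add integrable_L1_on)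
  finally show ?thesis .
qed

lemma L1_on_mono:
  assumes "L1_regular M f" "A \<in> sets M" "B \<in> sets M" "A \<subseteq> B"
  shows "L1_on M A f \<le> L1_on M B f"
  unfolding L1_on_def using assms
  by (intro integral_mono integrable_L1_on) (auto simp: indicator_def)

definition norm_tail :: "'w measure \<Rightarrow> real \<Rightarrow> ('w \<Rightarrow> 'b::real_normed_vector) \<Rightarrow> 'w set" where
  "norm_tail M c f = {w \<in> space M. c \<le> norm (f w)}"

lemma norm_tail_sets:
  assumes "L1_regular M f"
  shows "norm_tail M c f \<in> sets M"
proof -
  have [measurable]: "(\<lambda>w. norm (f w)) \<in> borel_measurable M" using L1_regular_norm[OF assms] by simp
  show ?thesis unfolding norm_tail_def by measurable
qed

lemma L1_norm_tail_small:
  assumes f: "L1_regular M f" and e: "e > 0"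
  shows "\<exists>c>0. L1_on M (norm_tail M c f) f \<le> e"
proof -
  have "(\<lambda>n. L1_on M (norm_tail M (real (Suc n)) f) f) \<longlonglongrightarrow> (\<integral>w. 0 \<partial>M)"
    unfolding L1_on_def
  proof (rule integral_dominated_convergence[where w = "\<lambda>w. norm (f w)"])
    show "AE w in M. (\<lambda>n. indicator (norm_tail M (real (Suc n)) f) w * norm (f w)) \<longlonglongrightarrow> 0"
    proof (rule AE_I2)
      fix w
      obtain N where N: "norm (f w) < real N" using reals_Archimedean2 by blast
      have "\<forall>\<^sub>F n in sequentially. indicator (norm_tail M (real (Suc n)) f) w * norm (f w) = 0"
        using eventually_ge_at_top[of N]
      proof eventually_elim
        case (elim n)
        then have "norm (f w) < real (Suc n)" using N by simp
        then show ?case by (simp add: norm_tail_def indicator_def)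
      qed
      then show "(\<lambda>n. indicator (norm_tail M (real (Suc n)) f) w * norm (f w)) \<longlonglongrightarrow> 0"
        by (simp add: tendsto_eventually)
    qed
    show "(\<lambda>w. indicator (norm_tail M (real (Suc n)) f) w * norm (f w)) \<in> borel_measurable M" for n
      using integrable_L1_on[OF f norm_tail_sets[OF f]] by simp
    show "AE w in M. norm (indicator (norm_tail M (real (Suc n)) f) w * norm (f w)) \<le> norm (f w)" for n
      by (auto simp: indicator_def)
  qed (use f in \<open>auto simp: L1_regular_def\<close>)
  then have "\<forall>\<^sub>F n in sequentially. L1_on M (norm_tail M (real (Suc n)) f) f < e"
    using e by (intro order_tendstoD(2)) auto
  then obtain n where "L1_on M (norm_tail M (real (Suc n)) f) f < e"
    by (auto simp: eventually_sequentially)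
  then show ?thesis by (intro exI[of _ "real (Suc n)"]) auto
qed

lemma integrable_norm_mult_bounded:
  assumes f: "L1_regular M f" and h: "h \<in> borel_measurable M" "\<And>w. w \<in> space M \<Longrightarrow> 0 \<le> h w \<and> h w \<le> K"
  shows "integrable M (\<lambda>w. norm (f w) * h w)"
proof (rule Bochner_Integration.integrable_bound[where f = "\<lambda>w. K * norm (f w)"])
  show "AE w in M. norm (norm (f w) * h w) \<le> norm (K * norm (f w))"
  proof (rule AE_I2)
    fix w assume "w \<in> space M"
    then have "0 \<le> h w" "h w \<le> K" using h by auto
    then show "norm (norm (f w) * h w) \<le> norm (K * norm (f w))"
      by (simp add: abs_mult mult.commute[of "norm (f w)"] mult_right_mono)
  qed
qed (use f h in \<open>auto simp: L1_regular_def\<close>)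

text \<open>Replaces Egorov's theorem: it lets convergence in the mean of bounded factors \<open>h\<close> be used
  uniformly over a uniformly integrable family of functions \<open>f\<close>.\<close>

lemma (in finite_measure) integral_norm_mult_le:
  assumes f: "L1_regular M f" and h: "h \<in> borel_measurable M" "\<And>w. w \<in> space M \<Longrightarrow> 0 \<le> h w \<and> h w \<le> K"
    and c: "c \<ge> 0"
  shows "(\<integral>w. norm (f w) * h w \<partial>M) \<le> K * L1_on M (norm_tail M c f) f + c * (\<integral>w. h w \<partial>M)"
proof -
  have ih: "integrable M h"
    using h by (intro integrable_const_bound[where B = K]) (auto simp: AE_I2)
  note it = integrable_L1_on[OF f norm_tail_sets[OF f, of c]]
  \<comment> \<open>Pointwise split at the level \<open>c\<close>: on the tail
    \<open>h \<le> K\<close>, off the tail \<open>norm f \<le> c\<close>.\<close>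
  have "(\<integral>w. norm (f w) * h w \<partial>M) \<le>
      (\<integral>w. K * (indicator (norm_tail M c f) w * norm (f w)) + c * h w \<partial>M)"
  proof (rule integral_mono)
    fix w assume w: "w \<in> space M"
    with h(2)[OF w] c have "norm (f w) * h w \<le> norm (f w) * K" "0 \<le> c * h w" "0 \<le> K"
      by (auto intro: mult_left_mono)
    moreover have "norm (f w) * h w \<le> c * h w" if "norm (f w) \<le> c"
      using h(2)[OF w] that by (intro mult_right_mono) auto
    ultimately show "norm (f w) * h w \<le> K * (indicator (norm_tail M c f) w * norm (f w)) + c * h w"
      using w by (auto simp: norm_tail_def indicator_def mult.commute)
  qed (use it ih integrable_norm_mult_bounded[OF f h] in auto)
  also have "\<dots> = K * L1_on M (norm_tail M c f) f + c * (\<integral>w. h w \<partial>M)"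
    unfolding L1_on_def using it ih by (subst Bochner_Integration.integral_add) auto
  finally show ?thesis .
qed

section \<open>Absolute continuity of integrals and pairings with the dual unit ball\<close>

context finite_measure
begin

text \<open>With a cutoff \<open>c\<close> for \<open>f\<close> and mean \<open>e / (2 * c)\<close>
  for \<open>h\<close>, the tail of \<open>f\<close> and its bounded part contribute
  \<open>e / 2\<close> each. The point is that \<open>h\<close> need only be small in the mean, not
  uniformly.\<close>

lemma L1_norm_mult_continuous:
  assumes f: "L1_regular M f" and e: "e > 0" and K: "K > 0"
  shows "\<exists>\<rho>>0. \<forall>h\<in>borel_measurable M. (\<forall>w\<in>space M. 0 \<le> h w \<and> h w \<le> K) \<longrightarrow> (\<integral>w. h w \<partial>M) \<le> \<rho> \<longrightarrow>
    (\<integral>w. norm (f w) * h w \<partial>M) \<le> e"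
proof -
  obtain c where c: "c > 0" "L1_on M (norm_tail M c f) f \<le> e / (2 * K)"
    using L1_norm_tail_small[OF f, of "e / (2 * K)"] e K by auto
  show ?thesis
  proof (intro exI[of _ "e / (2 * c)"] conjI ballI impI)
    fix h assume h: "h \<in> borel_measurable M" "\<forall>w\<in>space M. 0 \<le> h w \<and> h w \<le> K" "(\<integral>w. h w \<partial>M) \<le> e / (2 * c)"
    have "(\<integral>w. norm (f w) * h w \<partial>M) \<le> K * L1_on M (norm_tail M c f) f + c * (\<integral>w. h w \<partial>M)"
      using h c by (intro integral_norm_mult_le[OF f]) auto
    also have "\<dots> \<le> K * (e / (2 * K)) + c * (e / (2 * c))"
      using c h K by (intro add_mono mult_left_mono) auto
    also have "\<dots> = e" using c K by simp
    finally show "(\<integral>w. norm (f w) * h w \<partial>M) \<le> e" .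
  qed (use e c in simp)
qed

lemma L1_on_continuous:
  assumes f: "L1_regular M f" and e: "e > 0"
  shows "\<exists>\<delta>>0. \<forall>A\<in>sets M. measure M A \<le> \<delta> \<longrightarrow> L1_on M A f \<le> e"
proof -
  obtain \<rho> where \<rho>: "\<rho> > 0" "\<And>h. h \<in> borel_measurable M \<Longrightarrow> (\<forall>w\<in>space M. 0 \<le> h w \<and> h w \<le> 1) \<Longrightarrow>
      (\<integral>w. h w \<partial>M) \<le> \<rho> \<Longrightarrow> (\<integral>w. norm (f w) * h w \<partial>M) \<le> e"
    using L1_norm_mult_continuous[OF f e, of 1] by auto
  show ?thesis
  proof (intro exI[of _ \<rho>] conjI ballI impI)
    fix A assume "A \<in> sets M" "measure M A \<le> \<rho>"
    then show "L1_on M A f \<le> e"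
      using \<rho>(2)[of "indicator A"] by (simp add: L1_on_def mult.commute)
  qed (fact \<rho>(1))
qed

text \<open>The unit ball of the test functions; general elements of \<open>Linf_dual M\<close> are
  reduced to it by scaling. The bound holds at all points of the type, not only on
  \<open>space M\<close>, which spares side conditions.\<close>

definition dual_ball :: "('a \<Rightarrow> ('b::real_normed_vector \<Rightarrow>\<^sub>L real)) set" where
  "dual_ball = {b. simple_limit M b \<and> (\<forall>w. norm (b w) \<le> 1)}"

text \<open>The gliding hump moves only within this part of the ball, where pasting along a
  measurable set and convex combination produce simple functions again.\<close>

definition simple_dual_ball :: "('a \<Rightarrow> ('b::real_normed_vector \<Rightarrow>\<^sub>L real)) set" where
  "simple_dual_ball = {b. simple_function M b \<and> (\<forall>w. norm (b w) \<le> 1)}"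

definition pair :: "('a \<Rightarrow> 'b::real_normed_vector) \<Rightarrow> ('a \<Rightarrow> ('b \<Rightarrow>\<^sub>L real)) \<Rightarrow> real" where
  "pair f b = (\<integral>w. blinfun_apply (b w) (f w) \<partial>M)"

lemma simple_dual_ball_subset: "b \<in> simple_dual_ball \<Longrightarrow> b \<in> dual_ball"
  by (auto simp: simple_dual_ball_def dual_ball_def simple_limit_simple_function)

lemma integrable_pair: "L1_regular M f \<Longrightarrow> b \<in> dual_ball \<Longrightarrow> integrable M (\<lambda>w. blinfun_apply (b w) (f w))"
  by (rule integrable_pairing[of _ _ _ 1]) (auto simp: dual_ball_def)

lemma integrable_dual_diff:
  assumes "b \<in> dual_ball" "c \<in> dual_ball"
  shows "(\<lambda>w. norm (b w - c w)) \<in> borel_measurable M" "integrable M (\<lambda>w. norm (b w - c w))"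
    "norm (b w - c w) \<le> 2"
proof -
  show *: "(\<lambda>w. norm (b w - c w)) \<in> borel_measurable M"
    using assms by (intro borel_measurable_simple_limit simple_limit_norm simple_limit_diff) (auto simp: dual_ball_def)
  have **: "norm (b w - c w) \<le> 2" for w
    using norm_triangle_ineq4[of "b w" "c w"] assms by (auto simp: dual_ball_def) (smt (verit))
  then show "integrable M (\<lambda>w. norm (b w - c w))"
    using * by (intro integrable_const_bound[where B = 2]) auto
  show "norm (b w - c w) \<le> 2" by (rule **)
qed

lemma pair_diff_le:
  assumes f: "L1_regular M f" and b: "b \<in> dual_ball" "c \<in> dual_ball"
  shows "\<bar>pair f b - pair f c\<bar> \<le> (\<integral>w. norm (f w) * norm (b w - c w) \<partial>M)"
proof -
  have "pair f b - pair f c = (\<integral>w. blinfun_apply (b w - c w) (f w) \<partial>M)"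
    unfolding pair_def using integrable_pair[OF f] b
    by (simp add: blinfun.diff_left)
  also have "\<bar>\<dots>\<bar> \<le> (\<integral>w. \<bar>blinfun_apply (b w - c w) (f w)\<bar> \<partial>M)"
    by (rule integral_abs_bound)
  also have "\<dots> \<le> (\<integral>w. norm (f w) * norm (b w - c w) \<partial>M)"
  proof (rule integral_mono)
    show "integrable M (\<lambda>w. \<bar>blinfun_apply (b w - c w) (f w)\<bar>)"
      using integrable_pair[OF f b(1)] integrable_pair[OF f b(2)] by (simp add: blinfun.diff_left)
    show "integrable M (\<lambda>w. norm (f w) * norm (b w - c w))"
      using integrable_dual_diff[OF b] by (intro integrable_norm_mult_bounded[OF f, where K = 2]) auto
    show "\<bar>blinfun_apply (b w - c w) (f w)\<bar> \<le> norm (f w) * norm (b w - c w)" for w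
      using norm_blinfun[of "b w - c w" "f w"] by (simp add: mult.commute)
  qed
  finally show ?thesis .
qed

text \<open>Uniformity over the ball holds although \<open>f\<close> may be unbounded:
  \<open>norm (b w - c w)\<close> never exceeds 2, so a small mean of it makes the integral of its
  product with \<open>norm (f w)\<close> small.\<close>

lemma pair_continuous:
  fixes f :: "'a \<Rightarrow> 'b::real_normed_vector"
  assumes f: "L1_regular M f" and e: "e > 0"
  shows "\<exists>\<rho>>0. \<forall>b\<in>dual_ball. \<forall>c\<in>dual_ball. (\<integral>w. norm (b w - c w) \<partial>M) \<le> \<rho> \<longrightarrow> \<bar>pair f b - pair f c\<bar> \<le> e"
proof -
  obtain \<rho> where \<rho>: "\<rho> > 0" "\<And>h. h \<in> borel_measurable M \<Longrightarrow> (\<forall>w\<in>space M. 0 \<le> h w \<and> h w \<le> 2) \<Longrightarrow>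
      (\<integral>w. h w \<partial>M) \<le> \<rho> \<Longrightarrow> (\<integral>w. norm (f w) * h w \<partial>M) \<le> e"
    using L1_norm_mult_continuous[OF f e, of 2] by auto
  have "\<bar>pair f b - pair f c\<bar> \<le> e"
    if "b \<in> dual_ball" "c \<in> dual_ball" "(\<integral>w. norm (b w - c w) \<partial>M) \<le> \<rho>" for b c
    using pair_diff_le[OF f that(1,2)] \<rho>(2)[of "\<lambda>w. norm (b w - c w)"] integrable_dual_diff[OF that(1,2)] that(3)
    by force
  then show ?thesis using \<rho>(1) by blast
qed

text \<open>Norming functionals are taken for a simple approximant \<open>s\<close> instead of
  \<open>f\<close>. This makes \<open>b\<close> simple and costs \<open>norm (f - s)\<close> twice,
  once to replace \<open>norm f\<close> by \<open>norm s\<close> and once to pass from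
  \<open>b\<close> at \<open>s\<close> to \<open>b\<close> at \<open>f\<close>. The estimate is
  pointwise, so one \<open>b\<close> serves all sets \<open>A\<close>.\<close>

lemma norming_simple:
  fixes f :: "'a \<Rightarrow> 'b::real_normed_vector"
  assumes f: "L1_regular M f" and e: "e > 0"
  shows "\<exists>b\<in>simple_dual_ball. \<forall>A\<in>sets M. L1_on M A f \<le> (\<integral>w. indicator A w * blinfun_apply (b w) (f w) \<partial>M) + e"
proof -
  obtain s where s: "\<And>i::nat. simple_function M (s i)" "\<And>i. L1_regular M (s i)"
      "(\<lambda>i. \<integral>w. norm (f w - s i w) \<partial>M) \<longlonglongrightarrow> 0"
    using L1_regular_simple_approx_integral[OF f] by blast
  have "\<forall>\<^sub>F i in sequentially. (\<integral>w. norm (f w - s i w) \<partial>M) < e / 2"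
    using s(3) e by (intro order_tendstoD(2)) auto
  then obtain i where i: "(\<integral>w. norm (f w - s i w) \<partial>M) < e / 2" by (auto simp: eventually_sequentially)
  let ?b = "\<lambda>w. norming (s i w)"
  have b: "?b \<in> simple_dual_ball"
    unfolding simple_dual_ball_def using simple_function_compose1[OF s(1)] by (auto simp: norm_norming)
  have le: "norm (f w) \<le> blinfun_apply (?b w) (f w) + 2 * norm (f w - s i w)" for w
  proof -
    have "norm (s i w) - blinfun_apply (?b w) (f w) = blinfun_apply (?b w) (s i w - f w)"
      by (simp add: blinfun.diff_right norming_self)
    also have "\<dots> \<le> norm (f w - s i w)"
      using abs_blinfun_le[OF norm_norming, of "s i w" "s i w - f w"] by (simp add: norm_minus_commute)
    finally show ?thesis using norm_triangle_ineq2[of "f w" "s i w"] by simp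
  qed
  have "L1_on M A f \<le> (\<integral>w. indicator A w * blinfun_apply (?b w) (f w) \<partial>M) + e" if A: "A \<in> sets M" for A
  proof -
    have i1: "integrable M (\<lambda>w. indicator A w * blinfun_apply (?b w) (f w))"
      using integrable_mult_indicator[OF A integrable_pair[OF f simple_dual_ball_subset[OF b]]] by simp
    have i2: "integrable M (\<lambda>w. norm (f w - s i w))"
      using L1_regular_norm[OF L1_regular_diff[OF f s(2)]] .
    have "L1_on M A f \<le> (\<integral>w. indicator A w * blinfun_apply (?b w) (f w) + 2 * norm (f w - s i w) \<partial>M)"
      unfolding L1_on_def
    proof (rule integral_mono)
      show "indicator A w * norm (f w) \<le> indicator A w * blinfun_apply (?b w) (f w) + 2 * norm (f w - s i w)" for w
        using le[of w] by (simp add: indicator_def)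
    qed (use i1 i2 integrable_L1_on[OF f A] in auto)
    also have "\<dots> = (\<integral>w. indicator A w * blinfun_apply (?b w) (f w) \<partial>M) + 2 * (\<integral>w. norm (f w - s i w) \<partial>M)"
      using i1 i2 by simp
    finally show ?thesis using i by simp
  qed
  then show ?thesis by (intro bexI[OF _ b] ballI)
qed

text \<open>The Riesz-Fischer argument: a finite sum of \<open>L1\<close> distances makes the
  pointwise distances summable almost everywhere, and the dual space is complete. Setting the
  functions to 0 on the exceptional null set makes the limit an everywhere limit of simple
  functions.\<close>

lemma L1_Cauchy_limit:
  fixes c :: "nat \<Rightarrow> 'a \<Rightarrow> ('b::real_normed_vector \<Rightarrow>\<^sub>L real)"
  assumes c: "\<And>n. c n \<in> simple_dual_ball"
    and sum: "summable (\<lambda>n. \<integral>w. norm (c (Suc n) w - c n w) \<partial>M)"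
  shows "\<exists>b\<in>dual_ball. AE w in M. (\<lambda>n. c n w) \<longlonglongrightarrow> b w"
proof -
  note cb = simple_dual_ball_subset[OF c]
  let ?d = "\<lambda>n w. norm (c (Suc n) w - c n w)"
  have [measurable]: "(\<lambda>w. ?d n w) \<in> borel_measurable M" for n
    by (rule integrable_dual_diff[OF cb cb])
  have nn: "(\<integral>\<^sup>+w. ennreal (?d n w) \<partial>M) = ennreal (\<integral>w. ?d n w \<partial>M)" for n
    by (rule nn_integral_eq_integral[OF integrable_dual_diff(2)[OF cb cb]]) auto
  have "(\<integral>\<^sup>+w. (\<Sum>n. ennreal (?d n w)) \<partial>M) = (\<Sum>n. \<integral>\<^sup>+w. ennreal (?d n w) \<partial>M)"
    by (rule nn_integral_suminf) simp
  also have "\<dots> = (\<Sum>n. ennreal (\<integral>w. ?d n w \<partial>M))" by (simp add: nn)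
  finally have "(\<integral>\<^sup>+w. (\<Sum>n. ennreal (?d n w)) \<partial>M) \<noteq> top"
    using ennreal_suminf_neq_top[OF sum integral_nonneg_AE[OF AE_I2[OF norm_ge_zero]]] by (rule ssubst)
  then have "AE w in M. (\<Sum>n. ennreal (?d n w)) \<noteq> \<infinity>"
    by (intro nn_integral_PInf_AE) auto
  then have "AE w in M. convergent (\<lambda>n. c n w)"
  proof eventually_elim
    case (elim w)
    then have "summable (\<lambda>n. ?d n w)"
      by (intro summable_suminf_not_top) auto
    then have "summable (\<lambda>n. c (Suc n) w - c n w)" by (rule summable_norm_cancel)
    then have "convergent (\<lambda>n. (\<Sum>k<n. c (Suc k) w - c k w))" by (simp add: summable_iff_convergent)
    then have "convergent (\<lambda>n. c n w - c 0 w)"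
      by (simp only: sum_lessThan_telescope[of "\<lambda>k. c k w"])
    then show ?case by (simp add: convergent_diff_const_right_iff)
  qed
  then obtain N where N: "{w \<in> space M. \<not> convergent (\<lambda>n. c n w)} \<subseteq> N" "emeasure M N = 0" "N \<in> sets M"
    by (rule AE_E)
  define s where "s n w = indicator (space M - N) w *\<^sub>R c n w" for n w
  define b where "b w = lim (\<lambda>n. s n w)" for w
  have lim: "(\<lambda>n. s n w) \<longlonglongrightarrow> b w" for w
  proof -
    have "convergent (\<lambda>n. s n w)"
      using N(1) by (cases "w \<in> space M - N") (auto simp: s_def convergent_const)
    then show ?thesis unfolding b_def by (rule convergent_LIMSEQ_iff[THEN iffD1])
  qed
  have "simple_function M (s n)" for n
    unfolding s_def
    using simple_function_compose2[of M "indicator (space M - N) :: 'a \<Rightarrow> real" "c n" "(*\<^sub>R)"] c N(3)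
    by (auto simp: simple_dual_ball_def)
  then have "simple_limit M b" using lim unfolding simple_limit_def by blast
  moreover have "norm (b w) \<le> 1" for w
  proof (rule LIMSEQ_le_const2[OF tendsto_norm[OF lim]], intro exI[of _ 0] allI impI)
    show "norm (s n w) \<le> 1" for n
      using c[of n] by (auto simp: s_def simple_dual_ball_def indicator_def)
  qed
  moreover have "AE w in M. (\<lambda>n. c n w) \<longlonglongrightarrow> b w"
    using AE_space AE_not_in[OF null_setsI[OF N(2,3)]]
  proof eventually_elim
    case (elim w)
    then show ?case using lim[of w] by (simp add: s_def)
  qed
  ultimately show ?thesis by (auto simp: dual_ball_def)
qed

lemma pair_LIMSEQ:
  fixes f :: "'a \<Rightarrow> 'b::real_normed_vector"
  assumes f: "L1_regular M f" and c: "\<And>n. c n \<in> dual_ball" "b \<in> dual_ball"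
    and lim: "AE w in M. (\<lambda>n. c n w) \<longlonglongrightarrow> b w"
  shows "(\<lambda>n. pair f (c n)) \<longlonglongrightarrow> pair f b"
  unfolding pair_def
proof (rule integral_dominated_convergence[where w = "\<lambda>w. norm (f w)"])
  show "AE w in M. (\<lambda>n. blinfun_apply (c n w) (f w)) \<longlonglongrightarrow> blinfun_apply (b w) (f w)"
    using lim by eventually_elim (intro tendsto_intros)
  show "AE w in M. norm (blinfun_apply (c n w) (f w)) \<le> norm (f w)" for n
    using c(1)[of n] by (auto simp: dual_ball_def abs_blinfun_le)
qed (use integrable_pair[OF f] c L1_regular_norm[OF f] in auto)

text \<open>A gliding hump: if the claim failed, one could build simple functions \<open>c n\<close>, Cauchy in the
  mean so fast that \<open>pair (g (k n))\<close> hardly distinguishes \<open>c n\<close> from the limit, on which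
  \<open>pair (g (k n))\<close> would then stay away from 0.\<close>

lemma gliding_hump:
  fixes g :: "nat \<Rightarrow> 'a \<Rightarrow> 'b::real_normed_vector"
  assumes g: "\<And>k. L1_regular M (g k)"
    and weak: "\<forall>b\<in>dual_ball. (\<lambda>k. pair (g k) b) \<longlonglongrightarrow> 0"
    and e: "e > 0"
  shows "\<exists>c\<in>simple_dual_ball. \<exists>r>0. \<exists>N. \<forall>d\<in>simple_dual_ball. (\<integral>w. norm (d w - c w) \<partial>M) \<le> r \<longrightarrow>
     (\<forall>k\<ge>N. \<bar>pair (g k) d\<bar> \<le> e)"
proof (rule ccontr)
  assume "\<not> ?thesis"
  then have bad: "\<exists>d\<in>simple_dual_ball. \<exists>k\<ge>N. (\<integral>w. norm (d w - c w) \<partial>M) \<le> r \<and> \<bar>pair (g k) d\<bar> > e"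
    if "c \<in> simple_dual_ball" "r > 0" for c r N
    using that by (meson not_le)
  \<comment> \<open>A state \<open>(c, r, k)\<close> consists of a function, a tolerance and an
    index \<open>k\<close> at which \<open>c\<close> violates the bound; \<open>r\<close> is so
    small that simple functions within \<open>2 * r\<close> of \<open>c\<close> change the pairing
    with \<open>g k\<close> by at most \<open>e / 2\<close>.\<close>
  define P where "P n t \<longleftrightarrow> (case t of (c, r, k) \<Rightarrow> c \<in> simple_dual_ball \<and> r > 0 \<and> k \<ge> n \<and> \<bar>pair (g k) c\<bar> > e \<and>
      (\<forall>d\<in>simple_dual_ball. (\<integral>w. norm (d w - c w) \<partial>M) \<le> 2 * r \<longrightarrow> \<bar>pair (g k) d - pair (g k) c\<bar> \<le> e / 2))"
    for n :: nat and t :: "('a \<Rightarrow> ('b \<Rightarrow>\<^sub>L real)) \<times> real \<times> nat"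
  \<comment> \<open>Each step moves by at most the old tolerance and at least halves it, so that all
    later functions stay within \<open>2 * r\<close> of \<open>c\<close>.\<close>
  define Q where "Q n t u \<longleftrightarrow> (case t of (c, r, k) \<Rightarrow> case u of (c', r', k') \<Rightarrow>
      (\<integral>w. norm (c' w - c w) \<partial>M) \<le> r \<and> r' \<le> r / 2)"
    for n :: nat and t u :: "('a \<Rightarrow> ('b \<Rightarrow>\<^sub>L real)) \<times> real \<times> nat"
  have ext: "\<exists>u. P n u \<and> (\<integral>w. norm (fst u w - c w) \<partial>M) \<le> r \<and> fst (snd u) \<le> r / 2"
    if cr: "c \<in> simple_dual_ball" "r > 0" for c r n
  proof -
    obtain d k where d: "d \<in> simple_dual_ball" "k \<ge> n" "(\<integral>w. norm (d w - c w) \<partial>M) \<le> r" "\<bar>pair (g k) d\<bar> > e"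
      using bad[OF cr] by blast
    obtain \<rho> where \<rho>: "\<rho> > 0" "\<And>b c. b \<in> dual_ball \<Longrightarrow> c \<in> dual_ball \<Longrightarrow> (\<integral>w. norm (b w - c w) \<partial>M) \<le> \<rho> \<Longrightarrow>
        \<bar>pair (g k) b - pair (g k) c\<bar> \<le> e / 2"
      using pair_continuous[OF g[of k], of "e / 2"] e by auto
    have "P n (d, min (\<rho> / 2) (r / 2), k)"
      using d \<rho> cr by (auto simp: P_def simple_dual_ball_subset min_def)
    then show ?thesis using d by (intro exI[of _ "(d, min (\<rho> / 2) (r / 2), k)"]) auto
  qed
  have "\<exists>t. \<forall>n. P n (t n) \<and> Q n (t n) (t (Suc n))"
  proof (rule dependent_nat_choice)
    show "\<exists>t. P 0 t"
      using ext[of "\<lambda>_. 0" 1 0] by (auto simp: simple_dual_ball_def)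
    fix t n assume "P n t"
    then obtain c r k where t: "t = (c, r, k)" "c \<in> simple_dual_ball" "r > 0"
      by (cases t) (auto simp: P_def)
    show "\<exists>u. P (Suc n) u \<and> Q n t u"
      using ext[OF t(2,3), of "Suc n"] by (auto simp: t Q_def)
  qed
  then obtain t where t: "\<And>n. P n (t n)" "\<And>n. Q n (t n) (t (Suc n))" by blast
  define c where "c n = fst (t n)" for n
  define r where "r n = fst (snd (t n))" for n
  define k where "k n = snd (snd (t n))" for n
  have P: "c n \<in> simple_dual_ball" "r n > 0" "k n \<ge> n" "\<bar>pair (g (k n)) (c n)\<bar> > e"
    "\<And>d. d \<in> simple_dual_ball \<Longrightarrow> (\<integral>w. norm (d w - c n w) \<partial>M) \<le> 2 * r n \<Longrightarrow>
       \<bar>pair (g (k n)) d - pair (g (k n)) (c n)\<bar> \<le> e / 2" for n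
    using t(1)[of n] by (auto simp: P_def c_def r_def k_def split: prod.splits)
  have Q: "(\<integral>w. norm (c (Suc n) w - c n w) \<partial>M) \<le> r n" "r (Suc n) \<le> r n / 2" for n
    using t(2)[of n] by (auto simp: Q_def c_def r_def split: prod.splits)
  note cb = simple_dual_ball_subset[OF P(1)]
  \<comment> \<open>The subtracted term carries the induction:
    \<open>r (n + m) \<le> 2 * (r (n + m) - r (n + Suc m))\<close>, because tolerances at least
    halve.\<close>
  have close: "(\<integral>w. norm (c (n + m) w - c n w) \<partial>M) \<le> 2 * (r n - r (n + m))" for n m
  proof (induction m)
    case (Suc m)
    have "(\<integral>w. norm (c (n + Suc m) w - c n w) \<partial>M) \<le>
        (\<integral>w. norm (c (Suc (n + m)) w - c (n + m) w) + norm (c (n + m) w - c n w) \<partial>M)"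
    proof (rule integral_mono)
      show "norm (c (n + Suc m) w - c n w) \<le> norm (c (Suc (n + m)) w - c (n + m) w) + norm (c (n + m) w - c n w)" for w
        using norm_triangle_ineq[of "c (Suc (n + m)) w - c (n + m) w" "c (n + m) w - c n w"] by simp
    qed (use integrable_dual_diff(2)[OF cb cb] in auto)
    also have "\<dots> = (\<integral>w. norm (c (Suc (n + m)) w - c (n + m) w) \<partial>M) + (\<integral>w. norm (c (n + m) w - c n w) \<partial>M)"
      using integrable_dual_diff(2)[OF cb cb] by (intro Bochner_Integration.integral_add)
    also have "\<dots> \<le> r (n + m) + 2 * (r n - r (n + m))"
      using Q(1)[of "n + m"] Suc by simp
    also have "\<dots> \<le> 2 * (r n - r (n + Suc m))" using Q(2)[of "n + m"] by simp
    finally show ?case .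
  qed simp
  have r_le: "r n \<le> r 0 * (1 / 2) ^ n" for n
  proof (induction n)
    case (Suc n)
    then show ?case using Q(2)[of n] by simp
  qed simp
  have "summable (\<lambda>n. \<integral>w. norm (c (Suc n) w - c n w) \<partial>M)"
  proof (rule summable_comparison_test')
    show "summable (\<lambda>n. r 0 * (1 / 2) ^ n)" by (intro summable_mult summable_geometric) simp
    show "norm (\<integral>w. norm (c (Suc n) w - c n w) \<partial>M) \<le> r 0 * (1 / 2) ^ n" if "n \<ge> 0" for n
      using Q(1)[of n] r_le[of n] by (simp add: integral_nonneg_AE)
  qed
  from L1_Cauchy_limit[OF P(1) this]
  obtain b where b: "b \<in> dual_ball" "AE w in M. (\<lambda>n. c n w) \<longlonglongrightarrow> b w"
    by blast
  \<comment> \<open>The bound \<open>e / 2\<close> on the change of the pairing survives the limit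
    of the \<open>c m\<close> and is subtracted from the violation, which exceeds
    \<open>e\<close>.\<close>
  have large: "\<bar>pair (g (k n)) b\<bar> \<ge> e / 2" for n
  proof -
    have "\<bar>pair (g (k n)) b - pair (g (k n)) (c n)\<bar> \<le> e / 2"
    proof (rule LIMSEQ_le_const2)
      show "(\<lambda>m. \<bar>pair (g (k n)) (c m) - pair (g (k n)) (c n)\<bar>) \<longlonglongrightarrow> \<bar>pair (g (k n)) b - pair (g (k n)) (c n)\<bar>"
        by (intro tendsto_intros pair_LIMSEQ[OF g cb b])
      show "\<exists>N. \<forall>m\<ge>N. \<bar>pair (g (k n)) (c m) - pair (g (k n)) (c n)\<bar> \<le> e / 2"
      proof (intro exI[of _ n] allI impI)
        fix m assume "m \<ge> n"
        then show "\<bar>pair (g (k n)) (c m) - pair (g (k n)) (c n)\<bar> \<le> e / 2"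
          using close[of n "m - n"] P(2)[of m] by (intro P(5)[OF P(1)]) auto
      qed
    qed
    then show ?thesis using P(4)[of n] by linarith
  qed
  have "\<forall>\<^sub>F k in sequentially. \<bar>pair (g k) b\<bar> < e / 2"
    using tendsto_rabs[OF bspec[OF weak b(1)]] e by (intro order_tendstoD(2)) auto
  then obtain N where "\<And>k. k \<ge> N \<Longrightarrow> \<bar>pair (g k) b\<bar> < e / 2" by (auto simp: eventually_sequentially)
  from this[OF P(3)[of N]] large[of N] show False by simp
qed

lemma integrable_indicator_finite: "A \<in> sets M \<Longrightarrow> integrable M (indicator A :: 'a \<Rightarrow> real)"
  by (intro integrable_real_indicator) (simp_all add: less_top[symmetric])

text \<open>Change the centre \<open>c\<close> of the ball on \<open>A\<close> to \<open>b\<close>,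
  and also to \<open>0\<close>: both modifications move by at most \<open>2 * measure M A\<close> in
  the mean, and the difference of their pairings is the integral over \<open>A\<close> of
  \<open>b\<close> applied to \<open>g k\<close>. For an almost norming \<open>b\<close> this is
  nearly the \<open>L1\<close> norm on \<open>A\<close>. The budget is \<open>e / 4\<close> for each
  pairing and \<open>e / 2\<close> for the norming error.\<close>

lemma weakly_null_uniformly_continuous:
  fixes g :: "nat \<Rightarrow> 'a \<Rightarrow> 'b::real_normed_vector"
  assumes g: "\<And>k. L1_regular M (g k)"
    and weak: "\<forall>b\<in>dual_ball. (\<lambda>k. pair (g k) b) \<longlonglongrightarrow> 0"
    and e: "e > 0"
  shows "\<exists>\<delta>>0. \<exists>N. \<forall>k\<ge>N. \<forall>A\<in>sets M. measure M A \<le> \<delta> \<longrightarrow> L1_on M A (g k) \<le> e"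
proof -
  have "e / 4 > (0::real)" using e by simp
  from gliding_hump[OF g weak this]
  obtain c r N where c: "c \<in> simple_dual_ball" "r > 0" and
    "\<forall>d\<in>simple_dual_ball. (\<integral>w. norm (d w - c w) \<partial>M) \<le> r \<longrightarrow> (\<forall>k\<ge>N. \<bar>pair (g k) d\<bar> \<le> e / 4)"
  proof (elim bexE exE conjE, goal_cases)
    case (1 c r N)
    show ?case by (rule 1(1)[OF 1(2-4)])
  qed
  then have N: "\<bar>pair (g k) d\<bar> \<le> e / 4"
    if "d \<in> simple_dual_ball" "(\<integral>w. norm (d w - c w) \<partial>M) \<le> r" "k \<ge> N" for d k
    using that by blast
  have "L1_on M A (g k) \<le> e" if k: "k \<ge> N" and A: "A \<in> sets M" "measure M A \<le> r / 2" for k A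
  proof -
    obtain b where b: "b \<in> simple_dual_ball"
      "L1_on M A (g k) \<le> (\<integral>w. indicator A w * blinfun_apply (b w) (g k w) \<partial>M) + e / 2"
      using norming_simple[OF g[of k], of "e / 2"] e A(1) by fastforce
    define d where "d v w = (if w \<in> A then v w else c w)" for v w
    have d: "d v \<in> simple_dual_ball" "(\<integral>w. norm (d v w - c w) \<partial>M) \<le> r" if v: "v \<in> simple_dual_ball" for v
    proof -
      show *: "d v \<in> simple_dual_ball"
        using v c A(1) sets.sets_into_space[OF A(1)] unfolding d_def
        by (auto simp: simple_dual_ball_def Int_absorb2 intro!: simple_function_If_set)
      have "(\<integral>w. norm (d v w - c w) \<partial>M) \<le> (\<integral>w. 2 * indicator A w \<partial>M)"
      proof (rule integral_mono)
        show "norm (d v w - c w) \<le> 2 * indicator A w" for w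
          using integrable_dual_diff(3)[OF simple_dual_ball_subset[OF v] simple_dual_ball_subset[OF c(1)], of w]
          by (simp add: d_def indicator_def)
      qed (use integrable_indicator_finite[OF A(1)] integrable_dual_diff(2)[OF simple_dual_ball_subset[OF *] simple_dual_ball_subset[OF c(1)]] in auto)
      also have "\<dots> = 2 * measure M A" using A by simp
      finally show "(\<integral>w. norm (d v w - c w) \<partial>M) \<le> r" using A(2) by simp
    qed
    have 0: "(\<lambda>_. 0) \<in> simple_dual_ball" by (simp add: simple_dual_ball_def)
    have eq: "indicator A w * blinfun_apply (b w) (g k w) =
        blinfun_apply (d b w) (g k w) - blinfun_apply (d (\<lambda>_. 0) w) (g k w)" for w
      by (simp add: d_def indicator_def)
    have "(\<integral>w. indicator A w * blinfun_apply (b w) (g k w) \<partial>M) = pair (g k) (d b) - pair (g k) (d (\<lambda>_. 0))"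
      unfolding pair_def eq
      by (intro Bochner_Integration.integral_diff integrable_pair[OF g] simple_dual_ball_subset d(1) b(1) 0)
    then show ?thesis using b(2) N[OF d[OF b(1)] k] N[OF d[OF 0] k] by linarith
  qed
  then show ?thesis using c(2) by (intro exI[of _ "r / 2"] conjI exI[of _ N]) auto
qed

text \<open>A form of the uniform boundedness principle. Moving from the centre \<open>c\<close> a
  fixed fraction \<open>t\<close> towards an almost norming \<open>b\<close> stays within distance
  \<open>r\<close>, so \<open>t * pair (g k) b \<le> 2\<close> with \<open>t\<close> independent of
  \<open>k\<close>.\<close>

lemma weakly_null_L1_bounded:
  fixes g :: "nat \<Rightarrow> 'a \<Rightarrow> 'b::real_normed_vector"
  assumes g: "\<And>k. L1_regular M (g k)"
    and weak: "\<forall>b\<in>dual_ball. (\<lambda>k. pair (g k) b) \<longlonglongrightarrow> 0"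
  shows "\<exists>L N. \<forall>k\<ge>N. L1_on M (space M) (g k) \<le> L"
proof -
  have "1 > (0::real)" by simp
  from gliding_hump[OF g weak this]
  obtain c r N where c: "c \<in> simple_dual_ball" "r > 0" and
    "\<forall>d\<in>simple_dual_ball. (\<integral>w. norm (d w - c w) \<partial>M) \<le> r \<longrightarrow> (\<forall>k\<ge>N. \<bar>pair (g k) d\<bar> \<le> 1)"
  proof (elim bexE exE conjE, goal_cases)
    case (1 c r N)
    show ?case by (rule 1(1)[OF 1(2-4)])
  qed
  then have N: "\<bar>pair (g k) d\<bar> \<le> 1"
    if "d \<in> simple_dual_ball" "(\<integral>w. norm (d w - c w) \<partial>M) \<le> r" "k \<ge> N" for d k
    using that by blast
  define m where "m = measure M (space M)"
  have m: "m \<ge> 0" by (simp add: m_def)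
  \<comment> \<open>\<open>t \<le> 1\<close> keeps the combination convex, and the summand 1 in the
    denominator covers \<open>m = 0\<close>.\<close>
  define t where "t = min 1 (r / (2 * (m + 1)))"
  have t: "t > 0" "t \<le> 1" using c(2) m by (auto simp: t_def)
  have tr: "2 * t * m \<le> r"
  proof -
    have "t \<le> r / (2 * (m + 1))" by (simp add: t_def)
    then have "2 * t * (m + 1) \<le> r" using m by (simp add: field_simps)
    moreover have "2 * t * m \<le> 2 * t * (m + 1)" using t by simp
    ultimately show ?thesis by linarith
  qed
  have "L1_on M (space M) (g k) \<le> 2 / t + 1" if k: "k \<ge> N" for k
  proof -
    obtain b where b: "b \<in> simple_dual_ball"
      "L1_on M (space M) (g k) \<le> (\<integral>w. indicator (space M) w * blinfun_apply (b w) (g k w) \<partial>M) + 1"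
      using norming_simple[OF g[of k], of 1] by fastforce
    have b': "(\<integral>w. indicator (space M) w * blinfun_apply (b w) (g k w) \<partial>M) = pair (g k) b"
      unfolding pair_def by (intro Bochner_Integration.integral_cong) auto
    define d where "d w = (1 - t) *\<^sub>R c w + t *\<^sub>R b w" for w
    have nb: "norm (b w) \<le> 1" "norm (c w) \<le> 1" for w using b c by (auto simp: simple_dual_ball_def)
    have "norm (d w) \<le> 1" for w
    proof -
      have "norm (d w) \<le> (1 - t) * norm (c w) + t * norm (b w)"
        unfolding d_def using t by (intro norm_triangle_le) simp
      also have "\<dots> \<le> (1 - t) * 1 + t * 1"
        using nb t by (intro add_mono mult_left_mono) auto
      finally show ?thesis by simp
    qed
    moreover have "simple_function M d"
      using simple_function_compose2[of M c b "\<lambda>x y. (1 - t) *\<^sub>R x + t *\<^sub>R y"] b c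
      unfolding d_def by (simp add: simple_dual_ball_def)
    ultimately have d: "d \<in> simple_dual_ball" by (simp add: simple_dual_ball_def)
    note ball = simple_dual_ball_subset[OF d] simple_dual_ball_subset[OF c(1)] simple_dual_ball_subset[OF b(1)]
    have "(\<integral>w. norm (d w - c w) \<partial>M) \<le> (\<integral>w. 2 * t \<partial>M)"
    proof (rule integral_mono)
      show "norm (d w - c w) \<le> 2 * t" for w
      proof -
        have "d w - c w = t *\<^sub>R (b w - c w)" by (simp add: d_def algebra_simps)
        then have "norm (d w - c w) = t * norm (b w - c w)" using t by simp
        also have "\<dots> \<le> t * 2"
          using integrable_dual_diff(3)[OF ball(3,2)] t by (intro mult_left_mono) auto
        finally show ?thesis by simp
      qed
    qed (use integrable_dual_diff(2)[OF ball(1,2)] in auto)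
    also have "\<dots> = 2 * t * m" by (simp add: m_def)
    finally have "(\<integral>w. norm (d w - c w) \<partial>M) \<le> r" using tr by simp
    from N[OF d this k] have pd: "\<bar>pair (g k) d\<bar> \<le> 1" .
    have pc: "\<bar>pair (g k) c\<bar> \<le> 1" using N[OF c(1) _ k] c(2) by simp
    have "pair (g k) d = (1 - t) * pair (g k) c + t * pair (g k) b"
      unfolding pair_def d_def using integrable_pair[OF g ball(2)] integrable_pair[OF g ball(3)]
      by (simp add: blinfun.add_left blinfun.scaleR_left)
    moreover have "- ((1 - t) * \<bar>pair (g k) c\<bar>) \<le> (1 - t) * pair (g k) c"
      using mult_left_mono[of "- \<bar>pair (g k) c\<bar>" "pair (g k) c" "1 - t"] t by simp
    ultimately have "t * pair (g k) b \<le> 1 + (1 - t) * \<bar>pair (g k) c\<bar>"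
      using pd by linarith
    also have "\<dots> \<le> 2" using mult_mono[of "1 - t" 1 "\<bar>pair (g k) c\<bar>" 1] pc t by simp
    finally have "pair (g k) b \<le> 2 / t" using t by (simp add: field_simps)
    then show ?thesis using b(2) b' by simp
  qed
  then show ?thesis by blast
qed

section \<open>Uniform integrability in terms of real integrals\<close>

definition unif_int :: "(nat \<Rightarrow> 'a \<Rightarrow> 'b::real_normed_vector) \<Rightarrow> bool" where
  "unif_int f \<longleftrightarrow> (\<forall>e>0. \<exists>c>0. \<forall>k. L1_on M (norm_tail M c (f k)) (f k) \<le> e)"

lemma nn_integral_norm_tail:
  assumes f: "L1_regular M f"
  shows "(\<integral>\<^sup>+w\<in>{w \<in> space M. c \<le> norm (f w)}. ennreal (norm (f w)) \<partial>M) = ennreal (L1_on M (norm_tail M c f) f)"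
proof -
  have "(\<integral>\<^sup>+w\<in>{w \<in> space M. c \<le> norm (f w)}. ennreal (norm (f w)) \<partial>M) =
      (\<integral>\<^sup>+w. ennreal (indicator (norm_tail M c f) w * norm (f w)) \<partial>M)"
    unfolding norm_tail_def by (intro nn_integral_cong) (auto simp: indicator_def)
  also have "\<dots> = ennreal (L1_on M (norm_tail M c f) f)"
    unfolding L1_on_def
    by (intro nn_integral_eq_integral integrable_L1_on norm_tail_sets f AE_I2) auto
  finally show ?thesis .
qed

text \<open>The tail integrals decrease in the cutoff, so a single good \<open>c\<close> for each
  \<open>e\<close> amounts to convergence of the suprema as the cutoff tends to infinity.\<close>

lemma uniformly_integrable_iff_unif_int:
  assumes f: "\<And>k. L1_regular M (f k)"
  shows "uniformly_integrable M (range f) \<longleftrightarrow> unif_int f"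
proof -
  let ?S = "\<lambda>c. SUP k. ennreal (L1_on M (norm_tail M c (f k)) (f k))"
  have eq: "uniformly_integrable M (range f) \<longleftrightarrow> (?S \<longlongrightarrow> 0) at_top"
    unfolding uniformly_integrable_def by (simp add: image_image nn_integral_norm_tail[OF f])
  show ?thesis
  proof
    assume "uniformly_integrable M (range f)"
    then have lim: "(?S \<longlongrightarrow> 0) at_top" using eq by simp
    show "unif_int f"
      unfolding unif_int_def
    proof (intro allI impI)
      fix e :: real assume "e > 0"
      then have "\<forall>\<^sub>F c in at_top. ?S c < ennreal e"
        using order_tendstoD(2)[OF lim, of "ennreal e"] by simp
      then have "\<forall>\<^sub>F c in at_top. ?S c < ennreal e \<and> c > 0"
        using eventually_gt_at_top[of "0::real"] by (rule eventually_conj)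
      then obtain c where c: "?S c < ennreal e" "c > 0"
        by (auto simp: eventually_at_top_linorder)
      have "L1_on M (norm_tail M c (f k)) (f k) \<le> e" for k
      proof -
        have "ennreal (L1_on M (norm_tail M c (f k)) (f k)) \<le> ?S c" by (rule SUP_upper) simp
        then have "ennreal (L1_on M (norm_tail M c (f k)) (f k)) \<le> ennreal e" using c(1) by simp
        then show ?thesis using \<open>e > 0\<close> by (simp add: ennreal_le_iff)
      qed
      then show "\<exists>c>0. \<forall>k. L1_on M (norm_tail M c (f k)) (f k) \<le> e" using c(2) by blast
    qed
  next
    assume ui: "unif_int f"
    have "(?S \<longlongrightarrow> 0) at_top"
    proof (rule order_tendstoI)
      fix a :: ennreal assume "0 < a"
      then obtain e where e: "0 < e" "ennreal e < a"
        by (metis ennreal_0 ennreal_neg dense ennreal_cases infinity_ennreal_def less_le_not_le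
            linorder_not_less not_less_iff_gr_or_eq top_greatest)
      obtain c where c: "c > 0" "\<And>k. L1_on M (norm_tail M c (f k)) (f k) \<le> e"
        using ui e(1) unfolding unif_int_def by blast
      have "?S c' < a" if "c' \<ge> c" for c'
      proof -
        have "?S c' \<le> ennreal e"
        proof (rule SUP_least, rule ennreal_leI)
          fix k
          have "L1_on M (norm_tail M c' (f k)) (f k) \<le> L1_on M (norm_tail M c (f k)) (f k)"
            using that by (intro L1_on_mono f norm_tail_sets) (auto simp: norm_tail_def)
          then show "L1_on M (norm_tail M c' (f k)) (f k) \<le> e" using c(2)[of k] by simp
        qed
        then show ?thesis using e(2) by (rule le_less_trans)
      qed
      then show "\<forall>\<^sub>F c in at_top. ?S c < a" unfolding eventually_at_top_linorder by blast
    qed simp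
    then show "uniformly_integrable M (range f)" using eq by simp
  qed
qed

lemma unif_int_L1_on_continuous:
  assumes f: "\<And>k. L1_regular M (f k)" and ui: "unif_int f" and e: "e > 0"
  shows "\<exists>\<delta>>0. \<forall>A\<in>sets M. measure M A \<le> \<delta> \<longrightarrow> (\<forall>k. L1_on M A (f k) \<le> e)"
proof -
  obtain c where c: "c > 0" "\<And>k. L1_on M (norm_tail M c (f k)) (f k) \<le> e / 2"
    using ui e unfolding unif_int_def by (meson half_gt_zero)
  have "L1_on M A (f k) \<le> e" if A: "A \<in> sets M" "measure M A \<le> e / (2 * c)" for A k
  proof -
    have "L1_on M A (f k) = (\<integral>w. norm (f k w) * indicator A w \<partial>M)"
      unfolding L1_on_def by (simp add: mult.commute)
    also have "\<dots> \<le> 1 * L1_on M (norm_tail M c (f k)) (f k) + c * (\<integral>w. indicator A w \<partial>M)"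
      using A c by (intro integral_norm_mult_le[OF f]) (auto simp: indicator_def)
    also have "\<dots> \<le> e / 2 + c * (e / (2 * c))"
      using mult_left_mono[OF A(2), of c] A(1) c(1) c(2)[of k] by simp
    also have "\<dots> = e" using c by simp
    finally show ?thesis .
  qed
  then show ?thesis using e c by (intro exI[of _ "e / (2 * c)"]) auto
qed

text \<open>Chebyshev's inequality: by the uniform \<open>L1\<close> bound \<open>L\<close>, the set
  where \<open>norm (f k)\<close> is at least \<open>(L + 1) / \<delta>\<close> has measure at most
  \<open>\<delta>\<close>, uniformly in \<open>k\<close>. The added 1 keeps the cutoff
  positive.\<close>

lemma unif_intI:
  assumes f: "\<And>k. L1_regular M (f k)"
    and cont: "\<And>e. e > 0 \<Longrightarrow> \<exists>\<delta>>0. \<forall>A\<in>sets M. measure M A \<le> \<delta> \<longrightarrow> (\<forall>k. L1_on M A (f k) \<le> e)"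
    and bdd: "\<And>k. L1_on M (space M) (f k) \<le> L"
  shows "unif_int f"
  unfolding unif_int_def
proof (intro allI impI)
  fix e :: real assume "e > 0"
  from cont[OF this] obtain \<delta> where \<delta>: "\<delta> > 0"
    "\<And>A k. A \<in> sets M \<Longrightarrow> measure M A \<le> \<delta> \<Longrightarrow> L1_on M A (f k) \<le> e" by blast
  have L: "0 \<le> L" using bdd[of 0] L1_on_nonneg[of M "space M" "f 0"] by linarith
  define c where "c = (L + 1) / \<delta>"
  have c: "c > 0" using L \<delta> by (simp add: c_def)
  have "L1_on M (norm_tail M c (f k)) (f k) \<le> e" for k
  proof (rule \<delta>(2)[OF norm_tail_sets[OF f]])
    have tail: "norm_tail M c (f k) \<in> sets M" by (rule norm_tail_sets[OF f])
    have "c * measure M (norm_tail M c (f k)) = (\<integral>w. c * indicator (norm_tail M c (f k)) w \<partial>M)"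
      using tail by simp
    also have "\<dots> \<le> (\<integral>w. norm (f k w) \<partial>M)"
    proof (rule integral_mono)
      show "c * indicator (norm_tail M c (f k)) w \<le> norm (f k w)" for w
        by (simp add: norm_tail_def indicator_def)
      show "integrable M (\<lambda>w. c * indicator (norm_tail M c (f k)) w)"
        using integrable_indicator_finite[OF tail] by simp
    qed (rule L1_regular_norm[OF f])
    also have "\<dots> \<le> L" using bdd[of k] by (simp add: L1_on_space)
    finally have "measure M (norm_tail M c (f k)) \<le> L / c" using c by (simp add: field_simps)
    also have "\<dots> \<le> \<delta>" using \<delta>(1) L by (simp add: c_def field_simps)
    finally show "measure M (norm_tail M c (f k)) \<le> \<delta>" .
  qed
  then show "\<exists>c>0. \<forall>k. L1_on M (norm_tail M c (f k)) (f k) \<le> e" using c by blast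
qed

text \<open>The gliding hump controls \<open>f k - f0\<close> only for large \<open>k\<close>. The
  finitely many other functions are integrable one by one: their norms are added to the uniform
  bound, and a common \<open>\<delta>\<close> for them is found by induction on their
  number.\<close>

lemma weakly_convergent_unif_int:
  fixes f :: "nat \<Rightarrow> 'a \<Rightarrow> 'b::real_normed_vector"
  assumes f: "\<And>k. L1_regular M (f k)" and f0: "L1_regular M f0"
    and weak: "\<forall>b\<in>dual_ball. (\<lambda>k. pair (\<lambda>w. f k w - f0 w) b) \<longlonglongrightarrow> 0"
  shows "unif_int f"
proof -
  note g = L1_regular_diff[OF f f0]
  have le: "L1_on M A (f k) \<le> L1_on M A (\<lambda>w. f k w - f0 w) + L1_on M A f0" if "A \<in> sets M" for A k
    using that norm_triangle_ineq[of "f k w - f0 w" "f0 w" for w]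
    by (intro L1_on_le f g f0) auto
  obtain L N where L: "\<And>k. k \<ge> N \<Longrightarrow> L1_on M (space M) (\<lambda>w. f k w - f0 w) \<le> L"
    using weakly_null_L1_bounded[OF g weak] by blast
  let ?L = "\<bar>L\<bar> + L1_on M (space M) f0 + (\<Sum>k<N. L1_on M (space M) (f k))"
  show ?thesis
  proof (rule unif_intI[OF f, where L = ?L])
    show "L1_on M (space M) (f k) \<le> ?L" for k
    proof (cases "k < N")
      case True
      then have "L1_on M (space M) (f k) \<le> (\<Sum>k<N. L1_on M (space M) (f k))"
        by (intro member_le_sum) (auto simp: L1_on_nonneg)
      then show ?thesis using L1_on_nonneg[of M "space M" f0] by linarith
    next
      case False
      have "0 \<le> (\<Sum>k<N. L1_on M (space M) (f k))" by (intro sum_nonneg) (simp add: L1_on_nonneg)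
      then show ?thesis using False L[of k] le[of "space M" k] by simp
    qed
  next
    fix e :: real assume e: "e > 0"
    have e2: "e / 2 > 0" using e by simp
    from weakly_null_uniformly_continuous[OF g weak e2]
    obtain \<delta>1 K where \<delta>1: "\<delta>1 > 0" "\<And>k A. k \<ge> K \<Longrightarrow> A \<in> sets M \<Longrightarrow> measure M A \<le> \<delta>1 \<Longrightarrow>
        L1_on M A (\<lambda>w. f k w - f0 w) \<le> e / 2"
      by blast
    obtain \<delta>2 where \<delta>2: "\<delta>2 > 0" "\<And>A. A \<in> sets M \<Longrightarrow> measure M A \<le> \<delta>2 \<Longrightarrow> L1_on M A f0 \<le> e / 2"
      using L1_on_continuous[OF f0 e2] by blast
    have "\<exists>\<delta>>0. \<forall>k<n. \<forall>A\<in>sets M. measure M A \<le> \<delta> \<longrightarrow> L1_on M A (f k) \<le> e" for n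
    proof (induction n)
      case (Suc n)
      then obtain \<delta> where \<delta>: "\<delta> > 0" "\<And>k A. k < n \<Longrightarrow> A \<in> sets M \<Longrightarrow> measure M A \<le> \<delta> \<Longrightarrow> L1_on M A (f k) \<le> e"
        by blast
      obtain \<eta> where \<eta>: "\<eta> > 0" "\<And>A. A \<in> sets M \<Longrightarrow> measure M A \<le> \<eta> \<Longrightarrow> L1_on M A (f n) \<le> e"
        using L1_on_continuous[OF f[of n] e] by blast
      show ?case
        using \<delta> \<eta> by (intro exI[of _ "min \<delta> \<eta>"]) (auto simp: less_Suc_eq)
    qed (auto intro: exI[of _ 1])
    from this[of K] obtain \<delta>3 where \<delta>3: "\<delta>3 > 0" "\<And>k A. k < K \<Longrightarrow> A \<in> sets M \<Longrightarrow> measure M A \<le> \<delta>3 \<Longrightarrow> L1_on M A (f k) \<le> e"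
      by blast
    show "\<exists>\<delta>>0. \<forall>A\<in>sets M. measure M A \<le> \<delta> \<longrightarrow> (\<forall>k. L1_on M A (f k) \<le> e)"
    proof (intro exI[of _ "min \<delta>1 (min \<delta>2 \<delta>3)"] conjI ballI impI allI)
      fix A k assume A: "A \<in> sets M" "measure M A \<le> min \<delta>1 (min \<delta>2 \<delta>3)"
      show "L1_on M A (f k) \<le> e"
      proof (cases "k < K")
        case False
        then show ?thesis using le[OF A(1), of k] \<delta>1(2)[of k A] \<delta>2(2)[of A] A by simp
      qed (use \<delta>3 A in auto)
    qed (use \<delta>1 \<delta>2 \<delta>3 in auto)
  qed
qed

end

section \<open>Oscillation and exhaustion\<close>

context finite_measure
begin

lemma L1_regular_const: "L1_regular M (\<lambda>_. c)"
  by (simp add: L1_regular_def simple_limit_const)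

lemma L1_on_const: "A \<in> sets M \<Longrightarrow> L1_on M A (\<lambda>_. c) = norm c * measure M A"
  unfolding L1_on_def by (simp add: mult.commute)

lemma L1_on_subadditive:
  assumes f: "L1_regular M f" and AB: "A \<in> sets M" "B \<in> sets M"
  shows "L1_on M (A \<union> B) f \<le> L1_on M A f + L1_on M B f"
proof -
  have "L1_on M (A \<union> B) f \<le> (\<integral>w. indicator A w * norm (f w) + indicator B w * norm (f w) \<partial>M)"
    unfolding L1_on_def using assms
    by (intro integral_mono Bochner_Integration.integrable_add integrable_L1_on)
       (auto simp: indicator_def)
  also have "\<dots> = L1_on M A f + L1_on M B f"
    unfolding L1_on_def using assms by (intro Bochner_Integration.integral_add integrable_L1_on)
  finally show ?thesis .
qed

lemma L1_on_functional_le: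
  fixes x :: "'b::real_normed_vector \<Rightarrow>\<^sub>L real"
  assumes "L1_regular M f" "A \<in> sets M" "norm x \<le> 1"
  shows "L1_on M A (\<lambda>w. blinfun_apply x (f w)) \<le> L1_on M A f"
  unfolding L1_on_def using assms abs_blinfun_le[OF assms(3)]
  by (intro integral_mono integrable_L1_on L1_regular_functional) (auto simp: indicator_def)

lemma mean_on_diff:
  fixes g h :: "'a \<Rightarrow> real"
  assumes "L1_regular M g" "L1_regular M h" "A \<in> sets M"
  shows "mean_on M A (\<lambda>w. g w - h w) = mean_on M A g - mean_on M A h"
proof -
  have i: "integrable M g" "integrable M h" using assms integrable_L1_regular by auto
  have "(\<integral>w. indicator A w * (g w - h w) \<partial>M) = (\<integral>w. indicator A w * g w \<partial>M) - (\<integral>w. indicator A w * h w \<partial>M)"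
    using integrable_mult_indicator[OF assms(3) i(1)] integrable_mult_indicator[OF assms(3) i(2)]
    by (simp add: right_diff_distrib)
  then show ?thesis using i assms(3) by (simp add: mean_on_real diff_divide_distrib)
qed

lemma abs_mean_on_le:
  fixes h :: "'a \<Rightarrow> real"
  assumes h: "L1_regular M h" and A: "A \<in> sets M"
  shows "\<bar>mean_on M A h\<bar> * measure M A \<le> L1_on M A h"
proof (cases "measure M A = 0")
  case False
  then have "\<bar>mean_on M A h\<bar> * measure M A = \<bar>\<integral>w. indicator A w * h w \<partial>M\<bar>"
    using integrable_L1_regular[OF h] A by (simp add: mean_on_real abs_divide)
  also have "\<dots> \<le> (\<integral>w. \<bar>indicator A w * h w\<bar> \<partial>M)" by (rule integral_abs_bound)
  also have "\<dots> = L1_on M A h" unfolding L1_on_def by (simp add: abs_mult)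
  finally show ?thesis .
qed (simp add: L1_on_nonneg)

lemma mean_on_const: "A \<in> sets M \<Longrightarrow> measure M A > 0 \<Longrightarrow> mean_on M A (\<lambda>_. c) = c"
  for c :: real
  by (subst mean_on_real) auto

text \<open>Not divided by the measure of \<open>A\<close>, so that the basic estimates hold on null
  sets too; \<open>osc A h / measure M A\<close> is the Bocce oscillation when the measure is
  positive.\<close>

definition osc :: "'a set \<Rightarrow> ('a \<Rightarrow> real) \<Rightarrow> real" where
  "osc A h = L1_on M A (\<lambda>w. h w - mean_on M A h)"

text \<open>One copy of the distance comes from replacing \<open>g\<close> by \<open>h\<close>, the
  other from replacing the mean, since the mean of \<open>g - h\<close> times the measure is again
  bounded by that distance.\<close>

lemma osc_le_perturbation:
  assumes g: "L1_regular M g" and h: "L1_regular M h" and A: "A \<in> sets M"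
  shows "osc A g \<le> osc A h + 2 * L1_on M A (\<lambda>w. g w - h w)"
proof -
  let ?m = "mean_on M A g" and ?n = "mean_on M A h"
  note c = L1_regular_const and d = L1_regular_diff
  have "osc A g \<le> L1_on M A (\<lambda>w. (h w - ?n) - (?m - ?n)) + L1_on M A (\<lambda>w. g w - h w)"
    unfolding osc_def by (rule L1_on_le[OF d[OF g c] d[OF d[OF h c] c] d[OF g h] A]) (smt (verit) real_norm_def)
  also have "L1_on M A (\<lambda>w. (h w - ?n) - (?m - ?n)) \<le> osc A h + L1_on M A (\<lambda>_. ?m - ?n)"
    unfolding osc_def by (rule L1_on_le[OF d[OF d[OF h c] c] d[OF h c] c A]) (smt (verit) real_norm_def)
  also have "L1_on M A (\<lambda>_. ?m - ?n) \<le> L1_on M A (\<lambda>w. g w - h w)"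
    using abs_mean_on_le[OF d[OF g h] A] by (simp add: L1_on_const[OF A] mean_on_diff[OF g h A])
  finally show ?thesis by simp
qed

text \<open>Write \<open>g - h = (g - m) - (h - n) + (m - n)\<close> with the two means. For
  \<open>x\<close> composed with \<open>f k\<close> and with \<open>f0\<close>, this turns small
  oscillations and close means into a small Pettis distance on \<open>A\<close>.\<close>

lemma L1_on_diff_le_osc:
  assumes g: "L1_regular M g" and h: "L1_regular M h" and A: "A \<in> sets M"
  shows "L1_on M A (\<lambda>w. g w - h w) \<le> osc A g + osc A h + \<bar>mean_on M A g - mean_on M A h\<bar> * measure M A"
proof -
  let ?m = "mean_on M A g" and ?n = "mean_on M A h"
  note c = L1_regular_const and d = L1_regular_diff
  have "L1_on M A (\<lambda>w. g w - h w) \<le> L1_on M A (\<lambda>w. (g w - ?m) - (h w - ?n)) + L1_on M A (\<lambda>_. ?m - ?n)"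
    by (rule L1_on_le[OF d[OF g h] d[OF d[OF g c] d[OF h c]] c A]) (smt (verit) real_norm_def)
  also have "L1_on M A (\<lambda>w. (g w - ?m) - (h w - ?n)) \<le> osc A g + osc A h"
    unfolding osc_def by (rule L1_on_le[OF d[OF d[OF g c] d[OF h c]] d[OF g c] d[OF h c] A]) (smt (verit) real_norm_def)
  finally show ?thesis by (simp add: L1_on_const[OF A])
qed

text \<open>A constant has oscillation zero and \<open>x\<close> does not increase norms, so the
  perturbation bound applies with distance \<open>e\<close>; its factor 2 is the one in the claim.
  The bound is uniform over the dual ball.\<close>

lemma osc_le_of_near_const:
  fixes x :: "'b::real_normed_vector \<Rightarrow>\<^sub>L real"
  assumes f: "L1_regular M f" and A: "A \<in> sets M" "measure M A > 0"
    and near: "\<And>w. w \<in> A \<Longrightarrow> norm (f w - c) \<le> e" and x: "norm x \<le> 1"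
  shows "osc A (\<lambda>w. blinfun_apply x (f w)) \<le> 2 * e * measure M A"
proof -
  let ?c = "\<lambda>_::'a. blinfun_apply x c"
  have "osc A ?c = 0" unfolding osc_def using A by (simp add: mean_on_const L1_on_def)
  moreover have "L1_on M A (\<lambda>w. blinfun_apply x (f w) - ?c w) \<le> (\<integral>w. e * indicator A w \<partial>M)"
    unfolding L1_on_def
  proof (rule integral_mono)
    show "indicator A w * norm (blinfun_apply x (f w) - ?c w) \<le> e * indicator A w" for w
      using near[of w] abs_blinfun_le[OF x, of "f w - c"] by (auto simp: indicator_def blinfun.diff_right)
    show "integrable M (\<lambda>w. indicator A w * norm (blinfun_apply x (f w) - ?c w))"
      by (rule integrable_L1_on[OF L1_regular_diff[OF L1_regular_functional[OF f] L1_regular_const] A(1)])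
  qed (use integrable_indicator_finite[OF A(1)] in simp)
  ultimately show ?thesis
    using osc_le_perturbation[OF L1_regular_functional[OF f] L1_regular_const A(1), of x "blinfun_apply x c"] A
    by simp
qed

text \<open>\<open>B\<close> is the countable union of the sets where
  \<open>norm (f w - s i w) \<le> e\<close>, so one of these has positive measure; one of the
  finitely many level sets of \<open>s i\<close> meets it in positive measure. This gives
  \<open>f0\<close> small oscillation, and later bounds the Radon-Nikodym density.\<close>

lemma exists_near_const:
  fixes f :: "'a \<Rightarrow> 'b::real_normed_vector"
  assumes f: "simple_limit M f" and e: "e > 0" and B: "B \<in> pos_sets M"
  shows "\<exists>A\<in>pos_subsets M B. \<exists>c. \<forall>w\<in>A. norm (f w - c) \<le> e"
proof -
  obtain s where s: "\<And>i::nat. simple_function M (s i)" "\<And>w. w \<in> space M \<Longrightarrow> (\<lambda>i. s i w) \<longlonglongrightarrow> f w"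
    using f unfolding simple_limit_def by blast
  have BM: "B \<in> sets M" "emeasure M B > 0" using B by (auto simp: pos_sets_def)
  let ?B = "\<lambda>i. {w \<in> B. norm (f w - s i w) \<le> e}"
  have Bi: "?B i \<in> sets M" for i
  proof -
    have [measurable]: "(\<lambda>w. norm (f w - s i w)) \<in> borel_measurable M"
      by (intro borel_measurable_simple_limit simple_limit_norm simple_limit_diff f simple_limit_simple_function s)
    have "{w \<in> space M. norm (f w - s i w) \<le> e} \<in> sets M" by measurable
    moreover have "?B i = B \<inter> {w \<in> space M. norm (f w - s i w) \<le> e}"
      using sets.sets_into_space[OF BM(1)] by auto
    ultimately show ?thesis using BM(1) by auto
  qed
  have "\<exists>i. ?B i \<notin> null_sets M"
  proof (rule ccontr)
    assume "\<nexists>i. ?B i \<notin> null_sets M"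
    then have null: "(\<Union>i. ?B i) \<in> null_sets M" by (intro null_sets_UN) auto
    have "B \<subseteq> (\<Union>i. ?B i)"
    proof
      fix w assume w: "w \<in> B"
      then have "(\<lambda>i. norm (f w - s i w)) \<longlonglongrightarrow> norm (f w - f w)"
        using sets.sets_into_space[OF BM(1)] by (intro tendsto_intros s) auto
      then have "\<forall>\<^sub>F i in sequentially. norm (f w - s i w) < e"
        using e by (intro order_tendstoD(2)) auto
      then obtain i where "norm (f w - s i w) < e" by (auto simp: eventually_sequentially)
      then show "w \<in> (\<Union>i. ?B i)" using w by (intro UN_I[of i]) auto
    qed
    then have "B \<in> null_sets M" using null_sets_subset[OF null BM(1)] by simp
    then show False using BM by auto
  qed
  then obtain i where i: "?B i \<notin> null_sets M" ..
  let ?C = "\<lambda>y. ?B i \<inter> (s i -` {y} \<inter> space M)"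
  have Ci: "?C y \<in> sets M" for y using Bi simple_functionD(2)[OF s(1)] by auto
  have "\<exists>y. ?C y \<notin> null_sets M"
  proof (rule ccontr)
    assume "\<nexists>y. ?C y \<notin> null_sets M"
    then have "(\<Union>y\<in>s i ` space M. ?C y) \<in> null_sets M"
      using simple_functionD(1)[OF s(1)] by (intro null_sets.finite_UN) auto
    moreover have "(\<Union>y\<in>s i ` space M. ?C y) = ?B i"
      using sets.sets_into_space[OF BM(1)] by auto
    ultimately show False using i by simp
  qed
  then obtain y where y: "?C y \<notin> null_sets M" ..
  have "?C y \<in> pos_subsets M B"
    using y Ci[of y] by (auto simp: pos_subsets_def pos_sets_def null_sets_def zero_less_iff_neq_zero)
  moreover have "\<forall>w\<in>?C y. norm (f w - y) \<le> e" by auto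
  ultimately show ?thesis by blast
qed

text \<open>\<open>R A k\<close> is read as \<open>A\<close> being good for the index
  \<open>k\<close>. Each stage takes, disjoint from the earlier sets, a candidate of at least half
  the possible measure and thins out the indices. A remainder of positive measure would contain a
  positive set \<open>C\<close> good for infinitely many diagonal indices; it was a candidate at
  every stage, so \<open>measure M C \<le> 2 * measure M (A n)\<close>, which tends to 0. The
  threshold from which \<open>A n\<close> is good depends on \<open>n\<close>.\<close>

lemma exhaustion:
  fixes R :: "'a set \<Rightarrow> nat \<Rightarrow> bool"
  assumes ext: "\<And>B I. B \<in> pos_sets M \<Longrightarrow> infinite I \<Longrightarrow>
      \<exists>A\<in>pos_subsets M B. \<exists>J\<subseteq>I. infinite J \<and> (\<forall>k\<in>J. R A k)"
    and R_empty: "\<And>k. R {} k" and I: "infinite I"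
  shows "\<exists>J\<subseteq>I. infinite J \<and> (\<exists>A::nat \<Rightarrow> 'a set. disjoint_family A \<and> space M - (\<Union>n. A n) \<in> null_sets M \<and>
    (\<forall>n. A n \<in> sets M \<and> (\<exists>N. \<forall>k\<in>J. k \<ge> N \<longrightarrow> R (A n) k)))"
proof -
  define cand where "cand U J = {A \<in> sets M. A \<inter> U = {} \<and> (\<exists>J'\<subseteq>J. infinite J' \<and> (\<forall>k\<in>J'. R A k))}" for U J
  have step: "\<exists>A\<in>cand U J. \<forall>C\<in>cand U J. measure M C \<le> 2 * measure M A" if "infinite J" for U J
  proof -
    \<comment> \<open>The empty set keeps the family nonempty and is itself the choice when the
      supremum is 0.\<close>
    have ne: "{} \<in> cand U J" using that R_empty by (auto simp: cand_def)
    let ?S = "Sup (measure M ` cand U J)"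
    have bdd: "bdd_above (measure M ` cand U J)"
      by (intro bdd_aboveI2[of _ _ "measure M (space M)"] bounded_measure)
    have le: "measure M C \<le> ?S" if "C \<in> cand U J" for C
      using that bdd by (intro cSup_upper) auto
    show ?thesis
    proof (cases "?S > 0")
      case True
      then have "?S / 2 < ?S" by simp
      then obtain A where A: "A \<in> cand U J" "?S / 2 < measure M A"
        using ne by (subst (asm) less_cSup_iff) (auto intro: bdd)
      then show ?thesis using le by (intro bexI[OF _ A(1)] ballI) (smt (verit) field_sum_of_halves)
    next
      case False
      then show ?thesis using le by (intro bexI[OF _ ne] ballI) force
    qed
  qed
  define P where "P n t \<longleftrightarrow> (case t of (A, U, J) \<Rightarrow> A \<in> sets M \<and> U \<in> sets M \<and> infinite J \<and> J \<subseteq> I \<and> (n = 0 \<longrightarrow> U = {}))"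
    for n :: nat and t :: "'a set \<times> 'a set \<times> nat set"
  define Q where "Q n t u \<longleftrightarrow> (case t of (A, U, J) \<Rightarrow> case u of (A', U', J') \<Rightarrow>
      A' \<inter> U = {} \<and> U' = U \<union> A' \<and> J' \<subseteq> J \<and> (\<forall>k\<in>J'. R A' k) \<and> (\<forall>C\<in>cand U J. measure M C \<le> 2 * measure M A'))"
    for n :: nat and t u :: "'a set \<times> 'a set \<times> nat set"
  have "\<exists>t. \<forall>n. P n (t n) \<and> Q n (t n) (t (Suc n))"
  proof (rule dependent_nat_choice)
    show "\<exists>t. P 0 t" using I by (intro exI[of _ "({}, {}, I)"]) (simp add: P_def)
    fix t n assume "P n t"
    then obtain A U J where t: "t = (A, U, J)" "U \<in> sets M" "infinite J" "J \<subseteq> I"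
      by (cases t) (auto simp: P_def)
    obtain A' where A': "A' \<in> cand U J" "\<forall>C\<in>cand U J. measure M C \<le> 2 * measure M A'"
      using step[OF t(3)] by blast
    then obtain J' where J': "J' \<subseteq> J" "infinite J'" "\<forall>k\<in>J'. R A' k" by (auto simp: cand_def)
    show "\<exists>u. P (Suc n) u \<and> Q n t u"
      using A' J' t by (intro exI[of _ "(A', U \<union> A', J')"]) (auto simp: P_def Q_def cand_def)
  qed
  then obtain t where t: "\<And>n. P n (t n)" "\<And>n. Q n (t n) (t (Suc n))" by blast
  \<comment> \<open>The set in the initial state is a dummy; the set chosen at stage
    \<open>n\<close> sits in state \<open>Suc n\<close>, next to the indices thinned out for
    it.\<close>
  define A where "A n = fst (t (Suc n))" for n
  define U where "U n = fst (snd (t n))" for n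
  define J where "J n = snd (snd (t n))" for n
  have P: "A n \<in> sets M" "U n \<in> sets M" "infinite (J n)" "J n \<subseteq> I" "U 0 = {}" for n
    using t(1)[of n] t(1)[of "Suc n"] t(1)[of 0] by (auto simp: P_def A_def U_def J_def split: prod.splits)
  have Q: "A n \<inter> U n = {}" "U (Suc n) = U n \<union> A n" "J (Suc n) \<subseteq> J n" "\<forall>k\<in>J (Suc n). R (A n) k"
    "\<forall>C\<in>cand (U n) (J n). measure M C \<le> 2 * measure M (A n)" for n
    using t(2)[of n] by (auto simp: Q_def A_def U_def J_def split: prod.splits)
  have U_eq: "U n = (\<Union>i<n. A i)" for n
    by (induction n) (use P(5) Q(2) in \<open>auto simp: lessThan_Suc\<close>)
  have disj: "disjoint_family A"
  proof -
    have "A m \<inter> A n = {}" if "m < n" for m n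
      using Q(1)[of n] that unfolding U_eq by auto
    then show ?thesis unfolding disjoint_family_on_def by (metis Int_commute nat_neq_iff)
  qed
  have J_mono: "J n \<subseteq> J m" if "m \<le> n" for m n
    using that by (induction rule: dec_induct) (use Q(3) in auto)
  \<comment> \<open>A strictly increasing diagonal sequence through the decreasing index sets; from
    \<open>d n\<close> on it stays in \<open>J n\<close>.\<close>
  have "\<exists>d. \<forall>n. d n \<in> J n \<and> d n < d (Suc n)"
  proof (rule dependent_nat_choice)
    show "\<exists>x. x \<in> J 0" using P(3)[of 0] by (metis equals0I finite.emptyI)
    fix x n show "\<exists>y. y \<in> J (Suc n) \<and> x < y"
      using P(3)[of "Suc n"] unfolding infinite_nat_iff_unbounded by blast
  qed
  then obtain d where d: "\<And>n. d n \<in> J n" "\<And>n. d n < d (Suc n)" by blast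
  then have mono: "strict_mono d" by (intro strict_monoI_Suc)
  define D where "D = range d"
  have D_inf: "infinite D"
    unfolding D_def using mono by (intro range_inj_infinite strict_mono_imp_inj_on)
  have D_I: "D \<subseteq> I" using d(1) P(4) by (auto simp: D_def)
  have D_J: "k \<in> J n" if k: "k \<in> D" "k \<ge> d n" for k n
  proof -
    obtain m where m: "k = d m" using k(1) by (auto simp: D_def)
    then have "n \<le> m" using k(2) mono by (simp add: strict_mono_less_eq)
    then show ?thesis using d(1)[of m] J_mono[of n m] m by blast
  qed
  have R: "\<exists>N. \<forall>k\<in>D. k \<ge> N \<longrightarrow> R (A n) k" for n
    using D_J[of _ "Suc n"] Q(4)[of n] by blast
  let ?B = "space M - (\<Union>n. A n)"
  have B: "?B \<in> sets M" using P(1) by auto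
  have "?B \<in> null_sets M"
  proof (rule ccontr)
    assume "?B \<notin> null_sets M"
    then have "?B \<in> pos_sets M"
      using B by (auto simp: pos_sets_def null_sets_def zero_less_iff_neq_zero)
    from ext[OF this D_inf] obtain C K where C: "C \<in> pos_subsets M ?B" and K: "K \<subseteq> D" "infinite K" "\<forall>k\<in>K. R C k"
      by blast
    have CM: "C \<in> sets M" "emeasure M C > 0" "C \<subseteq> ?B" using C by (auto simp: pos_subsets_def pos_sets_def)
    have "C \<in> cand (U n) (J n)" for n
    proof -
      \<comment> \<open>Up to finitely many indices \<open>K\<close> lies in every
        \<open>J n\<close>, so \<open>C\<close> competed with every chosen set.\<close>
      have "K \<subseteq> (K \<inter> J n) \<union> {..<d n}" using K(1) D_J[of _ n] by force
      then have "infinite (K \<inter> J n)" using K(2) by (metis finite_UnI finite_lessThan finite_subset)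
      moreover have "C \<inter> U n = {}" using CM(3) unfolding U_eq by auto
      ultimately show ?thesis using CM(1) K(3) unfolding cand_def by blast
    qed
    then have le: "measure M C \<le> 2 * measure M (A n)" for n using Q(5) by blast
    have "summable (\<lambda>n. measure M (A n))"
      using finite_measure_UNION[OF _ disj] P(1) by (auto simp: sums_iff)
    then have "(\<lambda>n. 2 * measure M (A n)) \<longlonglongrightarrow> 2 * 0" by (intro tendsto_intros summable_LIMSEQ_zero)
    then have "measure M C \<le> 2 * 0" by (rule LIMSEQ_le_const) (use le in blast)
    then show False using CM(2) by (simp add: emeasure_eq_measure)
  qed
  then show ?thesis using D_I D_inf disj P(1) R by (intro exI[of _ D] conjI exI[of _ A] allI) auto
qed

end

section \<open>Pettis convergence\<close>

lemma ennreal_tendsto_0_iff_le: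
  fixes u :: "nat \<Rightarrow> ennreal"
  shows "u \<longlonglongrightarrow> 0 \<longleftrightarrow> (\<forall>e>0. \<forall>\<^sub>F k in sequentially. u k \<le> ennreal e)"
proof
  assume u: "u \<longlonglongrightarrow> 0"
  show "\<forall>e>0. \<forall>\<^sub>F k in sequentially. u k \<le> ennreal e"
  proof (intro allI impI)
    fix e :: real assume "e > 0"
    then have "\<forall>\<^sub>F k in sequentially. u k < ennreal e" by (intro order_tendstoD(2)[OF u]) simp
    then show "\<forall>\<^sub>F k in sequentially. u k \<le> ennreal e" by eventually_elim simp
  qed
next
  assume *: "\<forall>e>0. \<forall>\<^sub>F k in sequentially. u k \<le> ennreal e"
  show "u \<longlonglongrightarrow> 0"
  proof (rule order_tendstoI)
    fix a :: ennreal assume "0 < a"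
    then obtain b where b: "0 < b" "b < a" using dense by blast
    then obtain e where e: "b = ennreal e" "e > 0" by (cases b) auto
    then have "\<forall>\<^sub>F k in sequentially. u k \<le> ennreal e" using * by blast
    then show "\<forall>\<^sub>F k in sequentially. u k < a"
      by eventually_elim (use b e in auto)
  qed simp
qed

lemma functional_mean_on_eq:
  fixes x :: "'a::banach \<Rightarrow>\<^sub>L real"
  assumes "L1_regular M f" "A \<in> sets M"
  shows "blinfun_apply x (mean_on M A f) = mean_on M A (\<lambda>w. blinfun_apply x (f w))"
  using functional_mean_on[OF assms] mean_on_real[OF integrable_functional[OF assms(1)] assms(2)] by simp

context finite_measure
begin

text \<open>The supremum in the Pettis norm is unfolded into a bound uniform in \<open>x\<close>, so
  that later estimates treat one functional at a time with real integrals.\<close>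

definition Pettis_null :: "(nat \<Rightarrow> 'a \<Rightarrow> 'b::real_normed_vector) \<Rightarrow> bool" where
  "Pettis_null g \<longleftrightarrow> (\<forall>e>0. \<forall>\<^sub>F k in sequentially.
     \<forall>x :: 'b \<Rightarrow>\<^sub>L real. norm x \<le> 1 \<longrightarrow> L1_on M (space M) (\<lambda>w. blinfun_apply x (g k w)) \<le> e)"

lemma Pettis_nullD:
  fixes g :: "nat \<Rightarrow> 'a \<Rightarrow> 'b::real_normed_vector"
  shows "Pettis_null g \<Longrightarrow> e > 0 \<Longrightarrow> \<forall>\<^sub>F k in sequentially. \<forall>x :: 'b \<Rightarrow>\<^sub>L real. norm x \<le> 1 \<longrightarrow>
     L1_on M (space M) (\<lambda>w. blinfun_apply x (g k w)) \<le> e"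
  by (simp add: Pettis_null_def)

lemma Pettis_norm_tendsto_0_iff:
  fixes g :: "nat \<Rightarrow> 'a \<Rightarrow> 'b::real_normed_vector"
  assumes g: "\<And>k. L1_regular M (g k)"
  shows "(\<lambda>k. Pettis_norm M (g k)) \<longlonglongrightarrow> 0 \<longleftrightarrow> Pettis_null g"
proof -
  have "Pettis_norm M (g k) = (SUP x\<in>cball (0 :: 'b \<Rightarrow>\<^sub>L real) 1. ennreal (L1_on M (space M) (\<lambda>w. blinfun_apply x (g k w))))" for k
    unfolding Pettis_norm_def L1_on_space
    using nn_integral_norm_L1_regular[OF L1_regular_functional[OF g]] unfolding real_norm_def by simp
  then have "Pettis_norm M (g k) \<le> ennreal e \<longleftrightarrow>
      (\<forall>x :: 'b \<Rightarrow>\<^sub>L real. norm x \<le> 1 \<longrightarrow> L1_on M (space M) (\<lambda>w. blinfun_apply x (g k w)) \<le> e)" if "e > 0" for k e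
    using that by (simp add: SUP_le_iff ennreal_le_iff Ball_def)
  then show ?thesis unfolding ennreal_tendsto_0_iff_le Pettis_null_def by auto
qed

lemma Bocce_osc_eq:
  fixes h :: "'a \<Rightarrow> real"
  assumes h: "L1_regular M h" and A: "A \<in> sets M" "measure M A > 0"
  shows "Bocce_osc M h A = ennreal (osc A h / measure M A)"
proof -
  have "(\<integral>\<^sup>+w\<in>A. ennreal (norm (h w - mean_on M A h)) \<partial>M) =
      (\<integral>\<^sup>+w. ennreal (indicator A w * norm (h w - mean_on M A h)) \<partial>M)"
    by (intro nn_integral_cong) (auto simp: indicator_def)
  also have "\<dots> = ennreal (osc A h)"
    unfolding osc_def L1_on_def
    by (intro nn_integral_eq_integral integrable_L1_on L1_regular_diff h L1_regular_const A AE_I2) auto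
  finally show ?thesis
    unfolding Bocce_osc_def
    using divide_ennreal[OF L1_on_nonneg A(2)] by (simp add: emeasure_eq_measure osc_def)
qed

lemma Pettis_Bocce_osc_le_iff:
  fixes f :: "'a \<Rightarrow> 'b::real_normed_vector"
  assumes f: "L1_regular M f" and A: "A \<in> sets M" "measure M A > 0" and e: "e \<ge> 0"
  shows "Pettis_Bocce_osc M f A \<le> ennreal e \<longleftrightarrow>
    (\<forall>x :: 'b \<Rightarrow>\<^sub>L real. norm x \<le> 1 \<longrightarrow> osc A (\<lambda>w. blinfun_apply x (f w)) \<le> e * measure M A)"
  unfolding Pettis_Bocce_osc_def Bocce_osc_eq[OF L1_regular_functional[OF f] A]
  using A e by (simp add: SUP_le_iff ennreal_le_iff Ball_def pos_divide_le_eq)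

lemma pos_sets_measure: "A \<in> pos_sets M \<longleftrightarrow> A \<in> sets M \<and> measure M A > 0"
  by (auto simp: pos_sets_def emeasure_eq_measure)

text \<open>The set \<open>A\<close> is chosen for \<open>f0\<close> alone, with \<open>f0\<close>
  within \<open>e / 8\<close> of a constant: this gives oscillation \<open>e / 4\<close>, and a
  Pettis distance \<open>e / 8\<close> relative to the measure of \<open>A\<close> adds twice that
  amount. The resulting \<open>e / 2\<close> holds for all large \<open>k\<close>, hence along every
  subsequence.\<close>

lemma Pettis_null_imp_seq_Pettis_Bocce:
  fixes f :: "nat \<Rightarrow> 'a \<Rightarrow> 'b::real_normed_vector"
  assumes f: "\<And>k. L1_regular M (f k)" and f0: "L1_regular M f0"
    and null: "Pettis_null (\<lambda>k w. f k w - f0 w)"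
  shows "seq_Pettis_Bocce M f"
  unfolding seq_Pettis_Bocce_def
proof (intro allI impI ballI)
  fix r :: "nat \<Rightarrow> nat" and e :: real and B assume r: "strict_mono r" and e: "e > 0" and B: "B \<in> pos_sets M"
  have "e / 8 > 0" using e by simp
  from exists_near_const[OF L1_regular_simple_limit[OF f0] this B]
  obtain A c where A: "A \<in> pos_subsets M B" and c: "\<And>w. w \<in> A \<Longrightarrow> norm (f0 w - c) \<le> e / 8" by blast
  then have AM: "A \<in> sets M" "measure M A > 0" by (auto simp: pos_subsets_def pos_sets_measure)
  have "\<forall>\<^sub>F k in sequentially. \<forall>x :: 'b \<Rightarrow>\<^sub>L real. norm x \<le> 1 \<longrightarrow>
      L1_on M (space M) (\<lambda>w. blinfun_apply x (f k w - f0 w)) \<le> e / 8 * measure M A"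
    by (rule Pettis_nullD[OF null]) (use e AM in simp)
  then have "\<forall>\<^sub>F k in sequentially. Pettis_Bocce_osc M (f k) A \<le> ennreal (e / 2)"
  proof eventually_elim
    case (elim k)
    have "osc A (\<lambda>w. blinfun_apply x (f k w)) \<le> e / 2 * measure M A" if x: "norm x \<le> 1" for x :: "'b \<Rightarrow>\<^sub>L real"
    proof -
      note reg = L1_regular_functional[OF f] L1_regular_functional[OF f0]
      have "L1_on M A (\<lambda>w. blinfun_apply x (f k w - f0 w)) \<le> L1_on M (space M) (\<lambda>w. blinfun_apply x (f k w - f0 w))"
        by (intro L1_on_mono L1_regular_functional L1_regular_diff f f0 AM sets.top sets.sets_into_space)
      also have "\<dots> \<le> e / 8 * measure M A" using elim x by blast
      finally have "L1_on M A (\<lambda>w. blinfun_apply x (f k w) - blinfun_apply x (f0 w)) \<le> e / 8 * measure M A"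
        by (simp add: blinfun.diff_right)
      moreover have "osc A (\<lambda>w. blinfun_apply x (f0 w)) \<le> 2 * (e / 8) * measure M A"
        by (rule osc_le_of_near_const[OF f0 AM c x])
      ultimately show ?thesis using osc_le_perturbation[OF reg AM(1), of x k x] by simp
    qed
    then show ?case using Pettis_Bocce_osc_le_iff[OF f AM, of "e / 2"] e by simp
  qed
  then have "\<forall>\<^sub>F j in sequentially. Pettis_Bocce_osc M (f (r j)) A \<le> ennreal (e / 2)"
    by (rule eventually_compose_filterlim[OF _ filterlim_subseq[OF r]])
  then have "liminf (\<lambda>j. Pettis_Bocce_osc M (f (r j)) A) \<le> ennreal (e / 2)"
    by (intro Liminf_le) simp
  also have "\<dots> < ennreal e" using e by (simp add: ennreal_less_iff)
  finally show "\<exists>A\<in>pos_subsets M B. liminf (\<lambda>j. Pettis_Bocce_osc M (f (r j)) A) < ennreal e"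
    using A by blast
qed

text \<open>By duality: a functional of the difference of means is the mean of \<open>x\<close>
  applied to \<open>f k - f0\<close>, and the Pettis distance divided by the measure of
  \<open>B\<close> bounds these means uniformly in \<open>x\<close>.\<close>

lemma Pettis_null_imp_mean_on_tendsto:
  fixes f :: "nat \<Rightarrow> 'a \<Rightarrow> 'b::banach"
  assumes f: "\<And>k. L1_regular M (f k)" and f0: "L1_regular M f0"
    and null: "Pettis_null (\<lambda>k w. f k w - f0 w)" and B: "B \<in> pos_sets M"
  shows "(\<lambda>k. mean_on M B (f k)) \<longlonglongrightarrow> mean_on M B f0"
proof (rule metric_LIMSEQ_I, simp only: dist_norm)
  fix e :: real assume e: "e > 0"
  have BM: "B \<in> sets M" "measure M B > 0" using B by (auto simp: pos_sets_measure)
  have "\<forall>\<^sub>F k in sequentially. \<forall>x :: 'b \<Rightarrow>\<^sub>L real. norm x \<le> 1 \<longrightarrow>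
      L1_on M (space M) (\<lambda>w. blinfun_apply x (f k w - f0 w)) \<le> e / 2 * measure M B"
    by (rule Pettis_nullD[OF null]) (use e BM in simp)
  then have "\<forall>\<^sub>F k in sequentially. norm (mean_on M B (f k) - mean_on M B f0) < e"
  proof eventually_elim
    case (elim k)
    note reg = L1_regular_functional[OF f] L1_regular_functional[OF f0]
    have "norm (mean_on M B (f k) - mean_on M B f0) \<le> e / 2"
    proof (rule norm_le_dual)
      fix x :: "'b \<Rightarrow>\<^sub>L real" assume x: "norm x \<le> 1"
      let ?h = "\<lambda>w. blinfun_apply x (f k w - f0 w)"
      have "blinfun_apply x (mean_on M B (f k) - mean_on M B f0) = mean_on M B ?h"
        by (simp only: blinfun.diff_right functional_mean_on_eq[OF f BM(1)] functional_mean_on_eq[OF f0 BM(1)]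
            mean_on_diff[OF reg BM(1)])
      also have "\<dots> \<le> e / 2"
      proof -
        have "\<bar>mean_on M B ?h\<bar> * measure M B \<le> L1_on M B ?h"
          by (intro abs_mean_on_le L1_regular_functional L1_regular_diff f f0 BM)
        also have "\<dots> \<le> L1_on M (space M) ?h"
          by (intro L1_on_mono L1_regular_functional L1_regular_diff f f0 BM sets.top sets.sets_into_space)
        also have "\<dots> \<le> e / 2 * measure M B" using elim x by blast
        finally show ?thesis using BM(2) by (simp del: times_divide_eq_left)
      qed
      finally show "blinfun_apply x (mean_on M B (f k) - mean_on M B f0) \<le> e / 2" .
    qed
    then show ?case using e by simp
  qed
  then show "\<exists>N. \<forall>k\<ge>N. norm (mean_on M B (f k) - mean_on M B f0) < e"
    by (simp add: eventually_sequentially)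
qed

lemma Pettis_null_functional:
  fixes g :: "nat \<Rightarrow> 'a \<Rightarrow> 'b::real_normed_vector" and y :: "'b \<Rightarrow>\<^sub>L real"
  assumes null: "Pettis_null g"
  shows "(\<lambda>k. L1_on M (space M) (\<lambda>w. blinfun_apply y (g k w))) \<longlonglongrightarrow> 0"
proof -
  \<comment> \<open>The summand 1 avoids dividing by the norm of the zero functional.\<close>
  define C where "C = norm y + 1"
  have C: "C > 0" using norm_ge_zero[of y] by (simp add: C_def del: norm_ge_zero)
  define x where "x = y /\<^sub>R C"
  have x: "norm x \<le> 1" using C by (simp add: x_def C_def field_simps)
  have y: "y = C *\<^sub>R x" using C by (simp add: x_def)
  have eq: "L1_on M (space M) (\<lambda>w. blinfun_apply y (g k w)) = C * L1_on M (space M) (\<lambda>w. blinfun_apply x (g k w))" for k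
    unfolding y L1_on_def using C by (simp add: blinfun.scaleR_left abs_mult mult.left_commute)
  have "(\<lambda>k. L1_on M (space M) (\<lambda>w. blinfun_apply x (g k w))) \<longlonglongrightarrow> 0"
  proof (rule order_tendstoI)
    fix a :: real assume a: "0 < a"
    have "\<forall>\<^sub>F k in sequentially. \<forall>x :: 'b \<Rightarrow>\<^sub>L real. norm x \<le> 1 \<longrightarrow> L1_on M (space M) (\<lambda>w. blinfun_apply x (g k w)) \<le> a / 2"
      by (rule Pettis_nullD[OF null]) (use a in simp)
    then show "\<forall>\<^sub>F k in sequentially. L1_on M (space M) (\<lambda>w. blinfun_apply x (g k w)) < a"
    proof eventually_elim
      case (elim k)
      then have "L1_on M (space M) (\<lambda>w. blinfun_apply x (g k w)) \<le> a / 2" using x by blast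
      then show ?case using a by simp
    qed
  qed (intro always_eventually allI less_le_trans[OF _ L1_on_nonneg])
  then show ?thesis unfolding eq using tendsto_mult_right_zero by blast
qed

lemma pair_simple_eq_sum:
  fixes g :: "'a \<Rightarrow> 'b::real_normed_vector"
  assumes s: "simple_function M s" and g: "L1_regular M g"
  shows "pair g s = (\<Sum>y\<in>s ` space M. \<integral>w. indicator (s -` {y} \<inter> space M) w * blinfun_apply y (g w) \<partial>M)"
proof -
  have "pair g s = (\<integral>w. (\<Sum>y\<in>s ` space M. indicator (s -` {y} \<inter> space M) w * blinfun_apply y (g w)) \<partial>M)"
    unfolding pair_def
  proof (rule Bochner_Integration.integral_cong[OF refl])
    fix w assume w: "w \<in> space M"
    have "(\<Sum>y\<in>s ` space M. indicator (s -` {y} \<inter> space M) w * blinfun_apply y (g w)) =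
        (\<Sum>y\<in>s ` space M. if y = s w then blinfun_apply y (g w) else 0)"
      using w by (intro sum.cong) (auto simp: indicator_def)
    also have "\<dots> = blinfun_apply (s w) (g w)"
      using simple_functionD(1)[OF s] w by simp
    finally show "blinfun_apply (s w) (g w) =
      (\<Sum>y\<in>s ` space M. indicator (s -` {y} \<inter> space M) w * blinfun_apply y (g w))" by simp
  qed
  also have "\<dots> = (\<Sum>y\<in>s ` space M. \<integral>w. indicator (s -` {y} \<inter> space M) w * blinfun_apply y (g w) \<partial>M)"
  proof (rule Bochner_Integration.integral_sum)
    fix y
    show "integrable M (\<lambda>w. indicator (s -` {y} \<inter> space M) w * blinfun_apply y (g w))"
      using integrable_mult_indicator[OF simple_functionD(2)[OF s, of "{y}"] integrable_functional[OF g, of y]] by simp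
  qed
  finally show ?thesis .
qed

text \<open>The pairing is a finite sum over the values \<open>y\<close> of \<open>s\<close>; each
  term integrates one fixed functional of \<open>g k\<close> over a level set, which the Pettis norm
  controls.\<close>

lemma Pettis_null_pair_simple:
  fixes g :: "nat \<Rightarrow> 'a \<Rightarrow> 'b::real_normed_vector"
  assumes g: "\<And>k. L1_regular M (g k)" and null: "Pettis_null g" and s: "simple_function M s"
  shows "(\<lambda>k. pair (g k) s) \<longlonglongrightarrow> 0"
  unfolding pair_simple_eq_sum[OF s g]
proof (rule tendsto_null_sum)
  fix y
  let ?A = "s -` {y} \<inter> space M"
  have A: "?A \<in> sets M" by (rule simple_functionD(2)[OF s])
  show "(\<lambda>k. \<integral>w. indicator ?A w * blinfun_apply y (g k w) \<partial>M) \<longlonglongrightarrow> 0"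
  proof (rule Lim_null_comparison[OF always_eventually Pettis_null_functional[OF null, of y]], rule allI)
    fix k
    have "norm (\<integral>w. indicator ?A w * blinfun_apply y (g k w) \<partial>M) \<le>
        (\<integral>w. norm (indicator ?A w * blinfun_apply y (g k w)) \<partial>M)"
      by (rule integral_norm_bound)
    also have "\<dots> = L1_on M ?A (\<lambda>w. blinfun_apply y (g k w))"
      unfolding L1_on_def by (simp add: abs_mult)
    also have "\<dots> \<le> L1_on M (space M) (\<lambda>w. blinfun_apply y (g k w))"
      by (intro L1_on_mono L1_regular_functional g A sets.top) auto
    finally show "norm (\<integral>w. indicator ?A w * blinfun_apply y (g k w) \<partial>M) \<le>
        L1_on M (space M) (\<lambda>w. blinfun_apply y (g k w))" .
  qed
qed

text \<open>The simple \<open>s i\<close> approximate \<open>b\<close> only in the mean, while the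
  \<open>f k\<close> are unbounded. Cutting \<open>f k\<close> and \<open>f0\<close> at fixed levels
  \<open>c1\<close> and \<open>c2\<close> makes one \<open>s i\<close> good for all \<open>k\<close>
  at once.\<close>

lemma Pettis_null_imp_weakly_null:
  fixes f :: "nat \<Rightarrow> 'a \<Rightarrow> 'b::real_normed_vector"
  assumes f: "\<And>k. L1_regular M (f k)" and f0: "L1_regular M f0"
    and null: "Pettis_null (\<lambda>k w. f k w - f0 w)" and ui: "unif_int f" and b: "b \<in> dual_ball"
  shows "(\<lambda>k. pair (\<lambda>w. f k w - f0 w) b) \<longlonglongrightarrow> 0"
proof (rule LIMSEQ_I)
  fix e :: real assume e: "e > 0"
  let ?g = "\<lambda>k w. f k w - f0 w"
  note g = L1_regular_diff[OF f f0]
  have "simple_limit M b" using b by (simp add: dual_ball_def)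
  from simple_limit_dominated_approx[OF this] obtain s where s: "\<And>i::nat. simple_function M (s i)"
    "\<And>w. w \<in> space M \<Longrightarrow> (\<lambda>i. s i w) \<longlonglongrightarrow> b w" "\<And>i w. norm (s i w) \<le> 2 * norm (b w)"
    by blast
  have nb: "norm (b w) \<le> 1" for w using b by (simp add: dual_ball_def)
  have ns: "norm (s i w) \<le> 2" for i w using s(3)[of i w] nb[of w] by simp
  have h3: "norm (b w - s i w) \<le> 3" for i w
    using norm_triangle_ineq4[of "b w" "s i w"] nb[of w] ns[of i w] by linarith
  have hm: "(\<lambda>w. norm (b w - s i w)) \<in> borel_measurable M" for i
    using b s(1) by (intro borel_measurable_simple_limit simple_limit_norm simple_limit_diff)
      (auto simp: dual_ball_def simple_limit_simple_function)
  have "(\<lambda>i. \<integral>w. norm (b w - s i w) \<partial>M) \<longlonglongrightarrow> (\<integral>w. 0 \<partial>M)"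
  proof (rule integral_dominated_convergence[where w = "\<lambda>_. 3"])
    show "AE w in M. (\<lambda>i. norm (b w - s i w)) \<longlonglongrightarrow> 0"
    proof (rule AE_I2)
      fix w assume "w \<in> space M"
      then show "(\<lambda>i. norm (b w - s i w)) \<longlonglongrightarrow> 0"
        using tendsto_norm[OF tendsto_diff[OF tendsto_const[of "b w"] s(2)[of w]]] by simp
    qed
    show "AE w in M. norm (norm (b w - s i w)) \<le> 3" for i using h3 by simp
  qed (use hm in auto)
  then have hlim: "(\<lambda>i. \<integral>w. norm (b w - s i w) \<partial>M) \<longlonglongrightarrow> 0" by simp
  \<comment> \<open>As \<open>norm (b w - s i w) \<le> 3\<close>, each of the two tails costs
    \<open>3 * (e / 12)\<close>; with \<open>e / 4\<close> from the bounded parts this leaves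
    \<open>e / 4\<close> for the pairing with \<open>s i\<close>.\<close>
  have e12: "e / 12 > 0" using e by simp
  then obtain c1 where c1: "c1 > 0" "\<And>k. L1_on M (norm_tail M c1 (f k)) (f k) \<le> e / 12"
    using ui unfolding unif_int_def by blast
  obtain c2 where c2: "c2 > 0" "L1_on M (norm_tail M c2 f0) f0 \<le> e / 12"
    using L1_norm_tail_small[OF f0 e12] by blast
  have "\<forall>\<^sub>F i in sequentially. (\<integral>w. norm (b w - s i w) \<partial>M) < e / (4 * (c1 + c2))"
    using hlim e c1(1) c2(1) by (intro order_tendstoD(2)) auto
  then obtain i where i: "(\<integral>w. norm (b w - s i w) \<partial>M) < e / (4 * (c1 + c2))"
    by (auto simp: eventually_sequentially)
  let ?h = "\<lambda>w. norm (b w - s i w)"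
  have close: "\<bar>pair (?g k) b - pair (?g k) (s i)\<bar> \<le> 3 * e / 4" for k
  proof -
    have ib: "integrable M (\<lambda>w. blinfun_apply (b w) (?g k w))" by (rule integrable_pair[OF g b])
    have is': "integrable M (\<lambda>w. blinfun_apply (s i w) (?g k w))"
      by (rule integrable_pairing[OF g simple_limit_simple_function[OF s(1)] ns])
    have if1: "integrable M (\<lambda>w. norm (f k w) * ?h w)" "integrable M (\<lambda>w. norm (f0 w) * ?h w)"
      using hm h3 by (auto intro!: integrable_norm_mult_bounded[where K = 3] f f0)
    have "pair (?g k) b - pair (?g k) (s i) = (\<integral>w. blinfun_apply (b w) (?g k w) - blinfun_apply (s i w) (?g k w) \<partial>M)"
      unfolding pair_def by (rule Bochner_Integration.integral_diff[OF ib is', symmetric])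
    also have "\<bar>\<dots>\<bar> \<le> (\<integral>w. \<bar>blinfun_apply (b w) (?g k w) - blinfun_apply (s i w) (?g k w)\<bar> \<partial>M)"
      by (rule integral_abs_bound)
    also have "\<dots> \<le> (\<integral>w. norm (f k w) * ?h w + norm (f0 w) * ?h w \<partial>M)"
    proof (rule integral_mono)
      fix w
      have "\<bar>blinfun_apply (b w - s i w) (?g k w)\<bar> \<le> ?h w * norm (?g k w)"
        using norm_blinfun[of "b w - s i w" "?g k w"] by simp
      also have "\<dots> \<le> ?h w * (norm (f k w) + norm (f0 w))"
        by (intro mult_left_mono norm_triangle_ineq4) auto
      finally show "\<bar>blinfun_apply (b w) (?g k w) - blinfun_apply (s i w) (?g k w)\<bar>
          \<le> norm (f k w) * ?h w + norm (f0 w) * ?h w"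
        by (simp add: blinfun.diff_left algebra_simps)
    next
      show "integrable M (\<lambda>w. \<bar>blinfun_apply (b w) (?g k w) - blinfun_apply (s i w) (?g k w)\<bar>)"
        by (intro integrable_abs Bochner_Integration.integrable_diff ib is')
      show "integrable M (\<lambda>w. norm (f k w) * ?h w + norm (f0 w) * ?h w)"
        by (intro Bochner_Integration.integrable_add if1)
    qed
    also have "\<dots> = (\<integral>w. norm (f k w) * ?h w \<partial>M) + (\<integral>w. norm (f0 w) * ?h w \<partial>M)"
      by (rule Bochner_Integration.integral_add[OF if1])
    also have "\<dots> \<le> (3 * L1_on M (norm_tail M c1 (f k)) (f k) + c1 * (\<integral>w. ?h w \<partial>M))
        + (3 * L1_on M (norm_tail M c2 f0) f0 + c2 * (\<integral>w. ?h w \<partial>M))"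
      using hm h3 c1(1) c2(1) by (intro add_mono integral_norm_mult_le f f0) auto
    also have "\<dots> \<le> (3 * (e / 12) + c1 * (\<integral>w. ?h w \<partial>M)) + (3 * (e / 12) + c2 * (\<integral>w. ?h w \<partial>M))"
      using c1(2)[of k] c2(2) by simp
    also have "\<dots> = e / 2 + (c1 + c2) * (\<integral>w. ?h w \<partial>M)" by (simp add: algebra_simps)
    also have "\<dots> \<le> e / 2 + (c1 + c2) * (e / (4 * (c1 + c2)))"
      using i c1(1) c2(1) by (intro add_left_mono mult_left_mono) auto
    also have "(c1 + c2) * (e / (4 * (c1 + c2))) = e / 4" using c1(1) c2(1) by (simp add: field_simps)
    finally show ?thesis by simp
  qed
  obtain N where N: "\<And>k. k \<ge> N \<Longrightarrow> norm (pair (?g k) (s i) - 0) < e / 4"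
    using LIMSEQ_D[OF Pettis_null_pair_simple[OF g null s(1)[of i]], of "e / 4"] e by auto
  show "\<exists>N. \<forall>k\<ge>N. norm (pair (?g k) b - 0) < e"
  proof (intro exI[of _ N] allI impI)
    fix k assume "k \<ge> N"
    then have "\<bar>pair (?g k) (s i)\<bar> < e / 4" using N[of k] by simp
    then show "norm (pair (?g k) b - 0) < e" using close[of k] unfolding real_norm_def by linarith
  qed
qed

lemma seq_Pettis_Bocce_imp_Pettis_null:
  fixes f :: "nat \<Rightarrow> 'a \<Rightarrow> 'b::banach"
  assumes f: "\<And>k. L1_regular M (f k)" and f0: "L1_regular M f0"
    and ui: "unif_int f" and bocce: "seq_Pettis_Bocce M f"
    and mean: "\<forall>B\<in>pos_sets M. (\<lambda>k. mean_on M B (f k)) \<longlonglongrightarrow> mean_on M B f0"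
  shows "Pettis_null (\<lambda>k w. f k w - f0 w)"
proof (rule ccontr)
  let ?g = "\<lambda>k w. f k w - f0 w"
  note g = L1_regular_diff[OF f f0]
  note gx = L1_regular_functional[OF g]
  assume "\<not> Pettis_null ?g"
  then obtain e where e: "e > 0" and ev: "\<not> (\<forall>\<^sub>F k in sequentially. \<forall>x :: 'b \<Rightarrow>\<^sub>L real. norm x \<le> 1 \<longrightarrow>
      L1_on M (space M) (\<lambda>w. blinfun_apply x (?g k w)) \<le> e)"
    unfolding Pettis_null_def by blast
  \<comment> \<open>Bad indices, each with its own violating functional. Exhausting within
    \<open>I\<close> leaves an infinite set of bad indices, one of which finally turns out to
    satisfy the bound.\<close>
  define I where "I = {k. \<exists>x :: 'b \<Rightarrow>\<^sub>L real. norm x \<le> 1 \<and> L1_on M (space M) (\<lambda>w. blinfun_apply x (?g k w)) > e}"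
  have I: "infinite I"
    unfolding infinite_nat_iff_unbounded_le I_def using ev
    by (auto simp: eventually_sequentially not_le)
  define m where "m = measure M (space M)"
  have m: "m \<ge> 0" by (simp add: m_def)
  \<comment> \<open>Relative to their measure, so that the disjoint good sets together contribute at
    most \<open>\<eta> * m \<le> e / 4\<close>, whatever their number.\<close>
  define \<eta> where "\<eta> = e / (4 * (m + 1))"
  have \<eta>: "\<eta> > 0" "\<eta> * m \<le> e / 4" using e m by (auto simp: \<eta>_def field_simps)
  define R where "R A k \<longleftrightarrow> (\<forall>x :: 'b \<Rightarrow>\<^sub>L real. norm x \<le> 1 \<longrightarrow> L1_on M A (\<lambda>w. blinfun_apply x (?g k w)) \<le> \<eta> * measure M A)" for A k
  have ext: "\<exists>A\<in>pos_subsets M B. \<exists>J\<subseteq>I. infinite J \<and> (\<forall>k\<in>J. R A k)"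
    if B: "B \<in> pos_sets M" and I: "infinite I" for B I
  proof -
    \<comment> \<open>The budget in units of \<open>\<eta> / 4\<close>: one for the oscillation of
      \<open>f k\<close>, two for that of \<open>f0\<close>, one for the means.\<close>
    have "\<eta> / 4 > 0" using \<eta> by simp
    from exists_near_const[OF L1_regular_simple_limit[OF f0] this B]
    obtain B' c where B': "B' \<in> pos_subsets M B" and c: "\<And>w. w \<in> B' \<Longrightarrow> norm (f0 w - c) \<le> \<eta> / 4" by blast
    \<comment> \<open>The criterion is applied to the subsequence enumerating \<open>I\<close>, and
      inside \<open>B'\<close>, so that \<open>f0\<close> stays nearly constant on the set it
      returns.\<close>
    define r where "r = enumerate I"
    have r: "strict_mono r" "range r = I"
      unfolding r_def using I by (auto simp: strict_mono_enumerate range_enumerate)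
    have "B' \<in> pos_sets M" using B' by (auto simp: pos_subsets_def)
    with bocce r(1) \<open>\<eta> / 4 > 0\<close> obtain A where A: "A \<in> pos_subsets M B'"
      and lim: "liminf (\<lambda>j. Pettis_Bocce_osc M (f (r j)) A) < ennreal (\<eta> / 4)"
      unfolding seq_Pettis_Bocce_def by blast
    have AB: "A \<in> pos_subsets M B" "A \<subseteq> B'" and AM: "A \<in> sets M" "measure M A > 0" "A \<in> pos_sets M"
      using A B' by (auto simp: pos_subsets_def pos_sets_measure)
    \<comment> \<open>A small lower limit yields infinitely many good indices, not all large ones;
      hence the passage to \<open>J\<close>.\<close>
    have freq: "\<exists>j\<ge>N. Pettis_Bocce_osc M (f (r j)) A < ennreal (\<eta> / 4)" for N
    proof (rule ccontr)
      assume "\<not> ?thesis"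
      then have "\<forall>\<^sub>F j in sequentially. ennreal (\<eta> / 4) \<le> Pettis_Bocce_osc M (f (r j)) A"
        by (auto simp: eventually_sequentially not_less)
      from Liminf_bounded[OF this] lim show False by simp
    qed
    have "(\<lambda>k. norm (mean_on M A (f k) - mean_on M A f0)) \<longlonglongrightarrow> 0"
      using bspec[OF mean AM(3)] by (simp add: tendsto_norm_zero_iff LIM_zero_iff)
    then have "\<forall>\<^sub>F k in sequentially. norm (mean_on M A (f k) - mean_on M A f0) < \<eta> / 4"
      using \<eta> by (intro order_tendstoD(2)) auto
    then obtain N where N: "\<And>k. k \<ge> N \<Longrightarrow> norm (mean_on M A (f k) - mean_on M A f0) < \<eta> / 4"
      by (auto simp: eventually_sequentially)
    define J where "J = {k \<in> I. k \<ge> N \<and> Pettis_Bocce_osc M (f k) A < ennreal (\<eta> / 4)}"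
    have "infinite J"
      unfolding infinite_nat_iff_unbounded_le
    proof
      fix n
      obtain j where j: "j \<ge> max n N" "Pettis_Bocce_osc M (f (r j)) A < ennreal (\<eta> / 4)" using freq by blast
      moreover have "r j \<ge> j" using r(1) by (rule strict_mono_imp_increasing)
      moreover have "r j \<in> I" using r(2) by blast
      ultimately show "\<exists>k\<ge>n. k \<in> J" by (intro exI[of _ "r j"]) (auto simp: J_def)
    qed
    moreover have "R A k" if k: "k \<in> J" for k
      unfolding R_def
    proof (intro allI impI)
      fix x :: "'b \<Rightarrow>\<^sub>L real" assume x: "norm x \<le> 1"
      note reg = L1_regular_functional[OF f] L1_regular_functional[OF f0]
      have "Pettis_Bocce_osc M (f k) A \<le> ennreal (\<eta> / 4)" using k by (simp add: J_def less_imp_le)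
      then have 1: "osc A (\<lambda>w. blinfun_apply x (f k w)) \<le> \<eta> / 4 * measure M A"
        using Pettis_Bocce_osc_le_iff[OF f AM(1,2), of "\<eta> / 4" k] \<eta> x by simp
      have 2: "osc A (\<lambda>w. blinfun_apply x (f0 w)) \<le> 2 * (\<eta> / 4) * measure M A"
        using AB(2) by (intro osc_le_of_near_const[OF f0 AM(1,2) _ x, of c] c) auto
      have "\<bar>blinfun_apply x (mean_on M A (f k) - mean_on M A f0)\<bar> \<le> \<eta> / 4"
        using abs_blinfun_le[OF x, of "mean_on M A (f k) - mean_on M A f0"] N[of k] k by (simp add: J_def)
      then have "\<bar>mean_on M A (\<lambda>w. blinfun_apply x (f k w)) - mean_on M A (\<lambda>w. blinfun_apply x (f0 w))\<bar> \<le> \<eta> / 4"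
        using functional_mean_on_eq[OF f AM(1), of x k] functional_mean_on_eq[OF f0 AM(1), of x]
        by (simp add: blinfun.diff_right)
      from mult_right_mono[OF this, of "measure M A"]
      have 3: "\<bar>mean_on M A (\<lambda>w. blinfun_apply x (f k w)) - mean_on M A (\<lambda>w. blinfun_apply x (f0 w))\<bar> * measure M A
          \<le> \<eta> / 4 * measure M A" by simp
      have "L1_on M A (\<lambda>w. blinfun_apply x (?g k w)) \<le> \<eta> / 4 * measure M A + 2 * (\<eta> / 4) * measure M A + \<eta> / 4 * measure M A"
        using L1_on_diff_le_osc[OF reg AM(1), of x k x] 1 2 3 by (simp add: blinfun.diff_right)
      also have "\<dots> = \<eta> * measure M A" by simp
      finally show "L1_on M A (\<lambda>w. blinfun_apply x (?g k w)) \<le> \<eta> * measure M A" .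
    qed
    ultimately show ?thesis using AB(1) by (intro bexI[of _ A] exI[of _ J]) (auto simp: J_def)
  qed
  have "R {} k" for k by (simp add: R_def L1_on_def)
  from exhaustion[of R, OF ext this I] obtain J A where J: "J \<subseteq> I" "infinite J"
    and A: "disjoint_family A" "space M - (\<Union>n. A n) \<in> null_sets M"
      "\<And>n. A n \<in> sets M" "\<And>n::nat. \<exists>N. \<forall>k\<in>J. k \<ge> N \<longrightarrow> R (A n) k" by blast
  have e8: "e / 8 > 0" using e by simp
  from unif_int_L1_on_continuous[OF f ui this] obtain \<delta>1 where \<delta>1: "\<delta>1 > 0"
    "\<And>C k. C \<in> sets M \<Longrightarrow> measure M C \<le> \<delta>1 \<Longrightarrow> L1_on M C (f k) \<le> e / 8" by blast
  from L1_on_continuous[OF f0 e8] obtain \<delta>2 where \<delta>2: "\<delta>2 > 0"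
    "\<And>C. C \<in> sets M \<Longrightarrow> measure M C \<le> \<delta>2 \<Longrightarrow> L1_on M C f0 \<le> e / 8" by blast
  let ?U = "\<lambda>n. \<Union>i<n. A i"
  have U: "?U n \<in> sets M" for n using A(3) by auto
  have "(\<lambda>n. measure M (?U n)) \<longlonglongrightarrow> measure M (\<Union>n. ?U n)"
    using U by (intro finite_Lim_measure_incseq) (auto simp: incseq_Suc_iff lessThan_Suc)
  moreover have "(\<Union>n. ?U n) = (\<Union>n. A n)" by auto
  moreover have "measure M (\<Union>n. A n) = measure M (space M)"
  proof -
    have "measure M (space M - (\<Union>n. A n)) = 0" using A(2) by (simp add: measure_eq_0_null_sets)
    then show ?thesis using finite_measure_compl[of "\<Union>n. A n"] A(3) by auto
  qed
  ultimately have "(\<lambda>n. measure M (space M) - measure M (?U n)) \<longlonglongrightarrow> measure M (space M) - measure M (space M)"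
    by (intro tendsto_intros) simp
  then have "\<forall>\<^sub>F n in sequentially. measure M (space M) - measure M (?U n) < min \<delta>1 \<delta>2"
    using \<delta>1(1) \<delta>2(1) by (intro order_tendstoD(2)) auto
  then obtain n where "measure M (space M) - measure M (?U n) < min \<delta>1 \<delta>2"
    by (auto simp: eventually_sequentially)
  then have rest: "measure M (space M - ?U n) \<le> \<delta>1" "measure M (space M - ?U n) \<le> \<delta>2"
    using finite_measure_compl[OF U[of n]] by auto
  \<comment> \<open>Each good set has its own threshold; finitely many of them have a common
    one.\<close>
  have "\<exists>N. \<forall>k\<in>J. k \<ge> N \<longrightarrow> (\<forall>i<j. R (A i) k)" for j
  proof (induction j)
    case (Suc j)
    then obtain N where N: "\<forall>k\<in>J. k \<ge> N \<longrightarrow> (\<forall>i<j. R (A i) k)" by blast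
    obtain N' where N': "\<forall>k\<in>J. k \<ge> N' \<longrightarrow> R (A j) k" using A(4) by blast
    show ?case using N N' by (intro exI[of _ "max N N'"]) (auto simp: less_Suc_eq)
  qed simp
  from this[of n] obtain N where N: "\<forall>k\<in>J. k \<ge> N \<longrightarrow> (\<forall>i<n. R (A i) k)" by blast
  obtain k where k: "k \<in> J" "k \<ge> N" using J(2) unfolding infinite_nat_iff_unbounded_le by blast
  then have Rk: "R (A i) k" if "i < n" for i using N that by blast
  obtain x :: "'b \<Rightarrow>\<^sub>L real" where x: "norm x \<le> 1" "L1_on M (space M) (\<lambda>w. blinfun_apply x (?g k w)) > e"
    using k(1) J(1) by (auto simp: I_def)
  have "L1_on M (?U j) (\<lambda>w. blinfun_apply x (?g k w)) \<le> \<eta> * measure M (?U j)" if "j \<le> n" for j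
    using that
  proof (induction j)
    case (Suc j)
    have "A j \<inter> A i = {}" if "i < j" for i
      using disjoint_family_onD[OF A(1), of j i] that by simp
    then have disj: "A j \<inter> ?U j = {}" by blast
    have "L1_on M (?U (Suc j)) (\<lambda>w. blinfun_apply x (?g k w)) \<le>
        L1_on M (A j) (\<lambda>w. blinfun_apply x (?g k w)) + L1_on M (?U j) (\<lambda>w. blinfun_apply x (?g k w))"
      using L1_on_subadditive[OF gx A(3) U] by (simp add: lessThan_Suc)
    also have "\<dots> \<le> \<eta> * measure M (A j) + \<eta> * measure M (?U j)"
      using Suc Rk[of j] x(1) by (intro add_mono) (auto simp: R_def)
    also have "\<dots> = \<eta> * measure M (?U (Suc j))"
      using finite_measure_Union[OF A(3)[of j] U[of j] disj] by (simp add: lessThan_Suc algebra_simps)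
    finally show ?case .
  qed (simp add: L1_on_def)
  then have U_le: "L1_on M (?U n) (\<lambda>w. blinfun_apply x (?g k w)) \<le> \<eta> * measure M (?U n)" by simp
  have "\<eta> * measure M (?U n) \<le> \<eta> * m"
    using \<eta>(1) by (intro mult_left_mono) (auto simp: m_def intro: bounded_measure)
  with U_le \<eta>(2) have part1: "L1_on M (?U n) (\<lambda>w. blinfun_apply x (?g k w)) \<le> e / 4" by linarith
  let ?C = "space M - ?U n"
  have C: "?C \<in> sets M" using U by auto
  have "L1_on M ?C (\<lambda>w. blinfun_apply x (?g k w)) \<le> L1_on M ?C (?g k)"
    by (rule L1_on_functional_le[OF g C x(1)])
  also have "\<dots> \<le> L1_on M ?C (f k) + L1_on M ?C f0"
    by (intro L1_on_le g f f0 C norm_triangle_ineq4)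
  also have "\<dots> \<le> e / 8 + e / 8"
    using \<delta>1(2)[OF C rest(1)] \<delta>2(2)[OF C rest(2)] by (intro add_mono)
  finally have part2: "L1_on M ?C (\<lambda>w. blinfun_apply x (?g k w)) \<le> e / 4" by simp
  have "L1_on M (space M) (\<lambda>w. blinfun_apply x (?g k w)) \<le> e / 4 + e / 4"
  proof -
    have "?U n \<union> ?C = space M" using sets.sets_into_space[OF U[of n]] by blast
    then show ?thesis using L1_on_subadditive[OF gx[of x k] U[of n] C] part1 part2 by simp
  qed
  then show False using x(2) e by simp
qed

end

section \<open>The weak topologies\<close>

text \<open>A subsequence staying away from \<open>l\<close> would have a further subsequence
  converging to some \<open>m\<close> by compactness; functionals separate points, so
  \<open>m = l\<close>.\<close>

lemma tendsto_if_weakly_tendsto_relatively_compact: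
  fixes u :: "nat \<Rightarrow> 'b::real_normed_vector"
  assumes cpt: "compact (closure (range u))"
    and weak: "\<And>x :: 'b \<Rightarrow>\<^sub>L real. (\<lambda>k. blinfun_apply x (u k)) \<longlonglongrightarrow> blinfun_apply x l"
  shows "u \<longlonglongrightarrow> l"
proof (rule ccontr)
  assume "\<not> u \<longlonglongrightarrow> l"
  then obtain e where e: "e > 0" "\<not> (\<forall>\<^sub>F k in sequentially. dist (u k) l < e)"
    unfolding tendsto_iff by blast
  define I where "I = {k. dist (u k) l \<ge> e}"
  have I: "infinite I"
    unfolding infinite_nat_iff_unbounded_le I_def using e(2) by (auto simp: eventually_sequentially not_less)
  define r where "r = enumerate I"
  have r: "strict_mono r" "\<And>j. r j \<in> I"
    unfolding r_def using I by (auto simp: strict_mono_enumerate enumerate_in_set)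
  have "\<forall>j. u (r j) \<in> closure (range u)" using closure_subset[of "range u"] by blast
  from seq_compactE[OF compact_imp_seq_compact[OF cpt] this]
  obtain m s where s: "strict_mono (s :: nat \<Rightarrow> nat)" "((\<lambda>j. u (r j)) \<circ> s) \<longlonglongrightarrow> m" by metis
  have sub: "strict_mono (r \<circ> s)" using r(1) s(1) by (rule strict_mono_o)
  have "norm (m - l) \<le> 0"
  proof (rule norm_le_dual)
    fix x :: "'b \<Rightarrow>\<^sub>L real"
    have "(\<lambda>j. blinfun_apply x (u (r (s j)))) \<longlonglongrightarrow> blinfun_apply x m"
      using s(2) by (intro tendsto_intros) (simp add: o_def)
    moreover have "(\<lambda>j. blinfun_apply x (u (r (s j)))) \<longlonglongrightarrow> blinfun_apply x l"
      using LIMSEQ_subseq_LIMSEQ[OF weak sub] by (simp add: o_def)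
    ultimately have "blinfun_apply x m = blinfun_apply x l" by (rule LIMSEQ_unique)
    then show "blinfun_apply x (m - l) \<le> 0" by (simp add: blinfun.diff_right)
  qed
  then have "m = l" by simp
  have "(\<lambda>j. dist (u (r (s j))) l) \<longlonglongrightarrow> dist m l"
    using s(2) by (intro tendsto_intros) (simp add: o_def)
  then have "e \<le> dist m l"
    by (rule LIMSEQ_le_const) (use r(2) in \<open>auto simp: I_def\<close>)
  then show False using \<open>m = l\<close> e(1) by simp
qed

text \<open>In an open cover of the range together with \<open>l\<close>, a member containing
  \<open>l\<close> absorbs a tail, and finitely many points remain.\<close>

lemma compact_closure_range_of_tendsto:
  fixes u :: "nat \<Rightarrow> 'b::metric_space"
  assumes u: "u \<longlonglongrightarrow> l"
  shows "compact (closure (range u))"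
proof -
  have "compact (insert l (range u))"
    unfolding compact_eq_Heine_Borel
  proof (intro allI impI, elim conjE)
    fix \<C> assume op: "\<forall>T\<in>\<C>. open T" and cover: "insert l (range u) \<subseteq> \<Union>\<C>"
    then obtain T where T: "T \<in> \<C>" "l \<in> T" by blast
    then have "\<forall>\<^sub>F k in sequentially. u k \<in> T" using op u by (intro topological_tendstoD) auto
    then obtain N where N: "\<And>k. k \<ge> N \<Longrightarrow> u k \<in> T" by (auto simp: eventually_sequentially)
    have "\<forall>k. \<exists>C\<in>\<C>. u k \<in> C" using cover by blast
    then obtain C where C: "\<And>k. C k \<in> \<C>" "\<And>k. u k \<in> C k" by metis
    have "insert l (range u) \<subseteq> \<Union>(insert T (C ` {..<N}))"
    proof
      fix y assume "y \<in> insert l (range u)"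
      then consider "y = l" | k where "y = u k" by blast
      then show "y \<in> \<Union>(insert T (C ` {..<N}))"
      proof cases
        case (2 k)
        then show ?thesis using N[of k] C(2)[of k] by (cases "k < N") auto
      qed (use T in auto)
    qed
    moreover have "insert T (C ` {..<N}) \<subseteq> \<C>" using T(1) C(1) by blast
    ultimately show "\<exists>\<C>'\<subseteq>\<C>. finite \<C>' \<and> insert l (range u) \<subseteq> \<Union>\<C>'"
      by (intro exI[of _ "insert T (C ` {..<N})"]) simp
  qed
  moreover from this have "closure (range u) \<subseteq> insert l (range u)"
    by (intro closure_minimal compact_imp_closed) auto
  ultimately show ?thesis
    using compact_Int_closed[of "insert l (range u)" "closure (range u)"] by (simp add: Int_absorb1)
qed

lemma dual_pairing_cong_AE: "AE w in M. f w = g w \<Longrightarrow> dual_pairing M f b = dual_pairing M g b"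
  unfolding dual_pairing_def by (rule Bochner_int_cong_AE) auto

text \<open>For the converse direction, induction over the generation of open sets: a sequence
  eventually in each subbasic neighbourhood of \<open>f0\<close> is eventually in each finite
  intersection and union containing \<open>f0\<close>.\<close>

lemma limitin_sigma_L1_Linf_iff:
  fixes f :: "nat \<Rightarrow> 'w \<Rightarrow> 'a::real_normed_vector"
  assumes f: "\<And>k. f k \<in> L1_space M" and f0: "f0 \<in> L1_space M"
  shows "limitin (sigma_L1_Linf M) f f0 sequentially \<longleftrightarrow>
    (\<forall>b\<in>Linf_dual M. (\<lambda>k. dual_pairing M (f k) b) \<longlonglongrightarrow> dual_pairing M f0 b)"
proof
  assume lim: "limitin (sigma_L1_Linf M) f f0 sequentially"
  show "\<forall>b\<in>Linf_dual M. (\<lambda>k. dual_pairing M (f k) b) \<longlonglongrightarrow> dual_pairing M f0 b"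
  proof (intro ballI topological_tendstoI)
    fix b :: "'w \<Rightarrow> 'a \<Rightarrow>\<^sub>L real" and U assume b: "b \<in> Linf_dual M" and U: "open U" "dual_pairing M f0 b \<in> U"
    let ?V = "{f \<in> L1_space M. dual_pairing M f b \<in> U}"
    have "openin (sigma_L1_Linf M) ?V"
      unfolding sigma_L1_Linf_def using b U(1) by (intro topology_generated_by_Basis) blast
    moreover have "f0 \<in> ?V" using f0 U(2) by simp
    ultimately have "\<forall>\<^sub>F k in sequentially. f k \<in> ?V"
      using lim unfolding limitin_def by metis
    then show "\<forall>\<^sub>F k in sequentially. dual_pairing M (f k) b \<in> U" by eventually_elim simp
  qed
next
  let ?S = "{{f \<in> L1_space M. dual_pairing M f b \<in> U} | (b :: 'w \<Rightarrow> 'a \<Rightarrow>\<^sub>L real) U. b \<in> Linf_dual M \<and> open U}"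
  assume lim: "\<forall>b\<in>Linf_dual M. (\<lambda>k. dual_pairing M (f k) b) \<longlonglongrightarrow> dual_pairing M f0 b"
  \<comment> \<open>\<open>limitin\<close> also asks that \<open>f0\<close> be a point of the
    topology; the zero test function with the whole line makes \<open>L1_space M\<close> itself
    subbasic.\<close>
  have "(\<lambda>_. 0) \<in> (Linf_dual M :: ('w \<Rightarrow> 'a \<Rightarrow>\<^sub>L real) set)"
    using strongly_measurable_simple_limit[OF simple_limit_const] by (simp add: Linf_dual_def image_constant_conv)
  then have "L1_space M \<in> ?S" by (intro CollectI exI[of _ "\<lambda>_. 0"] exI[of _ UNIV]) auto
  then have top: "f0 \<in> topspace (sigma_L1_Linf M)"
    unfolding sigma_L1_Linf_def topology_generated_by_topspace using f0 by blast
  have "f0 \<in> V \<longrightarrow> (\<forall>\<^sub>F k in sequentially. f k \<in> V)" if "generate_topology_on ?S V" for V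
    using that
  proof induction
    case (Int a b)
    show ?case
    proof
      assume "f0 \<in> a \<inter> b"
      with Int have "\<forall>\<^sub>F k in sequentially. f k \<in> a" "\<forall>\<^sub>F k in sequentially. f k \<in> b" by auto
      then show "\<forall>\<^sub>F k in sequentially. f k \<in> a \<inter> b" by eventually_elim simp
    qed
  next
    case (UN K)
    show ?case
    proof
      assume "f0 \<in> \<Union>K"
      then obtain a where a: "a \<in> K" "f0 \<in> a" by blast
      with UN have "\<forall>\<^sub>F k in sequentially. f k \<in> a" by blast
      then show "\<forall>\<^sub>F k in sequentially. f k \<in> \<Union>K" by eventually_elim (use a(1) in blast)
    qed
  next
    case (Basis V)
    then obtain b U where V: "V = {f \<in> L1_space M. dual_pairing M f b \<in> U}" "b \<in> Linf_dual M" "open U"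
      by blast
    show ?case
    proof
      assume "f0 \<in> V"
      then have "\<forall>\<^sub>F k in sequentially. dual_pairing M (f k) b \<in> U"
        using bspec[OF lim V(2)] V by (auto intro: topological_tendstoD)
      then show "\<forall>\<^sub>F k in sequentially. f k \<in> V" by eventually_elim (simp add: V(1) f)
    qed
  qed simp
  then show "limitin (sigma_L1_Linf M) f f0 sequentially"
    unfolding limitin_def using top by (auto simp: sigma_L1_Linf_def openin_topology_generated_by_iff)
qed

context finite_measure
begin

lemma dual_pairing_eq_integral:
  assumes f: "L1_regular M f" and b: "simple_limit M b" "\<And>w. w \<in> space M \<Longrightarrow> norm (b w) \<le> C"
  shows "dual_pairing M f b = pair f b"
  unfolding dual_pairing_def pair_def
  by (rule Bochner_int_eq_lebesgue_integral[OF integrable_pairing[OF f b]])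

lemma dual_ball_Linf_dual: "b \<in> dual_ball \<Longrightarrow> b \<in> Linf_dual M"
  by (auto simp: dual_ball_def Linf_dual_def bounded_iff intro!: strongly_measurable_simple_limit)

text \<open>Pass to an everywhere limit, whose substituted zeros keep the bound, and divide by
  \<open>C = \<bar>K\<bar> + 1\<close>. The bound is known on \<open>space M\<close> only, so
  \<open>c\<close> is set to zero elsewhere.\<close>

lemma Linf_dual_scaled_dual_ball:
  fixes b :: "'a \<Rightarrow> 'b::real_normed_vector \<Rightarrow>\<^sub>L real"
  assumes b: "b \<in> Linf_dual M"
  shows "\<exists>c\<in>dual_ball. \<exists>C>0. \<forall>f. L1_regular M f \<longrightarrow> dual_pairing M f b = C * pair f c"
proof -
  obtain b' where b': "simple_limit M b'" "AE w in M. b' w = b w" "\<And>w. b' w = b w \<or> b' w = 0"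
    using b strongly_measurable_simple_limit_version[of M b] by (auto simp: Linf_dual_def)
  obtain K where K: "\<And>w. w \<in> space M \<Longrightarrow> norm (b w) \<le> K"
    using b by (auto simp: Linf_dual_def bounded_iff)
  define C where "C = \<bar>K\<bar> + 1"
  have C: "C > 0" by (simp add: C_def)
  have b'C: "norm (b' w) \<le> C" if "w \<in> space M" for w
    using b'(3)[of w] K[OF that] by (auto simp: C_def)
  define c where "c w = (indicator (space M) w / C) *\<^sub>R b' w" for w
  have "simple_limit M (\<lambda>w. indicator (space M) w / C)"
    using simple_limit_compose2[OF simple_limit_indicator[of "space M" M] simple_limit_const[of M C], of "(/)"] C
    by (simp add: simple_limit_simple_function)
  then have "simple_limit M c" unfolding c_def using b'(1) by (rule simple_limit_scaleR)
  moreover have "norm (c w) \<le> 1" for w using b'C[of w] C by (simp add: c_def indicator_def)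
  ultimately have "c \<in> dual_ball" by (simp add: dual_ball_def)
  moreover have "dual_pairing M f b = C * pair f c" if f: "L1_regular M f" for f
  proof -
    have "dual_pairing M f b = dual_pairing M f b'"
      unfolding dual_pairing_def using b'(2) by (intro Bochner_int_cong_AE) auto
    also have "\<dots> = pair f b'" by (rule dual_pairing_eq_integral[OF f b'(1) b'C])
    also have "\<dots> = (\<integral>w. C * blinfun_apply (c w) (f w) \<partial>M)"
      unfolding pair_def using C
      by (intro Bochner_Integration.integral_cong) (auto simp: c_def blinfun.scaleR_left)
    also have "\<dots> = C * pair f c" by (simp add: pair_def)
    finally show ?thesis .
  qed
  ultimately show ?thesis using C by blast
qed

lemma sigma_convergence_iff_pair:
  fixes f :: "nat \<Rightarrow> 'a \<Rightarrow> 'b::banach"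
  assumes f: "\<And>k. L1_regular M (f k)" and f0: "L1_regular M f0"
  shows "limitin (sigma_L1_Linf M) f f0 sequentially \<longleftrightarrow>
    (\<forall>b\<in>dual_ball. (\<lambda>k. pair (\<lambda>w. f k w - f0 w) b) \<longlonglongrightarrow> 0)"
proof -
  have diff: "pair (\<lambda>w. f k w - f0 w) b = pair (f k) b - pair f0 b" if "b \<in> dual_ball" for b k
    using integrable_pair[OF f that] integrable_pair[OF f0 that] by (simp add: pair_def blinfun.diff_right)
  have "(\<forall>b\<in>Linf_dual M. (\<lambda>k. dual_pairing M (f k) b) \<longlonglongrightarrow> dual_pairing M f0 b) \<longleftrightarrow>
      (\<forall>b\<in>dual_ball. (\<lambda>k. pair (f k) b) \<longlonglongrightarrow> pair f0 b)"
  proof (intro iffI ballI)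
    fix b :: "'a \<Rightarrow> 'b \<Rightarrow>\<^sub>L real"
    assume *: "\<forall>b\<in>Linf_dual M. (\<lambda>k. dual_pairing M (f k) b) \<longlonglongrightarrow> dual_pairing M f0 b" and b: "b \<in> dual_ball"
    have "dual_pairing M h b = pair h b" if "L1_regular M h" for h
      using b by (intro dual_pairing_eq_integral[OF that, of b 1]) (auto simp: dual_ball_def)
    then show "(\<lambda>k. pair (f k) b) \<longlonglongrightarrow> pair f0 b"
      using bspec[OF * dual_ball_Linf_dual[OF b]] f f0 by simp
  next
    fix b :: "'a \<Rightarrow> 'b \<Rightarrow>\<^sub>L real"
    assume *: "\<forall>b\<in>dual_ball. (\<lambda>k. pair (f k) b) \<longlonglongrightarrow> pair f0 b" and b: "b \<in> Linf_dual M"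
    obtain c C where c: "c \<in> dual_ball" "\<And>h. L1_regular M h \<Longrightarrow> dual_pairing M h b = C * pair h c"
      using Linf_dual_scaled_dual_ball[OF b] by blast
    show "(\<lambda>k. dual_pairing M (f k) b) \<longlonglongrightarrow> dual_pairing M f0 b"
      using tendsto_mult_left[OF bspec[OF * c(1)], of C] c(2) f f0 by simp
  qed
  then show ?thesis
    unfolding limitin_sigma_L1_Linf_iff[OF L1_space_regular[OF f] L1_space_regular[OF f0]]
    using LIM_zero_iff by (auto simp: diff)
qed

lemma weakly_convergent_means:
  fixes f :: "nat \<Rightarrow> 'a \<Rightarrow> 'b::banach" and x :: "'b \<Rightarrow>\<^sub>L real"
  assumes f: "\<And>k. L1_regular M (f k)" and f0: "L1_regular M f0"
    and weak: "\<forall>b\<in>dual_ball. (\<lambda>k. pair (\<lambda>w. f k w - f0 w) b) \<longlonglongrightarrow> 0" and B: "B \<in> pos_sets M"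
  shows "(\<lambda>k. blinfun_apply x (mean_on M B (f k))) \<longlonglongrightarrow> blinfun_apply x (mean_on M B f0)"
proof -
  have BM: "B \<in> sets M" using B by (auto simp: pos_sets_def)
  define C where "C = norm x + 1"
  have C: "C > 0" using norm_ge_zero[of x] unfolding C_def by linarith
  \<comment> \<open>Testing with \<open>x\<close> on \<open>B\<close> recovers the mean up to a
    factor; dividing by \<open>C\<close> puts the test function into the ball.\<close>
  define b where "b w = indicator B w *\<^sub>R (x /\<^sub>R C)" for w
  have b: "b \<in> dual_ball"
    unfolding dual_ball_def
  proof (intro CollectI conjI allI)
    show "simple_limit M b"
      unfolding b_def by (intro simple_limit_scaleR simple_limit_indicator BM simple_limit_const)
    show "norm (b w) \<le> 1" for w
      using C by (simp add: b_def indicator_def C_def field_simps)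
  qed
  have eq: "C / measure M B * pair h b = blinfun_apply x (mean_on M B h)" if h: "L1_regular M h" for h
  proof -
    have "C * pair h b = (\<integral>w. C * blinfun_apply (b w) (h w) \<partial>M)" by (simp add: pair_def)
    also have "\<dots> = (\<integral>w. indicator B w * blinfun_apply x (h w) \<partial>M)"
      using C by (intro Bochner_Integration.integral_cong) (auto simp: b_def blinfun.scaleR_left)
    finally show ?thesis by (simp add: functional_mean_on[OF h BM])
  qed
  have "(\<lambda>k. pair (\<lambda>w. f k w - f0 w) b) \<longlonglongrightarrow> 0" using weak b by blast
  then have "(\<lambda>k. pair (f k) b - pair f0 b) \<longlonglongrightarrow> 0"
    using integrable_pair[OF f b] integrable_pair[OF f0 b] by (simp add: pair_def blinfun.diff_right)
  then have "(\<lambda>k. pair (f k) b) \<longlonglongrightarrow> pair f0 b" by (rule LIM_zero_cancel)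
  then have "(\<lambda>k. C / measure M B * pair (f k) b) \<longlonglongrightarrow> C / measure M B * pair f0 b"
    by (rule tendsto_mult_left)
  then show ?thesis unfolding eq[OF f] eq[OF f0] .
qed

text \<open>The two third conditions are interchangeable next to the first: weak convergence makes
  the means converge weakly, which relative compactness upgrades to norm convergence, and a
  convergent sequence has relatively compact range.\<close>

lemma Pettis_convergence_characterization:
  fixes f :: "nat \<Rightarrow> 'a \<Rightarrow> 'b::banach"
  assumes f: "\<And>k. L1_regular M (f k)" and f0: "L1_regular M f0"
  defines "lhs \<equiv> (\<lambda>k. Pettis_norm M (\<lambda>w. f k w - f0 w)) \<longlonglongrightarrow> 0 \<and> uniformly_integrable M (range f)"
    and "weak \<equiv> limitin (sigma_L1_Linf M) f f0 sequentially"
    and "cpt \<equiv> \<forall>B\<in>pos_sets M. compact (closure (range (\<lambda>k. mean_on M B (f k))))"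
    and "means \<equiv> \<forall>B\<in>pos_sets M. (\<lambda>k. norm (mean_on M B (f k) - mean_on M B f0)) \<longlonglongrightarrow> 0"
  shows "lhs \<longleftrightarrow> weak \<and> seq_Pettis_Bocce M f \<and> cpt" and "lhs \<longleftrightarrow> weak \<and> seq_Pettis_Bocce M f \<and> means"
proof -
  have lhs_iff: "lhs \<longleftrightarrow> Pettis_null (\<lambda>k w. f k w - f0 w) \<and> unif_int f"
    unfolding lhs_def Pettis_norm_tendsto_0_iff[OF L1_regular_diff[OF f f0]] uniformly_integrable_iff_unif_int[OF f] ..
  have means_iff: "means \<longleftrightarrow> (\<forall>B\<in>pos_sets M. (\<lambda>k. mean_on M B (f k)) \<longlonglongrightarrow> mean_on M B f0)"
    unfolding means_def by (simp add: tendsto_norm_zero_iff LIM_zero_iff)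
  have weak_iff: "weak \<longleftrightarrow> (\<forall>b\<in>dual_ball. (\<lambda>k. pair (\<lambda>w. f k w - f0 w) b) \<longlonglongrightarrow> 0)"
    unfolding weak_def by (rule sigma_convergence_iff_pair[OF f f0])
  have lhs: "weak \<and> seq_Pettis_Bocce M f \<and> means" if "lhs"
    using that Pettis_null_imp_weakly_null[of f f0, OF f f0]
      Pettis_null_imp_seq_Pettis_Bocce[of f f0, OF f f0] Pettis_null_imp_mean_on_tendsto[of f f0, OF f f0]
    unfolding lhs_iff means_iff weak_iff by blast
  have conv: "lhs" if "weak" "seq_Pettis_Bocce M f" "means"
  proof -
    have ui: "unif_int f" by (rule weakly_convergent_unif_int[OF f f0 that(1)[unfolded weak_iff]])
    show ?thesis
      using seq_Pettis_Bocce_imp_Pettis_null[OF f f0 ui that(2) that(3)[unfolded means_iff]] ui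
      unfolding lhs_iff by blast
  qed
  have cpt_means: "means" if "weak" "cpt"
    unfolding means_iff
  proof
    fix B assume B: "B \<in> pos_sets M"
    show "(\<lambda>k. mean_on M B (f k)) \<longlonglongrightarrow> mean_on M B f0"
    proof (rule tendsto_if_weakly_tendsto_relatively_compact)
      show "compact (closure (range (\<lambda>k. mean_on M B (f k))))" using that(2) B unfolding cpt_def by blast
    qed (rule weakly_convergent_means[OF f f0 that(1)[unfolded weak_iff] B])
  qed
  have means_cpt: "cpt" if "means"
    unfolding cpt_def
  proof
    fix B assume B: "B \<in> pos_sets M"
    then have "(\<lambda>k. mean_on M B (f k)) \<longlonglongrightarrow> mean_on M B f0" using that unfolding means_iff by blast
    then show "compact (closure (range (\<lambda>k. mean_on M B (f k))))" by (rule compact_closure_range_of_tendsto)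
  qed
  show "lhs \<longleftrightarrow> weak \<and> seq_Pettis_Bocce M f \<and> cpt" and "lhs \<longleftrightarrow> weak \<and> seq_Pettis_Bocce M f \<and> means"
    using lhs conv cpt_means means_cpt by blast+
qed

end

section \<open>Continuous linear functionals on \<open>L1\<close> and their densities\<close>

lemma L1_on_scaleR: "L1_on M A (\<lambda>w. c *\<^sub>R f w) = \<bar>c\<bar> * L1_on M A f"
proof -
  have "L1_on M A (\<lambda>w. c *\<^sub>R f w) = (\<integral>w. \<bar>c\<bar> * (indicator A w * norm (f w)) \<partial>M)"
    unfolding L1_on_def by (intro Bochner_Integration.integral_cong) auto
  then show ?thesis by (simp add: L1_on_def)
qed

lemma L1_norm_regular: "L1_regular M f \<Longrightarrow> L1_norm M f = ennreal (L1_on M (space M) f)"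
  unfolding L1_norm_def by (simp add: nn_integral_norm_L1_regular L1_on_space)

context
  fixes M :: "'w measure" and \<phi> :: "('w \<Rightarrow> 'b::banach) \<Rightarrow> real"
  assumes \<phi>: "L1_continuous_linear_functional M \<phi>"
begin

lemma functional_add: "f \<in> L1_space M \<Longrightarrow> g \<in> L1_space M \<Longrightarrow> \<phi> (\<lambda>w. f w + g w) = \<phi> f + \<phi> g"
  and functional_scaleR: "f \<in> L1_space M \<Longrightarrow> \<phi> (\<lambda>w. c *\<^sub>R f w) = c * \<phi> f"
  and functional_continuous: "f \<in> L1_space M \<Longrightarrow> e > 0 \<Longrightarrow>
    \<exists>d>0. \<forall>g\<in>L1_space M. L1_norm M (\<lambda>w. g w - f w) < ennreal d \<longrightarrow> \<bar>\<phi> g - \<phi> f\<bar> < e"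
  using \<phi> unfolding L1_continuous_linear_functional_def by blast+

text \<open>Functionals act on functions, not on classes, so this rests on continuity: an almost
  everywhere modification lies at distance 0, and continuity with tolerance
  \<open>\<bar>\<phi> g - \<phi> f\<bar>\<close> would make this number smaller than itself.\<close>

lemma functional_cong_AE:
  assumes f: "f \<in> L1_space M" and g: "g \<in> L1_space M" and eq: "AE w in M. g w = f w"
  shows "\<phi> g = \<phi> f"
proof (rule ccontr)
  assume "\<phi> g \<noteq> \<phi> f"
  then have "\<bar>\<phi> g - \<phi> f\<bar> > 0" by simp
  from functional_continuous[OF f this] obtain d where d: "d > 0"
    "\<And>g'. g' \<in> L1_space M \<Longrightarrow> L1_norm M (\<lambda>w. g' w - f w) < ennreal d \<Longrightarrow> \<bar>\<phi> g' - \<phi> f\<bar> < \<bar>\<phi> g - \<phi> f\<bar>"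
    by blast
  have "L1_norm M (\<lambda>w. g w - f w) = (\<integral>\<^sup>+w. 0 \<partial>M)"
    unfolding L1_norm_def using eq by (intro nn_integral_cong_AE) auto
  then show False using d(2)[OF g] d(1) by simp
qed

lemma functional_diff:
  assumes f: "L1_regular M f" and g: "L1_regular M g"
  shows "\<phi> (\<lambda>w. f w - g w) = \<phi> f - \<phi> g"
  using functional_add[OF L1_space_regular[OF f] L1_space_regular[OF L1_regular_scaleR[OF g, of "- 1"]]]
    functional_scaleR[OF L1_space_regular[OF g], of "- 1"] by simp

lemma functional_bounded: "\<exists>C>0. \<forall>f. L1_regular M f \<longrightarrow> \<bar>\<phi> f\<bar> \<le> C * L1_on M (space M) f"
proof -
  have 0: "L1_regular M (\<lambda>_. 0 :: 'b)" by (simp add: L1_regular_def simple_limit_const)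
  have \<phi>0: "\<phi> (\<lambda>_. 0) = 0"
    using functional_scaleR[OF L1_space_regular[OF 0], of 0] by simp
  from functional_continuous[OF L1_space_regular[OF 0], of 1] obtain d where d: "d > 0"
    "\<And>g. g \<in> L1_space M \<Longrightarrow> L1_norm M (\<lambda>w. g w - 0) < ennreal d \<Longrightarrow> \<bar>\<phi> g - \<phi> (\<lambda>_. 0)\<bar> < 1"
    by force
  have small: "\<bar>\<phi> g\<bar> < 1" if g: "L1_regular M g" "L1_on M (space M) g < d" for g
    using d(2)[OF L1_space_regular[OF g(1)]] g \<phi>0 d(1) by (simp add: L1_norm_regular ennreal_less_iff L1_on_nonneg)
  have "\<bar>\<phi> f\<bar> \<le> 2 / d * L1_on M (space M) f" if f: "L1_regular M f" for f
  proof (rule field_le_epsilon)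
    fix \<eta> :: real assume \<eta>: "\<eta> > 0"
    define n where "n = L1_on M (space M) f"
    have n: "n \<ge> 0" by (simp add: n_def L1_on_nonneg)
    \<comment> \<open>Scaling by \<open>t > n\<close> instead of \<open>n\<close> covers
      \<open>n = 0\<close>; the surplus \<open>\<eta> * d / 2\<close> becomes the
      \<open>\<eta>\<close> of the limiting argument.\<close>
    define t where "t = n + \<eta> * d / 2"
    have t: "t > 0" "n < t" using n \<eta> d(1) by (auto simp: t_def intro: add_nonneg_pos)
    let ?g = "\<lambda>w. (d / (2 * t)) *\<^sub>R f w"
    have "L1_on M (space M) ?g = d / (2 * t) * n"
      using d(1) t by (simp add: L1_on_scaleR n_def)
    also have "\<dots> < d" using d(1) t n by (simp add: field_simps)
    finally have "\<bar>\<phi> ?g\<bar> < 1" by (rule small[OF L1_regular_scaleR[OF f]])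
    then have "d / (2 * t) * \<bar>\<phi> f\<bar> < 1"
      using functional_scaleR[OF L1_space_regular[OF f], of "d / (2 * t)"] d(1) t by (simp add: abs_mult)
    then have "\<bar>\<phi> f\<bar> < 2 * t / d" using d(1) t by (simp add: field_simps)
    also have "2 * t / d = 2 / d * n + \<eta>" using d(1) by (simp add: t_def field_simps)
    finally show "\<bar>\<phi> f\<bar> \<le> 2 / d * L1_on M (space M) f + \<eta>" by (simp add: n_def)
  qed
  then show ?thesis using d(1) by (intro exI[of _ "2 / d"]) auto
qed

end

text \<open>Together with finite additivity, the single estimate
  \<open>norm (G A) \<le> C * measure M A\<close> makes \<open>G\<close> countably additive, of
  bounded variation and continuous. The density obtained is merely integrable; it is shown to be
  essentially bounded, and cutting it off on a null set gives \<open>b\<close>. Agreement with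
  \<open>\<phi>\<close> passes from indicators times vectors to simple functions by linearity, and
  to all functions by density.\<close>

lemma (in finite_measure) RNP_functional_representation:
  fixes \<phi> :: "('a \<Rightarrow> 'b::banach) \<Rightarrow> real"
  assumes \<phi>: "L1_continuous_linear_functional M \<phi>" and RNP: "has_RNP_wrt M TYPE('b \<Rightarrow>\<^sub>L real)"
  shows "\<exists>b\<in>Linf_dual M. \<forall>f. L1_regular M f \<longrightarrow> \<phi> f = dual_pairing M f b"
proof -
  note add = functional_add[OF \<phi>] and scale = functional_scaleR[OF \<phi>] and cong = functional_cong_AE[OF \<phi>]
  obtain C where C: "C > 0" "\<And>f. L1_regular M f \<Longrightarrow> \<bar>\<phi> f\<bar> \<le> C * L1_on M (space M) f"
    using functional_bounded[OF \<phi>] by blast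
  define u where "u A x w = indicator A w *\<^sub>R x" for A and x :: 'b and w :: 'a
  have u: "L1_regular M (u A x)" if "A \<in> sets M" for A x
    unfolding u_def by (rule L1_regular_indicator[OF that L1_regular_const])
  have u_norm: "L1_on M (space M) (u A x) = norm x * measure M A" if "A \<in> sets M" for A x
  proof -
    have "L1_on M (space M) (u A x) = L1_on M A (\<lambda>_. x)"
      unfolding L1_on_space unfolding L1_on_def by (simp add: u_def)
    then show ?thesis by (simp add: L1_on_const[OF that])
  qed
  define G where "G A = Blinfun (\<lambda>x. \<phi> (u A x))" for A
  have G: "blinfun_apply (G A) x = \<phi> (u A x)" if A: "A \<in> sets M" for A x
  proof -
    have "bounded_linear (\<lambda>x. \<phi> (u A x))"
    proof (rule bounded_linear_intro[of _ "C * measure M A"])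
      show "\<phi> (u A (x + y)) = \<phi> (u A x) + \<phi> (u A y)" for x y
        using add[OF L1_space_regular[OF u[OF A]] L1_space_regular[OF u[OF A]], of x y]
        by (simp add: u_def[abs_def] scaleR_add_right)
      show "\<phi> (u A (c *\<^sub>R x)) = c *\<^sub>R \<phi> (u A x)" for c x
        using scale[OF L1_space_regular[OF u[OF A]], of c x]
        by (simp add: u_def[abs_def] mult.commute)
      show "norm (\<phi> (u A x)) \<le> norm x * (C * measure M A)" for x
        using C(2)[OF u[OF A], of x] by (simp add: u_norm[OF A] mult_ac)
    qed
    then show ?thesis by (simp add: G_def bounded_linear_Blinfun_apply)
  qed
  have norm_G: "norm (G A) \<le> C * measure M A" if A: "A \<in> sets M" for A
    using C(1) C(2)[OF u[OF A]] by (intro norm_blinfun_bound) (auto simp: G[OF A] u_norm[OF A] mult_ac)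
  have G_Un: "G (A \<union> B) = G A + G B" if AB: "A \<in> sets M" "B \<in> sets M" "A \<inter> B = {}" for A B
  proof (rule blinfun_eqI)
    fix x
    have "u (A \<union> B) x = (\<lambda>w. u A x w + u B x w)"
      using AB(3) by (auto simp: u_def fun_eq_iff indicator_def)
    then show "blinfun_apply (G (A \<union> B)) x = blinfun_apply (G A + G B) x"
      using add[OF L1_space_regular[OF u[OF AB(1)]] L1_space_regular[OF u[OF AB(2)]], of x x] AB
      by (simp add: G blinfun.add_left)
  qed
  have G_empty: "G {} = 0" using norm_G[of "{}"] by simp
  have G_UN: "G (\<Union>i<n. A i) = (\<Sum>i<n. G (A i))"
    if A: "range A \<subseteq> sets M" "disjoint_family A" for A :: "nat \<Rightarrow> 'a set" and n
  proof (induction n)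
    case (Suc n)
    have "A n \<inter> A i = {}" if "i < n" for i using disjoint_family_onD[OF A(2), of n i] that by simp
    then have "A n \<inter> (\<Union>i<n. A i) = {}" by blast
    moreover have "A i \<in> sets M" for i using A(1) by blast
    then have "A n \<in> sets M" "(\<Union>i<n. A i) \<in> sets M" by auto
    ultimately show ?case using G_Un[of "A n" "\<Union>i<n. A i"] Suc by (simp add: lessThan_Suc add.commute)
  qed (simp add: G_empty)
  have vm: "vector_measure M G"
    unfolding vector_measure_def
  proof (intro allI impI)
    fix A :: "nat \<Rightarrow> 'a set" assume A: "range A \<subseteq> sets M" "disjoint_family A"
    have AM: "A i \<in> sets M" for i using A(1) by blast
    let ?U = "\<lambda>n. \<Union>i<n. A i" and ?V = "\<Union>i. A i"
    have UM: "?U n \<in> sets M" "?V \<in> sets M" for n using AM by auto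
    have "(\<lambda>n. measure M (?U n)) \<longlonglongrightarrow> measure M (\<Union>n. ?U n)"
      using UM by (intro finite_Lim_measure_incseq) (auto simp: incseq_Suc_iff lessThan_Suc)
    moreover have "(\<Union>n. ?U n) = ?V" by auto
    ultimately have "(\<lambda>n. C * (measure M ?V - measure M (?U n))) \<longlonglongrightarrow> C * (measure M ?V - measure M ?V)"
      by (intro tendsto_intros) simp
    then have lim: "(\<lambda>n. C * (measure M ?V - measure M (?U n))) \<longlonglongrightarrow> 0" by simp
    have "(\<lambda>n. G ?V - (\<Sum>i<n. G (A i))) \<longlonglongrightarrow> 0"
    proof (rule Lim_null_comparison[OF always_eventually lim], rule allI)
      fix n
      have "?U n \<subseteq> ?V" by auto
      then have "?U n \<union> (?V - ?U n) = ?V" by auto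
      then have "G ?V = G (?U n) + G (?V - ?U n)"
        using G_Un[of "?U n" "?V - ?U n"] UM by (metis Diff_disjoint sets.Diff)
      then have "norm (G ?V - (\<Sum>i<n. G (A i))) = norm (G (?V - ?U n))" by (simp add: G_UN[OF A])
      also have "\<dots> \<le> C * measure M (?V - ?U n)" using UM by (intro norm_G) auto
      also have "measure M (?V - ?U n) = measure M ?V - measure M (?U n)"
        using UM by (intro finite_measure_Diff) auto
      finally show "norm (G ?V - (\<Sum>i<n. G (A i))) \<le> C * (measure M ?V - measure M (?U n))" .
    qed
    then have "(\<lambda>n. G ?V - (G ?V - (\<Sum>i<n. G (A i)))) \<longlonglongrightarrow> G ?V - 0" by (intro tendsto_intros)
    then show "(\<lambda>i. G (A i)) sums G ?V" by (simp add: sums_def)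
  qed
  have bv: "vm_bounded_variation M G"
    unfolding vm_bounded_variation_def
  proof (intro exI[of _ "C * measure M (space M)"] allI impI)
    fix P assume P: "finite P" "P \<subseteq> sets M" "partition_on (space M) P"
    have "(\<Sum>A\<in>P. norm (G A)) \<le> (\<Sum>A\<in>P. C * measure M A)"
      using P(2) norm_G by (intro sum_mono) auto
    also have "\<dots> = C * (\<Sum>A\<in>P. measure M A)" by (simp add: sum_distrib_left)
    also have "(\<Sum>A\<in>P. measure M A) = measure M (\<Union>A\<in>P. A)"
      using P by (intro finite_measure_finite_Union[symmetric])
        (auto simp: partition_on_def disjoint_family_on_def disjoint_def)
    also have "(\<Union>A\<in>P. A) = space M" using P(3) by (simp add: partition_on_def)
    finally show "(\<Sum>A\<in>P. norm (G A)) \<le> C * measure M (space M)" .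
  qed
  have ac: "vm_continuous M G"
    unfolding vm_continuous_def
  proof (intro allI impI)
    fix e :: real assume e: "e > 0"
    have "norm (G A) < e" if A: "A \<in> sets M" "emeasure M A < ennreal (e / C)" for A
    proof -
      have "measure M A < e / C"
        using A(2) by (simp add: emeasure_eq_measure ennreal_less_iff)
      then have "C * measure M A < e" using C(1) by (simp add: field_simps)
      then show ?thesis using norm_G[OF A(1)] by linarith
    qed
    then show "\<exists>d>0. \<forall>A\<in>sets M. emeasure M A < ennreal d \<longrightarrow> norm (G A) < e"
      using e C(1) by (intro exI[of _ "e / C"]) auto
  qed
  obtain g0 where g0: "g0 \<in> L1_space M" "\<And>A. A \<in> sets M \<Longrightarrow> G A = Bochner_set_int M A g0"
    using RNP vm bv ac unfolding has_RNP_wrt_def by blast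
  obtain g where g: "L1_regular M g" "AE w in M. g w = g0 w"
    using L1_space_regular_version[OF g0(1)] by blast
  have Gg: "G A = Bochner_set_int M A g" if "A \<in> sets M" for A
  proof -
    have "Bochner_set_int M A g0 = Bochner_set_int M A g"
      unfolding Bochner_set_int_def using g(2) by (intro Bochner_int_cong_AE) auto
    then show ?thesis using g0(2)[OF that] by simp
  qed
  \<comment> \<open>On a set where \<open>g\<close> stays within 1 of a vector \<open>c\<close>, its
    mean has norm at most \<open>C\<close>, so \<open>norm c \<le> C + 1\<close> and
    \<open>norm (g w) \<le> C + 2\<close>. The level \<open>C + 3\<close> is therefore reached only
    on a null set.\<close>
  let ?B = "norm_tail M (C + 3) g"
  have BM: "?B \<in> sets M" by (rule norm_tail_sets[OF g(1)])
  have null: "?B \<in> null_sets M"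
  proof (rule ccontr)
    assume "?B \<notin> null_sets M"
    then have "?B \<in> pos_sets M" using BM by (auto simp: pos_sets_def null_sets_def zero_less_iff_neq_zero)
    from exists_near_const[OF L1_regular_simple_limit[OF g(1)] zero_less_one this]
    obtain A c where A: "A \<in> pos_subsets M ?B" and c: "\<And>w. w \<in> A \<Longrightarrow> norm (g w - c) \<le> 1" by blast
    then have AM: "A \<in> sets M" "measure M A > 0" "A \<subseteq> ?B" by (auto simp: pos_subsets_def pos_sets_measure)
    have mean: "norm (mean_on M A g) \<le> C"
      using norm_G[OF AM(1)] AM(2) by (simp add: mean_on_def Gg[OF AM(1), symmetric] divide_le_eq)
    have "norm (c - mean_on M A g) \<le> 1"
    proof (rule norm_le_dual)
      \<comment> \<open>The values of \<open>g\<close> are functionals themselves, so the duality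
        argument runs in the bidual.\<close>
      fix x :: "('b \<Rightarrow>\<^sub>L real) \<Rightarrow>\<^sub>L real" assume x: "norm x \<le> 1"
      let ?x = "\<lambda>w. blinfun_apply x (g w)" and ?c = "\<lambda>_::'a. blinfun_apply x c"
      note reg = L1_regular_functional[OF g(1), of x] L1_regular_const[of "blinfun_apply x c"]
      have "blinfun_apply x (c - mean_on M A g) = - mean_on M A (\<lambda>w. ?x w - ?c w)"
        by (simp add: blinfun.diff_right functional_mean_on_eq[OF g(1) AM(1)] mean_on_diff[OF reg AM(1)]
            mean_on_const[OF AM(1,2)])
      also have "\<dots> \<le> 1"
      proof -
        have "\<bar>mean_on M A (\<lambda>w. ?x w - ?c w)\<bar> * measure M A \<le> L1_on M A (\<lambda>w. ?x w - ?c w)"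
          by (rule abs_mean_on_le[OF L1_regular_diff[OF reg] AM(1)])
        also have "\<dots> \<le> (\<integral>w. indicator A w \<partial>M)"
          unfolding L1_on_def
        proof (rule integral_mono)
          show "indicator A w * norm (?x w - ?c w) \<le> indicator A w" for w
            using c[of w] abs_blinfun_le[OF x, of "g w - c"] by (auto simp: indicator_def blinfun.diff_right)
        qed (use integrable_L1_on[OF L1_regular_diff[OF reg] AM(1)] integrable_indicator_finite[OF AM(1)] in auto)
        also have "\<dots> = 1 * measure M A" using AM(1) by simp
        finally have "\<bar>mean_on M A (\<lambda>w. ?x w - ?c w)\<bar> \<le> 1" using AM(2) by (rule mult_right_le_imp_le)
        then show ?thesis by linarith
      qed
      finally show "blinfun_apply x (c - mean_on M A g) \<le> 1" .
    qed
    then have nc: "norm c \<le> C + 1" using mean norm_triangle_ineq2[of c "mean_on M A g"] by linarith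
    obtain w where w: "w \<in> A" using AM(2) by fastforce
    have "norm (g w) \<le> C + 2" using c[OF w] nc norm_triangle_ineq2[of "g w" c] by linarith
    moreover have "norm (g w) \<ge> C + 3" using w AM(3) by (auto simp: norm_tail_def)
    ultimately show False by simp
  qed
  \<comment> \<open>Zero on the null tail and outside the space, so that the bound
    \<open>C + 3\<close> holds everywhere.\<close>
  define b where "b w = indicator (space M - ?B) w *\<^sub>R g w" for w
  have b: "simple_limit M b" "norm (b w) \<le> C + 3" for w
  proof -
    show "simple_limit M b"
      unfolding b_def using BM g(1) by (intro simple_limit_scaleR simple_limit_indicator L1_regular_simple_limit) auto
    show "norm (b w) \<le> C + 3" using C(1) by (auto simp: b_def norm_tail_def indicator_def)
  qed
  have bg: "AE w in M. b w = g w"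
    using AE_not_in[OF null] AE_space by eventually_elim (simp add: b_def)
  note ib = integrable_pairing[OF _ b]
  have ind: "\<phi> (u A x) = pair (u A x) b" if A: "A \<in> sets M" for A x
  proof -
    \<comment> \<open>Evaluation at \<open>x\<close>, an element of the bidual, carries the identity
      for \<open>G A\<close> over to scalar integrals.\<close>
    define ev where "ev = Blinfun (\<lambda>T :: 'b \<Rightarrow>\<^sub>L real. blinfun_apply T x)"
    have ev: "blinfun_apply ev T = blinfun_apply T x" for T
      unfolding ev_def by (subst bounded_linear_Blinfun_apply) (auto intro: bounded_linear_intros)
    have "\<phi> (u A x) = blinfun_apply ev (Bochner_set_int M A g)"
      using G[OF A, of x] by (simp add: ev Gg[OF A])
    also have "\<dots> = (\<integral>w. indicator A w * blinfun_apply (g w) x \<partial>M)"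
      by (simp add: functional_Bochner_set_int[OF g(1) A] ev)
    also have "\<dots> = (\<integral>w. blinfun_apply (b w) (u A x w) \<partial>M)"
    proof (rule integral_cong_AE)
      show "(\<lambda>w. indicator A w * blinfun_apply (g w) x) \<in> borel_measurable M"
        using integrable_mult_indicator[OF A integrable_functional[OF g(1), of ev]] by (simp add: ev)
      show "(\<lambda>w. blinfun_apply (b w) (u A x w)) \<in> borel_measurable M" using ib[OF u[OF A]] by simp
      show "AE w in M. indicator A w * blinfun_apply (g w) x = blinfun_apply (b w) (u A x w)"
        using bg by eventually_elim (simp add: u_def blinfun.scaleR_right)
    qed
    finally show ?thesis by (simp add: pair_def)
  qed
  have simple: "\<phi> s = pair s b" if s: "simple_function M s" for s
  proof -
    let ?A = "\<lambda>y. s -` {y} \<inter> space M"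
    have A: "?A y \<in> sets M" for y by (rule simple_functionD(2)[OF s])
    have sum: "L1_regular M (\<lambda>w. \<Sum>y\<in>F. u (?A y) y w) \<and>
        \<phi> (\<lambda>w. \<Sum>y\<in>F. u (?A y) y w) = pair (\<lambda>w. \<Sum>y\<in>F. u (?A y) y w) b" if "finite F" for F
      using that
    proof induction
      case empty
      have "u {} 0 = (\<lambda>w. 0)" by (simp add: u_def fun_eq_iff)
      then show ?case using ind[of "{}" 0] u[of "{}" 0] by simp
    next
      case (insert y F)
      let ?S = "\<lambda>w. \<Sum>y\<in>F. u (?A y) y w"
      have eq: "(\<lambda>w. \<Sum>y\<in>insert y F. u (?A y) y w) = (\<lambda>w. u (?A y) y w + ?S w)"
        using insert by simp
      have S: "L1_regular M ?S" "\<phi> ?S = pair ?S b" using insert by auto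
      have "pair (\<lambda>w. u (?A y) y w + ?S w) b = pair (u (?A y) y) b + pair ?S b"
        using ib[OF u[OF A]] ib[OF S(1)] by (simp add: pair_def blinfun.add_right)
      then show ?case
        unfolding eq using add[OF L1_space_regular[OF u[OF A]] L1_space_regular[OF S(1)]] ind[OF A] S
          L1_regular_add[OF u[OF A] S(1)] by simp
    qed
    let ?T = "\<lambda>w. \<Sum>y\<in>s ` space M. u (?A y) y w"
    have T: "L1_regular M ?T" "\<phi> ?T = pair ?T b" using sum[OF simple_functionD(1)[OF s]] by auto
    have eq: "?T w = s w" if w: "w \<in> space M" for w
    proof -
      have "?T w = (\<Sum>y\<in>s ` space M. if y = s w then y else 0)"
        using w by (intro sum.cong) (auto simp: u_def indicator_def)
      then show ?thesis using simple_functionD(1)[OF s] w by simp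
    qed
    have s_reg: "L1_regular M s"
      using eq by (intro L1_regular_bound[OF simple_limit_simple_function[OF s] L1_regular_norm[OF T(1)]]) simp
    \<comment> \<open>The representing sum agrees with \<open>s\<close> only on
      \<open>space M\<close>, hence the appeal to invariance under almost everywhere
      equality.\<close>
    have "\<phi> s = \<phi> ?T"
      using eq by (intro cong L1_space_regular s_reg T(1) AE_I2) simp
    moreover have "pair s b = pair ?T b"
      unfolding pair_def using eq by (intro Bochner_Integration.integral_cong) auto
    ultimately show ?thesis using T(2) by simp
  qed
  have "\<phi> f = dual_pairing M f b" if f: "L1_regular M f" for f
  proof -
    obtain s where s: "\<And>i::nat. simple_function M (s i)" "\<And>i. L1_regular M (s i)"
        "(\<lambda>i. \<integral>w. norm (f w - s i w) \<partial>M) \<longlonglongrightarrow> 0"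
      using L1_regular_simple_approx_integral[OF f] by blast
    let ?n = "\<lambda>i. \<integral>w. norm (f w - s i w) \<partial>M"
    \<comment> \<open>The factor is \<open>C\<close> for the functional plus \<open>C + 3\<close>
      for the pairing with \<open>b\<close>.\<close>
    have "\<bar>\<phi> f - pair f b\<bar> \<le> (2 * C + 3) * ?n i" for i
    proof -
      note d = L1_regular_diff[OF f s(2)]
      have "\<bar>\<phi> f - \<phi> (s i)\<bar> \<le> C * ?n i"
        using C(2)[OF d[of i]] by (simp add: functional_diff[OF \<phi> f s(2)] L1_on_space)
      moreover have "\<bar>pair f b - pair (s i) b\<bar> \<le> (C + 3) * ?n i"
      proof -
        have "pair f b - pair (s i) b = (\<integral>w. blinfun_apply (b w) (f w - s i w) \<partial>M)"
          using ib[OF f] ib[OF s(2)] by (simp add: pair_def blinfun.diff_right)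
        also have "\<bar>\<dots>\<bar> \<le> (\<integral>w. \<bar>blinfun_apply (b w) (f w - s i w)\<bar> \<partial>M)" by (rule integral_abs_bound)
        also have "\<dots> \<le> (\<integral>w. (C + 3) * norm (f w - s i w) \<partial>M)"
        proof (rule integral_mono)
          show "\<bar>blinfun_apply (b w) (f w - s i w)\<bar> \<le> (C + 3) * norm (f w - s i w)" for w
            using norm_blinfun[of "b w" "f w - s i w"] mult_right_mono[OF b(2)[of w] norm_ge_zero[of "f w - s i w"]]
            by simp
        qed (use ib[OF d] L1_regular_norm[OF d] in auto)
        finally show ?thesis by simp
      qed
      ultimately show ?thesis using simple[OF s(1)[of i]] by (simp add: algebra_simps)
    qed
    moreover have "(\<lambda>i. (2 * C + 3) * ?n i) \<longlonglongrightarrow> 0" using tendsto_mult_right_zero[OF s(3)] by simp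
    ultimately have "\<bar>\<phi> f - pair f b\<bar> \<le> 0" by (intro LIMSEQ_le_const) auto
    then show ?thesis using dual_pairing_eq_integral[OF f b] by simp
  qed
  moreover have "b \<in> Linf_dual M"
    using b by (auto simp: Linf_dual_def bounded_iff intro!: strongly_measurable_simple_limit)
  ultimately show ?thesis by blast
qed

text \<open>\<open>dual_pairing\<close> depends only on the almost everywhere class, so linearity is
  checked on \<open>L1_regular\<close> versions, where it is linearity of Lebesgue integrals.
  Continuity holds with \<open>d = e / C\<close>, where \<open>C\<close> bounds the scaled test
  function.\<close>

lemma (in finite_measure) L1_functional_of_Linf_dual:
  fixes b :: "'a \<Rightarrow> 'b::banach \<Rightarrow>\<^sub>L real"
  assumes b: "b \<in> Linf_dual M"
  shows "L1_continuous_linear_functional M (\<lambda>f. dual_pairing M f b)"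
proof -
  obtain c C where c: "c \<in> dual_ball" "C > 0" "\<And>h. L1_regular M h \<Longrightarrow> dual_pairing M h b = C * pair h c"
    using Linf_dual_scaled_dual_ball[OF b] by blast
  have ver: "\<exists>f'. L1_regular M f' \<and> (AE w in M. f' w = f w) \<and> dual_pairing M f b = C * pair f' c"
    if f: "f \<in> L1_space M" for f
  proof -
    obtain f' where f': "L1_regular M f'" "AE w in M. f' w = f w"
      using L1_space_regular_version[OF f] by blast
    then show ?thesis using dual_pairing_cong_AE[OF f'(2), of b] c(3)[OF f'(1)] by auto
  qed
  have pair_le: "\<bar>pair h c\<bar> \<le> L1_on M (space M) h" if h: "L1_regular M h" for h
  proof -
    have "\<bar>pair h c\<bar> \<le> (\<integral>w. \<bar>blinfun_apply (c w) (h w)\<bar> \<partial>M)"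
      unfolding pair_def by (rule integral_abs_bound)
    also have "\<dots> \<le> L1_on M (space M) h"
      unfolding L1_on_space
      using integrable_pair[OF h c(1)] L1_regular_norm[OF h] c(1)
      by (intro integral_mono) (auto simp: dual_ball_def abs_blinfun_le)
    finally show ?thesis .
  qed
  show ?thesis
    unfolding L1_continuous_linear_functional_def
  proof (intro conjI ballI allI impI)
    fix f g :: "'a \<Rightarrow> 'b" assume "f \<in> L1_space M" "g \<in> L1_space M"
    then obtain f' g' where f': "L1_regular M f'" "AE w in M. f' w = f w" "dual_pairing M f b = C * pair f' c"
      and g': "L1_regular M g'" "AE w in M. g' w = g w" "dual_pairing M g b = C * pair g' c"
      using ver by meson
    have "AE w in M. f w + g w = f' w + g' w" using f'(2) g'(2) by eventually_elim simp
    then have "dual_pairing M (\<lambda>w. f w + g w) b = C * pair (\<lambda>w. f' w + g' w) c"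
      using dual_pairing_cong_AE c(3)[OF L1_regular_add[OF f'(1) g'(1)]] by metis
    then show "dual_pairing M (\<lambda>w. f w + g w) b = dual_pairing M f b + dual_pairing M g b"
      using integrable_pair[OF f'(1) c(1)] integrable_pair[OF g'(1) c(1)]
      by (simp add: f' g' pair_def blinfun.add_right distrib_left)
  next
    fix a and f :: "'a \<Rightarrow> 'b" assume "f \<in> L1_space M"
    then obtain f' where f': "L1_regular M f'" "AE w in M. f' w = f w" "dual_pairing M f b = C * pair f' c"
      using ver by meson
    have "AE w in M. a *\<^sub>R f w = a *\<^sub>R f' w" using f'(2) by eventually_elim simp
    then have "dual_pairing M (\<lambda>w. a *\<^sub>R f w) b = C * pair (\<lambda>w. a *\<^sub>R f' w) c"
      using dual_pairing_cong_AE c(3)[OF L1_regular_scaleR[OF f'(1)]] by metis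
    then show "dual_pairing M (\<lambda>w. a *\<^sub>R f w) b = a * dual_pairing M f b"
      by (simp add: f' pair_def blinfun.scaleR_right)
  next
    fix f :: "'a \<Rightarrow> 'b" and e :: real assume f: "f \<in> L1_space M" and e: "e > 0"
    obtain f' where f': "L1_regular M f'" "AE w in M. f' w = f w" "dual_pairing M f b = C * pair f' c"
      using ver[OF f] by blast
    show "\<exists>d>0. \<forall>g\<in>L1_space M. L1_norm M (\<lambda>w. g w - f w) < ennreal d \<longrightarrow> \<bar>dual_pairing M g b - dual_pairing M f b\<bar> < e"
    proof (intro exI[of _ "e / C"] conjI ballI impI)
      show "e / C > 0" using e c(2) by simp
      fix g :: "'a \<Rightarrow> 'b" assume g: "g \<in> L1_space M" and less: "L1_norm M (\<lambda>w. g w - f w) < ennreal (e / C)"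
      obtain g' where g': "L1_regular M g'" "AE w in M. g' w = g w" "dual_pairing M g b = C * pair g' c"
        using ver[OF g] by blast
      let ?h = "\<lambda>w. g' w - f' w"
      have h: "L1_regular M ?h" by (rule L1_regular_diff[OF g'(1) f'(1)])
      have "L1_norm M (\<lambda>w. g w - f w) = L1_norm M ?h"
        unfolding L1_norm_def using f'(2) g'(2) by (intro nn_integral_cong_AE) auto
      then have "L1_on M (space M) ?h < e / C"
        using less by (simp add: L1_norm_regular[OF h] ennreal_less_iff L1_on_nonneg)
      then have "C * L1_on M (space M) ?h < e" using c(2) by (simp add: field_simps)
      moreover have "dual_pairing M g b - dual_pairing M f b = C * pair ?h c"
        using integrable_pair[OF f'(1) c(1)] integrable_pair[OF g'(1) c(1)]
        by (simp add: f' g' pair_def blinfun.diff_right right_diff_distrib)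
      moreover have "C * \<bar>pair ?h c\<bar> \<le> C * L1_on M (space M) ?h"
        using pair_le[OF h] c(2) by (intro mult_left_mono) auto
      moreover have "\<bar>C * pair ?h c\<bar> = C * \<bar>pair ?h c\<bar>" using c(2) by (simp add: abs_mult)
      ultimately show "\<bar>dual_pairing M g b - dual_pairing M f b\<bar> < e" by linarith
    qed
  qed
qed

text \<open>Pairings with elements of \<open>Linf_dual M\<close> are continuous functionals, and the
  Radon-Nikodym property makes every continuous functional such a pairing; both modes of convergence
  thus test the same functionals.\<close>

lemma (in finite_measure) sigma_convergence_iff_weak_convergence:
  fixes f :: "nat \<Rightarrow> 'a \<Rightarrow> 'b::banach"
  assumes f: "\<And>k. f k \<in> L1_space M" and f0: "f0 \<in> L1_space M"
    and RNP: "has_RNP_wrt M TYPE('b \<Rightarrow>\<^sub>L real)"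
  shows "limitin (sigma_L1_Linf M) f f0 sequentially \<longleftrightarrow> L1_weakly_convergent M f f0"
proof -
  have "L1_weakly_convergent M f f0 \<longleftrightarrow>
    (\<forall>b\<in>Linf_dual M. (\<lambda>k. dual_pairing M (f k) b) \<longlonglongrightarrow> dual_pairing M f0 b)"
    unfolding L1_weakly_convergent_def
  proof (intro iffI ballI allI impI)
    fix b :: "'a \<Rightarrow> 'b \<Rightarrow>\<^sub>L real"
    assume *: "\<forall>\<phi>. L1_continuous_linear_functional M \<phi> \<longrightarrow> (\<lambda>k. \<phi> (f k)) \<longlonglongrightarrow> \<phi> f0" and b: "b \<in> Linf_dual M"
    show "(\<lambda>k. dual_pairing M (f k) b) \<longlonglongrightarrow> dual_pairing M f0 b"
      using *[rule_format, OF L1_functional_of_Linf_dual[OF b]] .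
  next
    fix \<phi> :: "('a \<Rightarrow> 'b) \<Rightarrow> real"
    assume *: "\<forall>b\<in>Linf_dual M. (\<lambda>k. dual_pairing M (f k) b) \<longlonglongrightarrow> dual_pairing M f0 b"
      and \<phi>: "L1_continuous_linear_functional M \<phi>"
    obtain b where b: "b \<in> Linf_dual M" "\<And>h. L1_regular M h \<Longrightarrow> \<phi> h = dual_pairing M h b"
      using RNP_functional_representation[OF \<phi> RNP] by blast
    have eq: "\<phi> h = dual_pairing M h b" if h: "h \<in> L1_space M" for h
    proof -
      obtain h' where h': "L1_regular M h'" "AE w in M. h' w = h w"
        using L1_space_regular_version[OF h] by blast
      have "\<phi> h' = \<phi> h" by (rule functional_cong_AE[OF \<phi> h L1_space_regular[OF h'(1)] h'(2)])
      then show ?thesis using b(2)[OF h'(1)] dual_pairing_cong_AE[OF h'(2), of b] by simp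
    qed
    show "(\<lambda>k. \<phi> (f k)) \<longlonglongrightarrow> \<phi> f0"
      unfolding eq[OF f] eq[OF f0] using * b(1) by blast
  qed
  then show ?thesis using limitin_sigma_L1_Linf_iff[of f M f0, OF f f0] by simp
qed

section \<open>Invariance under almost everywhere equality\<close>

lemma Pettis_norm_cong_AE: "AE w in M. f w = g w \<Longrightarrow> Pettis_norm M f = Pettis_norm M g"
  unfolding Pettis_norm_def by (intro SUP_cong refl nn_integral_cong_AE) auto

lemma uniformly_integrable_cong_AE:
  assumes "\<And>k. AE w in M. f k w = g k w"
  shows "uniformly_integrable M (range f) \<longleftrightarrow> uniformly_integrable M (range g)"
proof -
  have eq: "(\<integral>\<^sup>+w\<in>{w \<in> space M. c \<le> norm (f k w)}. ennreal (norm (f k w)) \<partial>M) =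
      (\<integral>\<^sup>+w\<in>{w \<in> space M. c \<le> norm (g k w)}. ennreal (norm (g k w)) \<partial>M)" for c k
    using assms[of k] by (intro nn_integral_cong_AE) (auto simp: indicator_def)
  show ?thesis unfolding uniformly_integrable_def image_image eq ..
qed

lemma seq_Pettis_Bocce_cong_AE:
  assumes "\<And>k. AE w in M. f k w = g k w"
  shows "seq_Pettis_Bocce M f \<longleftrightarrow> seq_Pettis_Bocce M g"
proof -
  have "Pettis_Bocce_osc M (f k) A = Pettis_Bocce_osc M (g k) A" for k A
    unfolding Pettis_Bocce_osc_def
  proof (rule SUP_cong[OF refl])
    fix x :: "'b \<Rightarrow>\<^sub>L real"
    have eq: "AE w in M. blinfun_apply x (f k w) = blinfun_apply x (g k w)"
      using assms[of k] by eventually_elim simp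
    show "Bocce_osc M (\<lambda>w. blinfun_apply x (f k w)) A = Bocce_osc M (\<lambda>w. blinfun_apply x (g k w)) A"
      unfolding Bocce_osc_def mean_on_cong_AE[OF eq] using eq
      by (intro arg_cong[of _ _ "\<lambda>t. t / emeasure M A"] nn_integral_cong_AE) auto
  qed
  then show ?thesis unfolding seq_Pettis_Bocce_def by simp
qed

text \<open>All notions involved only depend on almost everywhere classes, so strongly measurable functions
  can be replaced by everywhere limits of simple functions, whose norms are Borel measurable.\<close>

theorem corollary5p12:
  fixes M :: "'w measure"
    and f :: "nat \<Rightarrow> 'w \<Rightarrow> 'a::banach"
    and f0 :: "'w \<Rightarrow> 'a"
  assumes "prob_space M"
    and "\<And>k. f k \<in> L1_space M"
    and "f0 \<in> L1_space M"
  shows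
    "(((\<lambda>k. Pettis_norm M (\<lambda>w. f k w - f0 w)) \<longlonglongrightarrow> 0 \<and> uniformly_integrable M (range f))
       \<longleftrightarrow>
      (limitin (sigma_L1_Linf M) f f0 sequentially \<and>
       seq_Pettis_Bocce M f \<and>
       (\<forall>B\<in>pos_sets M. compact (closure (range (\<lambda>k. mean_on M B (f k)))))))
     \<and>
     (((\<lambda>k. Pettis_norm M (\<lambda>w. f k w - f0 w)) \<longlonglongrightarrow> 0 \<and> uniformly_integrable M (range f))
       \<longleftrightarrow>
      (limitin (sigma_L1_Linf M) f f0 sequentially \<and>
       seq_Pettis_Bocce M f \<and>
       (\<forall>B\<in>pos_sets M. (\<lambda>k. norm (mean_on M B (f k) - mean_on M B f0)) \<longlonglongrightarrow> 0)))
     \<and>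
     (has_RNP TYPE('w) TYPE('a \<Rightarrow>\<^sub>L real) \<longrightarrow>
       (limitin (sigma_L1_Linf M) f f0 sequentially \<longleftrightarrow> L1_weakly_convergent M f f0))"
proof -
  interpret prob_space M by fact
  have "\<forall>k. \<exists>g. L1_regular M g \<and> (AE w in M. g w = f k w)"
    using L1_space_regular_version[OF assms(2)] by blast
  then obtain g where g: "\<And>k. L1_regular M (g k)" "\<And>k. AE w in M. g k w = f k w" by metis
  obtain g0 where g0: "L1_regular M g0" "AE w in M. g0 w = f0 w"
    using L1_space_regular_version[OF assms(3)] by blast
  have "AE w in M. g k w - g0 w = f k w - f0 w" for k
    using g(2)[of k] g0(2) by eventually_elim simp
  note eqs = Pettis_norm_cong_AE[OF this] uniformly_integrable_cong_AE[OF g(2)]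
    seq_Pettis_Bocce_cong_AE[OF g(2)] mean_on_cong_AE[OF g(2)] mean_on_cong_AE[OF g0(2)]
  have "limitin (sigma_L1_Linf M) g g0 sequentially \<longleftrightarrow> limitin (sigma_L1_Linf M) f f0 sequentially"
    unfolding limitin_sigma_L1_Linf_iff[of g M g0, OF L1_space_regular[OF g(1)] L1_space_regular[OF g0(1)]]
      limitin_sigma_L1_Linf_iff[of f M f0, OF assms(2,3)] dual_pairing_cong_AE[OF g(2)] dual_pairing_cong_AE[OF g0(2)] ..
  note main = Pettis_convergence_characterization[of g g0, OF g(1) g0(1), unfolded eqs this]
  have "has_RNP_wrt M TYPE('a \<Rightarrow>\<^sub>L real)" if "has_RNP TYPE('w) TYPE('a \<Rightarrow>\<^sub>L real)"
    using that finite_measure_axioms unfolding has_RNP_def by blast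
  then show ?thesis
    using main sigma_convergence_iff_weak_convergence[of f f0, OF assms(2,3)] by blast
qed

end
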